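(* For every $\beta\in(0,\alpha)$, $t>0$ and $x\in\mathbb{R}^d$, $$\int_{\mathbb{R}^d}\tilde p(t,x,y)|y|^\beta\,dy=|x|^\beta+(\kappa_\delta-\kappa_\beta)\int_0^t\int_{\mathbb{R}^d}\tilde p(s,x,y)|y|^{\beta-\alpha}\,dy\,ds.$$ In particular, $\int_{\mathbb{R}^d}\tilde p(t,x,y)|y|^\delta\,dy=|x|^\delta$ for all $t>0$, $x\in\mathbb{R}^d$.
   Context: Let $d\ge1$ be an integer, $\alpha\in(0,d\wedge2)$, $\delta\in(0,\alpha)$. Let $p(t,x,y)=p(t,x-y)$ be the heat kernel of $\Delta^{\alpha/2}=-(-\Delta)^{\alpha/2}$ on $\mathbb{R}^d$, i.e. the transition density of the rotationally symmetric $\alpha$-stable process $(X_t)$ (with $\int e^{i\xi\cdot z}p(t,z)dz=e^{-t|\xi|^\alpha}$). For $\beta\in(0,\alpha)$, $\kappa_\beta=\frac{2^\alpha\Gamma(\frac{\alpha-\beta}{2})\Gamma(\frac{d+\beta}{2})}{\Gamma(\frac{-\beta}{2})\Gamma(\frac{d+\beta-\alpha}{2})}$ with $\Gamma(-\beta/2)=\int_0^\infty r^{-1-\beta/2}(e^{-r}-1)dr$. Let $q(x)=\kappa_\delta|x|^{-\alpha}$. $\tilde p(t,x,y)$ is the symmetric kernel (satisfying Chapman–Kolmogorov) of the Feynman–Kac semigroup $\tilde P_tf(x)=\mathbb{E}^x[f(X_t)e^{\int_0^tq(X_s)ds}]$ for $x,y\ne0$, with $\tilde p(t,x,y)=0$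 if $x=0$ or $y=0$; it is the heat kernel of $\Delta^{\alpha/2}+q$. *)

theory Defs
  imports "HOL-Analysis.Analysis" "HOL-Probability.Probability"
begin

text \<open>Heat kernel p(t,z) of the fractional Laplacian on the Euclidean space 'a,
  given by Fourier inversion of exp(-t |xi|^alpha).\<close>
definition stable_kernel :: "real \<Rightarrow> real \<Rightarrow> 'a::euclidean_space \<Rightarrow> real" where
  "stable_kernel \<alpha> t z =
     (1 / (2 * pi) ^ DIM('a)) * (LINT \<xi>|lborel. exp (- t * norm \<xi> powr \<alpha>) * cos (\<xi> \<bullet> z))"

definition Gamma_neg_half :: "real \<Rightarrow> real" where
  "Gamma_neg_half \<beta> = (LINT r:{0<..}|lborel. r powr (-1 - \<beta>/2) * (exp (- r) - 1))"

definition kappa :: "nat \<Rightarrow> real \<Rightarrow> real \<Rightarrow> real" where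
  "kappa d \<alpha> \<beta> =
     2 powr \<alpha> * Gamma ((\<alpha> - \<beta>) / 2) * Gamma ((real d + \<beta>) / 2)
     / (Gamma_neg_half \<beta> * Gamma ((real d + \<beta> - \<alpha>) / 2))"

definition hardy_pot :: "real \<Rightarrow> real \<Rightarrow> 'a::euclidean_space \<Rightarrow> real" where
  "hardy_pot \<alpha> \<delta> x = kappa DIM('a) \<alpha> \<delta> / norm x powr \<alpha>"

definition stable_process ::
  "real \<Rightarrow> 'b measure \<Rightarrow> (real \<Rightarrow> 'b \<Rightarrow> 'a::euclidean_space) \<Rightarrow> 'a \<Rightarrow> bool" where
  "stable_process \<alpha> M X x \<longleftrightarrow>
     prob_space M \<and>
     (\<lambda>(s, \<omega>). X s \<omega>) \<in> borel_measurable (lborel \<Otimes>\<^sub>M M) \<and>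
     (AE \<omega> in M. X 0 \<omega> = x) \<and>
     (\<forall>s t. 0 \<le> s \<and> s < t \<longrightarrow>
        distributed M lborel (\<lambda>\<omega>. X t \<omega> - X s \<omega>) (\<lambda>z. ennreal (stable_kernel \<alpha> (t - s) z))) \<and>
     (\<forall>ts :: real list. sorted_wrt (<) ts \<and> ts \<noteq> [] \<and> hd ts \<ge> 0 \<longrightarrow>
        prob_space.indep_vars M (\<lambda>_. borel) (\<lambda>i \<omega>. X (ts ! Suc i) \<omega> - X (ts ! i) \<omega>)
          {..<length ts - 1})"

text \<open>Feynman-Kac weight exp(int_0^t q(X_s) ds); since q <= 0 here, a non-integrable
  integrand means the integral is -oo and the weight is 0.\<close>
definition fk_weight :: "('a \<Rightarrow> real) \<Rightarrow> (real \<Rightarrow> 'b \<Rightarrow> 'a) \<Rightarrow> real \<Rightarrow> 'b \<Rightarrow> real" where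
  "fk_weight q X t \<omega> =
     (if set_integrable lborel {0..t} (\<lambda>s. q (X s \<omega>))
      then exp (LINT s:{0..t}|lborel. q (X s \<omega>)) else 0)"

definition is_fk_kernel ::
  "real \<Rightarrow> real \<Rightarrow> (real \<Rightarrow> 'a::euclidean_space \<Rightarrow> 'a \<Rightarrow> real) \<Rightarrow> 'b itself \<Rightarrow> bool" where
  "is_fk_kernel \<alpha> \<delta> pt _ \<longleftrightarrow>
     (\<forall>t>0. \<forall>x y. pt t x y \<ge> 0) \<and>
     (\<forall>t>0. \<forall>x. pt t x \<in> borel_measurable borel) \<and>
     (\<forall>t>0. \<forall>x y. pt t x y = pt t y x) \<and>
     (\<forall>t>0. \<forall>y. pt t 0 y = 0 \<and> pt t y 0 = 0) \<and>
     (\<forall>s>0. \<forall>t>0. \<forall>x y. ennreal (pt (s + t) x y) =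
        (\<integral>\<^sup>+ z. ennreal (pt s x z * pt t z y) \<partial>lborel)) \<and>
     (\<forall>x. x \<noteq> 0 \<longrightarrow> (\<exists>(M :: 'b measure) X. stable_process \<alpha> M X x \<and>
        (\<forall>t>0. \<forall>f :: 'a \<Rightarrow> ennreal. f \<in> borel_measurable borel \<longrightarrow>
           (\<integral>\<^sup>+ y. f y * ennreal (pt t x y) \<partial>lborel) =
           (\<integral>\<^sup>+ \<omega>. f (X t \<omega>) * ennreal (fk_weight (hardy_pot \<alpha> \<delta>) X t \<omega>) \<partial>M))))"

end

theory Submission
  imports Defs
begin

text \<open>
  Write \<open>k y = |y|\<^sup>\<beta>\<close>, \<open>q = \<kappa>\<^sub>\<delta> |y|\<^bsup>-\<alpha>\<^esup> < 0\<close>, and let \<open>P\<^sub>t\<close> be the semigroup of the stable process.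

  Without potential, \<open>P\<^sub>t k x = k x - \<kappa>\<^sub>\<beta> \<integral>\<^sub>0\<^sup>t P\<^sub>s |.|\<^bsup>\<beta>-\<alpha>\<^esup> x ds\<close>: both \<open>|y|\<^sup>\<beta>\<close> and \<open>|y|\<^bsup>\<beta>-\<alpha>\<^esup>\<close> are mixtures of
  Gaussians \<open>exp (- u |y|\<^sup>2)\<close>, on which \<open>P\<^sub>t\<close> acts explicitly on the Fourier side, and after integrating over \<open>u\<close>
  both sides are multiples of \<open>\<integral> cos (\<xi> \<bullet> x) (1 - exp (- t |\<xi>|\<^sup>\<alpha>)) |\<xi>|\<^bsup>-d-\<beta>\<^esup> d\<xi>\<close>; the ratio of the constants is
  \<open>-\<kappa>\<^sub>\<beta>\<close>.  Letting \<open>\<beta> \<rightarrow> 0\<close> also shows \<open>E \<integral>\<^sub>0\<^sup>t |X\<^sub>s|\<^bsup>-\<alpha>\<^esup> ds < \<infinity>\<close> for a start away from \<open>0\<close>, so the weight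
  \<open>A\<^sub>t = exp (\<integral>\<^sub>0\<^sup>t q (X\<^sub>s) ds)\<close> is almost surely positive.

  With potential, insert \<open>1 - A\<^sub>t = \<integral>\<^sub>0\<^sup>t |q (X\<^sub>s)| A\<^sub>s ds\<close> into \<open>E [k (X\<^sub>t) (1 - A\<^sub>t)]\<close>, apply the Markov property at time
  \<open>s\<close> and the formula without potential to \<open>P\<^bsub>t-s\<^esub> k\<close>, and use the same identity for \<open>1 - A\<^sub>u\<close> backwards.  All terms
  are nonnegative and finite, so the result can be subtracted from the formula for \<open>E [k (X\<^sub>t)]\<close>.
\<close>

section \<open>One-dimensional Gamma-type integrals\<close>

text \<open>Formally \<Delta>^(\<alpha>/2) |y|^\<beta> = - \<kappa>_\<beta> |y|^(\<beta>-\<alpha>),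
  so \<Delta>^(\<alpha>/2) + q maps |y|^\<beta> to (\<kappa>_\<delta> - \<kappa>_\<beta>)
  |y|^(\<beta>-\<alpha>). The theorem is this identity integrated in time, and \<beta> = \<delta> is
  the harmonic case. Unbounded powers and a singular q are awkward for generators and perturbation
  series; the perturbation argument therefore runs through Tonelli in [0, \<infinity>], with a
  subtraction only at the end, once finiteness is known. Two weak inputs shape the rest. The kernel
  is only a Fourier inversion integral, with no visible sign or decay; Gaussians are the test
  functions because their pairing with it converges absolutely anyway. The process is jointly
  measurable but need not have regular paths, so functionals of its past are identified only almost
  surely.\<close>

lemma nn_integral_Gamma:
  fixes x c :: real
  assumes "x > 0" "c > 0"
  shows "(\<integral>\<^sup>+ r. ennreal (indicator {0<..} r * (r powr (x - 1) * exp (- c * r))) \<partial>lborel)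
           = ennreal (Gamma x / c powr x)"
proof -
  have 1: "(\<integral>\<^sup>+ r. ennreal (indicator {0<..} r * (r powr (x - 1) * exp (- r))) \<partial>lborel) = ennreal (Gamma x)"
  proof -
    have "(\<integral>\<^sup>+ r. ennreal (indicator {0..} r * (r powr (x - 1) / exp r)) \<partial>lborel) = ennreal (Gamma x)"
      by (rule nn_integral_has_integral_lebesgue[OF _ Gamma_integral_real[OF assms(1)]]) auto
    moreover have "indicator {0<..} r * (r powr (x - 1) * exp (- r)) = indicator {0..} r * (r powr (x - 1) / exp r)" for r :: real
      by (auto simp: indicator_def exp_minus divide_inverse)
    ultimately show ?thesis by simp
  qed
  have "ennreal (Gamma x) = ennreal c * (\<integral>\<^sup>+ r. ennreal (indicator {0<..} (c * r) * ((c * r) powr (x - 1) * exp (- (c * r)))) \<partial>lborel)"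
    unfolding 1[symmetric] by (subst nn_integral_real_affine[where c = c and t = 0]) (use assms in auto)
  also have "\<dots> = ennreal c * (\<integral>\<^sup>+ r. ennreal (c powr (x - 1)) * ennreal (indicator {0<..} r * (r powr (x - 1) * exp (- c * r))) \<partial>lborel)"
    using assms by (intro arg_cong2[where f = "(*)"] nn_integral_cong refl)
      (auto simp: indicator_def powr_mult zero_less_mult_iff simp flip: ennreal_mult)
  also have "\<dots> = ennreal (c powr x) * (\<integral>\<^sup>+ r. ennreal (indicator {0<..} r * (r powr (x - 1) * exp (- c * r))) \<partial>lborel)"
    using assms by (subst nn_integral_cmult)
      (auto simp: mult.assoc[symmetric] powr_mult_base simp flip: ennreal_mult)
  finally have "ennreal (inverse (c powr x)) * ennreal (Gamma x) =
      ennreal (inverse (c powr x)) * (ennreal (c powr x) * (\<integral>\<^sup>+ r. ennreal (indicator {0<..} r * (r powr (x - 1) * exp (- c * r))) \<partial>lborel))"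
    by simp
  also have "\<dots> = (\<integral>\<^sup>+ r. ennreal (indicator {0<..} r * (r powr (x - 1) * exp (- c * r))) \<partial>lborel)"
    using assms by (simp add: mult.assoc[symmetric] flip: ennreal_mult)
  finally show ?thesis using assms
    by (simp add: field_simps Gamma_real_nonneg flip: ennreal_mult)
qed

text \<open>Substitution of 1/r in Euler's integral. It serves integrals over the variance of a
  Gaussian density, where the parameter sits in the denominator of the exponent.\<close>

lemma nn_integral_inverse_Gamma:
  fixes x c :: real
  assumes "x > 0" "c > 0"
  shows "(\<integral>\<^sup>+ r. ennreal (indicator {0<..} r * (r powr (- x - 1) * exp (- c / r))) \<partial>lborel)
           = ennreal (Gamma x / c powr x)"
proof -
  define f where "f = (\<lambda>r::real. r powr (x - 1) * exp (- c * r))"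
  have img: "(\<lambda>r::real. 1 / r) ` {0<..} = {0<..}"
    by (auto simp: image_iff intro!: bexI[of _ "1 / _"])
  have fnn: "0 \<le> f r" for r by (simp add: f_def)
  have fh: "(f has_integral Gamma x / c powr x) {0<..}"
  proof -
    have "((\<lambda>r. indicator {0<..} r * f r) has_integral Gamma x / c powr x) UNIV"
      unfolding f_def by (rule nn_integral_has_integral[OF _ _ nn_integral_Gamma])
        (use assms in \<open>auto simp: Gamma_real_nonneg\<close>)
    moreover have "(\<lambda>r. indicator {0<..} r * f r) = (\<lambda>r. if r \<in> {0<..} then f r else 0)"
      by (auto simp: indicator_def)
    ultimately show ?thesis by (simp only: has_integral_restrict_UNIV)
  qed
  have "f absolutely_integrable_on (\<lambda>r. 1 / r) ` {0<..} \<and> integral ((\<lambda>r. 1 / r) ` {0<..}) f = Gamma x / c powr x"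
    unfolding img using fh fnn
    by (auto intro!: nonnegative_absolutely_integrable_1 simp: has_integral_iff)
  also have "?this \<longleftrightarrow> (\<lambda>r. \<bar>- 1 / r\<^sup>2\<bar> * f (1 / r)) absolutely_integrable_on {0<..} \<and>
      integral {0<..} (\<lambda>r. \<bar>- 1 / r\<^sup>2\<bar> * f (1 / r)) = Gamma x / c powr x"
    by (rule has_absolute_integral_change_of_variables_1'[symmetric])
      (auto intro!: derivative_eq_intros inj_onI simp: power2_eq_square field_simps)
  finally have "((\<lambda>r. \<bar>- 1 / r\<^sup>2\<bar> * f (1 / r)) has_integral Gamma x / c powr x) {0<..}"
    by (auto simp: has_integral_iff set_lebesgue_integral_eq_integral(1))
  then have "(\<integral>\<^sup>+ r. ennreal (indicator {0<..} r * (\<bar>- 1 / r\<^sup>2\<bar> * f (1 / r))) \<partial>lborel) = ennreal (Gamma x / c powr x)"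
    by (intro nn_integral_has_integral_lebesgue) (auto simp: fnn)
  moreover have "indicator {0<..} r * (\<bar>- 1 / r\<^sup>2\<bar> * f (1 / r)) = indicator {0<..} r * (r powr (- x - 1) * exp (- c / r))" for r :: real
  proof (cases "r > 0")
    case True
    have "(1 / r) powr (x - 1) = r powr (1 - x)"
      using True by (simp add: powr_def ln_div algebra_simps)
    moreover have "1 / r\<^sup>2 = r powr (-2)"
      using True by (simp add: powr_minus_divide powr_numeral)
    moreover have "r powr (-2) * r powr (1 - x) = r powr (- x - 1)"
      by (subst powr_add[symmetric]) (rule arg_cong[where f = "\<lambda>e. r powr e"], simp)
    ultimately show ?thesis using True by (simp add: f_def mult.assoc[symmetric])
  qed auto
  ultimately show ?thesis by simp
qed

lemma nn_integral_powr_to_inf: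
  fixes e a :: real
  assumes "e < -1" "a > 0"
  shows "(\<integral>\<^sup>+ r. ennreal (indicator {a..} r * r powr e) \<partial>lborel) = ennreal (- (a powr (e + 1)) / (e + 1))"
  by (rule nn_integral_has_integral_lebesgue[OF _ has_integral_powr_to_inf[OF assms]]) auto

lemma nn_integral_powr_from_0:
  fixes e c :: real
  assumes "e > -1" "c \<ge> 0"
  shows "(\<integral>\<^sup>+ r. ennreal (indicator {0..c} r * r powr e) \<partial>lborel) = ennreal (c powr (e + 1) / (e + 1))"
  by (rule nn_integral_has_integral_lebesgue[OF _ has_integral_powr_from_0[OF assms]]) auto

text \<open>Near 0 the bound 1 - exp(-r) \<le> r makes the singularity integrable; beyond 1 the
  bound 1 - exp(-r) \<le> 1 suffices. The explicit value matters later: its growth like 1/b as b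
  tends to 0 yields a lower bound of order \<beta> for - \<kappa>_\<beta>.\<close>

lemma nn_integral_compensated_Gamma_le:
  fixes b :: real
  assumes "0 < b" "b < 1"
  shows "(\<integral>\<^sup>+ r. ennreal (indicator {0<..} r * (r powr (- 1 - b) * (1 - exp (- r)))) \<partial>lborel) \<le> ennreal (1 / (1 - b) + 1 / b)"
proof -
  have "(\<integral>\<^sup>+ r. ennreal (indicator {0<..} r * (r powr (- 1 - b) * (1 - exp (- r)))) \<partial>lborel) \<le>
     (\<integral>\<^sup>+ r. ennreal (indicator {0..1} r * r powr (- b)) + ennreal (indicator {1..} r * r powr (- 1 - b)) \<partial>lborel)"
  proof (rule nn_integral_mono, subst ennreal_plus[symmetric])
    fix r :: real
    have *: "r powr (- 1 - b) * (1 - exp (- r)) \<le> r powr (- b)" if "r > 0"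
    proof -
      have "1 - exp (- r) \<le> r" using exp_ge_add_one_self[of "-r"] by simp
      then have "r powr (- 1 - b) * (1 - exp (- r)) \<le> r powr (- 1 - b) * r" by (intro mult_left_mono) auto
      also have "\<dots> = r powr (- b)" using that powr_add[of r "-1-b" 1] by simp
      finally show ?thesis .
    qed
    have **: "r powr (- 1 - b) * (1 - exp (- r)) \<le> r powr (- 1 - b)"
      by (rule mult_left_le) auto
    show "ennreal (indicator {0<..} r * (r powr (- 1 - b) * (1 - exp (- r)))) \<le>
      ennreal (indicator {0..1} r * r powr (- b) + indicator {1..} r * r powr (- 1 - b))"
      using * ** exp_ge_zero[of "-1::real"] by (intro ennreal_leI) (auto simp: indicator_def simp del: exp_ge_zero)
  qed auto
  also have "\<dots> = ennreal (1 / (1 - b)) + ennreal (1 / b)"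
    using nn_integral_powr_from_0[of "-b" 1] nn_integral_powr_to_inf[of "-1-b" 1] assms
    by (subst nn_integral_add) (auto simp: add.commute)
  finally show ?thesis using assms by simp
qed

lemma compensated_Gamma_integrable:
  assumes "0 < \<beta>" "\<beta> < 2"
  shows "integrable lborel (\<lambda>r::real. indicator {0<..} r * (r powr (- 1 - \<beta> / 2) * (1 - exp (- r))))"
  using nn_integral_compensated_Gamma_le[of "\<beta> / 2"] assms
  by (intro integrableI_nonneg) (auto simp: indicator_def less_top[symmetric] top_unique)

lemma Gamma_neg_half_eq:
  "Gamma_neg_half \<beta> = - (LINT r|lborel. indicator {0<..} r * (r powr (- 1 - \<beta> / 2) * (1 - exp (- r))))"
  unfolding Gamma_neg_half_def set_lebesgue_integral_def
  by (subst integral_minus[symmetric], rule Bochner_Integration.integral_cong) (auto simp: algebra_simps indicator_def)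

lemma nn_integral_compensated_Gamma:
  assumes "0 < \<beta>" "\<beta> < 2"
  shows "(\<integral>\<^sup>+ r. ennreal (indicator {0<..} r * (r powr (- 1 - \<beta> / 2) * (1 - exp (- r)))) \<partial>lborel) = ennreal (- Gamma_neg_half \<beta>)"
  unfolding Gamma_neg_half_eq minus_minus
  by (rule nn_integral_eq_integral[OF compensated_Gamma_integrable[OF assms]])
     (auto simp: indicator_def)

lemma Gamma_neg_half_ge:
  assumes "0 < \<beta>" "\<beta> < 2"
  shows "- Gamma_neg_half \<beta> \<le> 1 / (1 - \<beta> / 2) + 2 / \<beta>"
proof -
  have "ennreal (- Gamma_neg_half \<beta>) \<le> ennreal (1 / (1 - \<beta> / 2) + 1 / (\<beta> / 2))"
    unfolding nn_integral_compensated_Gamma[OF assms, symmetric]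
    using nn_integral_compensated_Gamma_le[of "\<beta> / 2"] assms by simp
  moreover have "0 \<le> 1 / (1 - \<beta> / 2) + 1 / (\<beta> / 2)" using assms by auto
  ultimately show ?thesis by (subst (asm) ennreal_le_iff) auto
qed

lemma Gamma_neg_half_neg:
  assumes "0 < \<beta>" "\<beta> < 2"
  shows "Gamma_neg_half \<beta> < 0"
proof (rule ccontr)
  let ?f = "\<lambda>r::real. indicator {0<..} r * (r powr (- 1 - \<beta> / 2) * (1 - exp (- r)))"
  assume "\<not> Gamma_neg_half \<beta> < 0"
  then have "(\<integral>\<^sup>+ r. ennreal (?f r) \<partial>lborel) = 0"
    using nn_integral_compensated_Gamma[OF assms] by (simp add: ennreal_neg)
  then have "AE r in lborel. ennreal (?f r) = 0"
    by (subst (asm) nn_integral_0_iff_AE) auto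
  then have "AE r in lborel. \<not> r \<in> {0<..<1::real}"
  proof eventually_elim
    case (elim r)
    have "0 < ?f r" if "r > 0" using that by simp
    then show ?case using elim by (auto simp: ennreal_eq_0_iff not_less[symmetric])
  qed
  then have "emeasure lborel {0<..<1::real} = 0"
    by (subst (asm) AE_iff_measurable[where N = "{0<..<1::real}"]) auto
  then show False by simp
qed

text \<open>Scaling by c^2 turns the compensated Gamma integral into c^\<beta>. With c = |y| this
  writes |y|^\<beta> as a mixture of 1 - exp(-r |y|^2); the compensation by 1 is forced, since
  Gaussians decrease in |y|.\<close>

lemma nn_integral_compensated_scaled:
  assumes "0 < \<beta>" "\<beta> < 2" "c \<ge> 0"
  shows "(\<integral>\<^sup>+ r. ennreal (indicator {0<..} r * (r powr (- 1 - \<beta> / 2) * (1 - exp (- r * c\<^sup>2)))) \<partial>lborel) = ennreal (- Gamma_neg_half \<beta> * c powr \<beta>)"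
proof (cases "c = 0")
  case False
  then have c: "c > 0" using assms by simp
  let ?h = "\<lambda>r::real. indicator {0<..} r * (r powr (- 1 - \<beta> / 2) * (1 - exp (- r)))"
  have eq: "c\<^sup>2 * ?h (c\<^sup>2 * r) = c powr (- \<beta>) * (indicator {0<..} r * (r powr (- 1 - \<beta> / 2) * (1 - exp (- r * c\<^sup>2))))" for r
  proof -
    have "c\<^sup>2 * (c\<^sup>2) powr (- 1 - \<beta> / 2) = c powr (- \<beta>)"
    proof -
      have "(c\<^sup>2) powr (- 1 - \<beta> / 2) = c powr (2 * (- 1 - \<beta> / 2))"
        using c by (simp only: powr_powr[symmetric]) (simp add: powr_numeral)
      moreover have "c\<^sup>2 = c powr 2" using c by (simp add: powr_numeral)
      ultimately show ?thesis by (simp add: powr_add[symmetric])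
    qed
    then have *: "c\<^sup>2 * (c\<^sup>2 * r) powr (- 1 - \<beta> / 2) = c powr (- \<beta>) * r powr (- 1 - \<beta> / 2)" if "r > 0"
      using that by (simp add: powr_mult)
    show ?thesis
    proof (cases "r > 0")
      case True
      have "c\<^sup>2 * ?h (c\<^sup>2 * r) = (c\<^sup>2 * (c\<^sup>2 * r) powr (- 1 - \<beta> / 2)) * (1 - exp (- r * c\<^sup>2))"
        using True c by (simp add: mult.commute)
      then show ?thesis unfolding *[OF True] using True by simp
    qed (use c in \<open>simp add: zero_less_mult_iff\<close>)
  qed
  have "ennreal (- Gamma_neg_half \<beta>) = ennreal (c\<^sup>2) * (\<integral>\<^sup>+ r. ennreal (?h (c\<^sup>2 * r)) \<partial>lborel)"
    unfolding nn_integral_compensated_Gamma[OF assms(1,2),symmetric]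
    by (subst nn_integral_real_affine[where c = "c\<^sup>2" and t = 0]) (use c in auto)
  also have "\<dots> = (\<integral>\<^sup>+ r. ennreal (c\<^sup>2 * ?h (c\<^sup>2 * r)) \<partial>lborel)"
    by (subst nn_integral_cmult[symmetric]) (auto simp: ennreal_mult indicator_def zero_less_mult_iff)
  also have "\<dots> = ennreal (c powr (- \<beta>)) * (\<integral>\<^sup>+ r. ennreal (indicator {0<..} r * (r powr (- 1 - \<beta> / 2) * (1 - exp (- r * c\<^sup>2)))) \<partial>lborel)"
    unfolding eq by (subst nn_integral_cmult[symmetric]) (auto simp: ennreal_mult indicator_def)
  finally have *: "ennreal (- Gamma_neg_half \<beta>) = ennreal (c powr (- \<beta>)) * (\<integral>\<^sup>+ r. ennreal (indicator {0<..} r * (r powr (- 1 - \<beta> / 2) * (1 - exp (- r * c\<^sup>2)))) \<partial>lborel)" (is "_ = _ * ?I") .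
  have "ennreal (- Gamma_neg_half \<beta> * c powr \<beta>) = ennreal (c powr \<beta>) * ennreal (- Gamma_neg_half \<beta>)"
    using Gamma_neg_half_neg[OF assms(1,2)] by (subst ennreal_mult[symmetric]) (auto simp: mult.commute)
  also have "\<dots> = ennreal (c powr \<beta> * c powr (- \<beta>)) * ?I"
    unfolding * by (simp add: ennreal_mult mult.assoc)
  also have "c powr \<beta> * c powr (- \<beta>) = 1"
    using c by (simp add: powr_add[symmetric])
  finally show ?thesis by simp
qed simp

section \<open>Gaussian integrals and radial powers on Euclidean space\<close>

lemma borel_measurable_cis [measurable]: "cis \<in> borel_measurable borel"
  by (intro borel_measurable_continuous_onI continuous_intros)

lemma
  fixes c :: "'a::euclidean_space" and f :: "'a \<Rightarrow> 'b::{banach,second_countable_topology}"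
  assumes [measurable]: "f \<in> borel_measurable borel"
  shows lborel_translation_integral: "(LINT z|lborel. f (c + z)) = (LINT z|lborel. f z)"
    and lborel_translation_integrable: "integrable lborel (\<lambda>z. f (c + z)) \<longleftrightarrow> integrable lborel f"
proof -
  have "(LINT z|distr lborel borel ((+) c). f z) = (LINT z|lborel. f (c + z))"
    by (rule integral_distr) auto
  then show "(LINT z|lborel. f (c + z)) = (LINT z|lborel. f z)" by (simp add: lborel_distr_plus)
  have "integrable (distr lborel borel ((+) c)) f \<longleftrightarrow> integrable lborel (\<lambda>z. f (c + z))"
    by (rule integrable_distr_eq) auto
  then show "integrable lborel (\<lambda>z. f (c + z)) \<longleftrightarrow> integrable lborel f" by (simp add: lborel_distr_plus)
qed

lemma
  fixes f :: "'a::euclidean_space \<Rightarrow> real \<Rightarrow> 'b::{real_normed_field,banach,second_countable_topology}"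
  assumes int: "\<And>b. b \<in> Basis \<Longrightarrow> integrable lborel (f b)"
  shows lborel_integral_prod: "(LINT z|lborel. (\<Prod>b\<in>Basis. f b (z \<bullet> b))) = (\<Prod>b\<in>Basis. LINT s|lborel. f b s)"
    and lborel_integrable_prod: "integrable lborel (\<lambda>z::'a. \<Prod>b\<in>Basis. f b (z \<bullet> b))"
proof -
  interpret product_sigma_finite "\<lambda>b::'a. lborel :: real measure"
    by standard
  have m[measurable]: "b \<in> Basis \<Longrightarrow> f b \<in> borel_measurable borel" for b
    using borel_measurable_integrable[OF int[of b]] by simp
  have m2: "(\<lambda>z::'a. \<Prod>b\<in>Basis. f b (z \<bullet> b)) \<in> borel_measurable borel"
    by measurable
  have eq: "(\<Prod>b\<in>Basis. f b ((\<Sum>b\<in>Basis. g b *\<^sub>R b) \<bullet> b)) = (\<Prod>b\<in>Basis. f b (g b))" for g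
    by (intro prod.cong) auto
  have "(LINT z|lborel. (\<Prod>b\<in>Basis. f b (z \<bullet> b))) = (LINT g|Pi\<^sub>M (Basis::'a set) (\<lambda>_. lborel). (\<Prod>b\<in>Basis. f b (g b)))"
    by (subst lborel_eq, subst integral_distr) (use m2 eq in auto)
  then show "(LINT z|lborel. (\<Prod>b\<in>Basis. f b (z \<bullet> b))) = (\<Prod>b\<in>Basis. LINT s|lborel. f b s)"
    using product_integral_prod[OF finite_Basis int] by simp
  have "integrable (distr (Pi\<^sub>M (Basis::'a set) (\<lambda>_. lborel)) borel (\<lambda>g. \<Sum>b\<in>Basis. g b *\<^sub>R b)) (\<lambda>z::'a. \<Prod>b\<in>Basis. f b (z \<bullet> b))"
    by (subst integrable_distr_eq) (use m2 eq product_integrable_prod[OF finite_Basis int] in auto)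
  then show "integrable lborel (\<lambda>z::'a. \<Prod>b\<in>Basis. f b (z \<bullet> b))"
    by (subst lborel_eq)
qed

text \<open>Rescaling by c = 1 / sqrt(2u) reduces the integral to the characteristic function of the
  standard normal law.\<close>

lemma
  fixes u t :: real
  assumes u: "u > 0"
  shows gaussian_cis_integral_real: "(LINT s|lborel. complex_of_real (exp (- u * s\<^sup>2)) * cis (t * s))
      = complex_of_real (sqrt (pi / u) * exp (- t\<^sup>2 / (4 * u)))" (is ?I)
    and gaussian_cis_integrable_real: "integrable lborel (\<lambda>s. complex_of_real (exp (- u * s\<^sup>2)) * cis (t * s))" (is ?i)
proof -
  define c where "c = 1 / sqrt (2 * u)"
  have c: "c > 0" using u by (simp add: c_def)
  have c2: "c\<^sup>2 = 1 / (2 * u)" using u by (simp add: c_def power_divide)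
  have e: "std_normal_density s = exp (- u * (c * s)\<^sup>2) / sqrt (2 * pi)" for s
    using u by (simp add: std_normal_density_def power_mult_distrib c2)
  let ?g = "\<lambda>s. complex_of_real (exp (- u * s\<^sup>2)) * cis (t * s)"
  have eq: "?g (0 + c * s) = complex_of_real (sqrt (2 * pi)) * (std_normal_density s *\<^sub>R iexp (t * c * s))" for s
    unfolding e by (simp add: scaleR_conv_of_real cis_conv_exp mult_ac)
  have si: "integrable lborel (\<lambda>s. std_normal_density s *\<^sub>R iexp (t * c * s))"
    using integrable_normal_density[of 1 0, OF zero_less_one]
    by (rule Bochner_Integration.integrable_bound) (auto simp: norm_mult)
  have "(LINT s|lborel. ?g s) = \<bar>c\<bar> *\<^sub>R (LINT s|lborel. ?g (0 + c * s))"
    using c by (intro lborel_integral_real_affine) simp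
  also have "\<dots> = c *\<^sub>R (complex_of_real (sqrt (2 * pi)) * char std_normal_distribution (t * c))"
  proof -
    have "char std_normal_distribution (t * c) = (LINT s|lborel. std_normal_density s *\<^sub>R iexp (t * c * s))"
      unfolding char_def by (subst integral_density) auto
    then show ?thesis unfolding eq using c by (simp only: integral_mult_right_zero abs_of_pos)
  qed
  also have "\<dots> = complex_of_real (c * sqrt (2 * pi) * exp (- (t * c)\<^sup>2 / 2))"
    by (simp add: char_std_normal_distribution scaleR_conv_of_real)
  also have "c * sqrt (2 * pi) * exp (- (t * c)\<^sup>2 / 2) = sqrt (pi / u) * exp (- t\<^sup>2 / (4 * u))"
    using u by (simp add: power_mult_distrib c2) (simp add: c_def real_sqrt_divide real_sqrt_mult)
  finally show ?I .
  have "integrable lborel (\<lambda>s. ?g (0 + c * s))"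
    unfolding eq by (rule integrable_mult_right) (rule si)
  then show ?i using c by (subst (asm) lborel_integrable_real_affine_iff) auto
qed

lemma norm_sq_Basis: "(norm z)\<^sup>2 = (\<Sum>b\<in>Basis. (z \<bullet> b)\<^sup>2)" for z :: "'a::euclidean_space"
  by (subst power2_norm_eq_inner, subst euclidean_inner) (simp add: power2_eq_square)

lemma
  fixes \<xi> :: "'a::euclidean_space" and u :: real
  assumes u: "u > 0"
  shows gaussian_cis_integral: "(LINT z|lborel. complex_of_real (exp (- u * (norm z)\<^sup>2)) * cis (\<xi> \<bullet> z))
      = complex_of_real ((pi / u) powr (DIM('a) / 2) * exp (- (norm \<xi>)\<^sup>2 / (4 * u)))" (is ?I)
    and gaussian_integrable: "integrable lborel (\<lambda>z::'a. exp (- u * (norm z)\<^sup>2))" (is ?i)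
proof -
  have eq: "complex_of_real (exp (- u * (norm z)\<^sup>2)) * cis (\<xi> \<bullet> z) =
    (\<Prod>b\<in>Basis. complex_of_real (exp (- u * (z \<bullet> b)\<^sup>2)) * cis ((\<xi> \<bullet> b) * (z \<bullet> b)))" for z \<xi> :: 'a
  proof -
    have "exp (- u * (norm z)\<^sup>2) = (\<Prod>b\<in>Basis. exp (- u * (z \<bullet> b)\<^sup>2))"
      by (simp add: norm_sq_Basis sum_distrib_left exp_sum[symmetric] sum_negf)
    moreover have "cis (\<xi> \<bullet> z) = (\<Prod>b\<in>Basis. cis ((\<xi> \<bullet> b) * (z \<bullet> b)))"
      by (subst euclidean_inner) (simp add: cis_conv_exp sum_distrib_left exp_sum[symmetric])
    ultimately show ?thesis by (simp add: prod.distrib)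
  qed
  have "(LINT z|lborel. complex_of_real (exp (- u * (norm z)\<^sup>2)) * cis (\<xi> \<bullet> z)) =
     (\<Prod>b\<in>Basis. complex_of_real (sqrt (pi / u) * exp (- (\<xi> \<bullet> b)\<^sup>2 / (4 * u))))"
    unfolding eq by (subst lborel_integral_prod)
       (use u in \<open>auto intro!: prod.cong gaussian_cis_integrable_real simp only: gaussian_cis_integral_real\<close>)
  also have "\<dots> = complex_of_real (sqrt (pi / u) ^ DIM('a) * (\<Prod>b\<in>Basis. exp (- (\<xi> \<bullet> b)\<^sup>2 / (4 * u))))"
    by (simp add: prod.distrib)
  also have "(\<Prod>b\<in>Basis. exp (- (\<xi> \<bullet> b)\<^sup>2 / (4 * u))) = exp (- (norm \<xi>)\<^sup>2 / (4 * u))"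
    by (simp add: exp_sum[symmetric] norm_sq_Basis sum_divide_distrib sum_negf)
  also have "sqrt (pi / u) ^ DIM('a) = (pi / u) powr (DIM('a) / 2)"
    using u by (simp add: powr_half_sqrt[symmetric] powr_powr powr_realpow[symmetric])
  finally show ?I .
  have "integrable lborel (\<lambda>z. complex_of_real (exp (- u * (norm z)\<^sup>2)) * cis ((0::'a) \<bullet> z))"
    unfolding eq using u by (intro lborel_integrable_prod gaussian_cis_integrable_real)
  then show ?i by (rule Bochner_Integration.integrable_bound) (auto simp: norm_mult)
qed

text \<open>Translating by x costs the phase \<open>cis (- (\<xi> \<bullet> x))\<close>. The
  transform of the centred Gaussian is real, so the real part keeps only the cosine of that
  phase.\<close>

lemma
  fixes \<xi> x :: "'a::euclidean_space" and u :: real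
  assumes u: "u > 0"
  shows gaussian_cos_integral_shift: "(LINT z|lborel. exp (- u * (norm (x + z))\<^sup>2) * cos (\<xi> \<bullet> z))
      = cos (\<xi> \<bullet> x) * ((pi / u) powr (DIM('a) / 2) * exp (- (norm \<xi>)\<^sup>2 / (4 * u)))"
    and gaussian_shift_integrable: "integrable lborel (\<lambda>z::'a. exp (- u * (norm (x + z))\<^sup>2))"
proof -
  show i: "integrable lborel (\<lambda>z::'a. exp (- u * (norm (x + z))\<^sup>2))"
    using gaussian_integrable[OF u, where 'a = 'a] by (subst lborel_translation_integrable) auto
  have ic: "integrable lborel (\<lambda>z. complex_of_real (exp (- u * (norm (x + z))\<^sup>2)) * cis (\<xi> \<bullet> z))"
    using i by (rule Bochner_Integration.integrable_bound) (auto simp: norm_mult)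
  have "(LINT z|lborel. exp (- u * (norm (x + z))\<^sup>2) * cos (\<xi> \<bullet> z)) =
     Re (LINT z|lborel. complex_of_real (exp (- u * (norm (x + z))\<^sup>2)) * cis (\<xi> \<bullet> z))"
    by (subst integral_Re[OF ic, symmetric]) simp
  also have "(\<lambda>z. complex_of_real (exp (- u * (norm (x + z))\<^sup>2)) * cis (\<xi> \<bullet> z)) =
       (\<lambda>z. cis (- (\<xi> \<bullet> x)) * (complex_of_real (exp (- u * (norm (x + z))\<^sup>2)) * cis (\<xi> \<bullet> (x + z))))"
  proof
    fix z
    have "cis (\<xi> \<bullet> z) = cis (- (\<xi> \<bullet> x)) * cis (\<xi> \<bullet> (x + z))"
      by (simp only: cis_mult inner_add_right) simp
    then show "complex_of_real (exp (- u * (norm (x + z))\<^sup>2)) * cis (\<xi> \<bullet> z) =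
       cis (- (\<xi> \<bullet> x)) * (complex_of_real (exp (- u * (norm (x + z))\<^sup>2)) * cis (\<xi> \<bullet> (x + z)))"
      by (simp only: mult.left_commute)
  qed
  also have "(LINT z|lborel. \<dots> z) = cis (- (\<xi> \<bullet> x)) * (LINT z|lborel. (complex_of_real (exp (- u * (norm (x + z))\<^sup>2)) * cis (\<xi> \<bullet> (x + z))))"
    by simp
  also have "(LINT z|lborel. (complex_of_real (exp (- u * (norm (x + z))\<^sup>2)) * cis (\<xi> \<bullet> (x + z)))) =
     (LINT z|lborel. complex_of_real (exp (- u * (norm z)\<^sup>2)) * cis (\<xi> \<bullet> z))"
    by (rule lborel_translation_integral[where f = "\<lambda>z. complex_of_real (exp (- u * (norm z)\<^sup>2)) * cis (\<xi> \<bullet> z)"])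
       simp
  finally show "(LINT z|lborel. exp (- u * (norm (x + z))\<^sup>2) * cos (\<xi> \<bullet> z))
      = cos (\<xi> \<bullet> x) * ((pi / u) powr (DIM('a) / 2) * exp (- (norm \<xi>)\<^sup>2 / (4 * u)))"
    unfolding gaussian_cis_integral[OF u] by simp
qed

section \<open>Fubini and integrability of radial powers\<close>

lemma Fubini_lborel:
  fixes f :: "'a::euclidean_space \<Rightarrow> 'b::euclidean_space \<Rightarrow> real"
  assumes f[measurable]: "(\<lambda>(x, y). f x y) \<in> borel_measurable (borel \<Otimes>\<^sub>M borel)"
    and fin: "(\<integral>\<^sup>+ y. \<integral>\<^sup>+ x. ennreal \<bar>f x y\<bar> \<partial>lborel \<partial>lborel) < \<infinity>"
  shows "(LINT x|lborel. LINT y|lborel. f x y) = (LINT y|lborel. LINT x|lborel. f x y)"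
    and "integrable lborel (\<lambda>x. LINT y|lborel. f x y)"
    and "integrable lborel (\<lambda>y. LINT x|lborel. f x y)"
proof -
  have "(\<integral>\<^sup>+ p. ennreal (norm ((\<lambda>(x, y). f x y) p)) \<partial>(lborel \<Otimes>\<^sub>M lborel)) = (\<integral>\<^sup>+ y. \<integral>\<^sup>+ x. ennreal \<bar>f x y\<bar> \<partial>lborel \<partial>lborel)"
    by (subst lborel_pair.nn_integral_snd[symmetric]) auto
  then have i: "integrable (lborel \<Otimes>\<^sub>M lborel) (\<lambda>(x, y). f x y)"
    using fin by (intro integrableI_bounded) auto
  show "(LINT x|lborel. LINT y|lborel. f x y) = (LINT y|lborel. LINT x|lborel. f x y)"
    using lborel_pair.Fubini_integral[OF i] by simp
  show "integrable lborel (\<lambda>x. LINT y|lborel. f x y)"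
    using lborel_pair.integrable_fst[OF i] by simp
  show "integrable lborel (\<lambda>y. LINT x|lborel. f x y)"
    using lborel_pair.integrable_snd[OF i] by simp
qed

lemma powr_eq_layer_cake:
  assumes "p > 0" "r > 0"
  shows "ennreal (r powr (- p)) = (\<integral>\<^sup>+ \<rho>. ennreal (indicator {r..} \<rho> * (p * \<rho> powr (- p - 1))) \<partial>lborel)"
proof -
  have "(\<integral>\<^sup>+ \<rho>. ennreal (indicator {r..} \<rho> * (p * \<rho> powr (- p - 1))) \<partial>lborel) = (\<integral>\<^sup>+ \<rho>. ennreal p * ennreal (indicator {r..} \<rho> * \<rho> powr (- p - 1)) \<partial>lborel)"
    using assms by (intro nn_integral_cong) (auto simp: indicator_def ennreal_mult)
  also have "\<dots> = ennreal p * ennreal (- (r powr (- p)) / (- p))"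
    using assms by (subst nn_integral_cmult) (auto simp: nn_integral_powr_to_inf)
  finally show ?thesis using assms by (simp flip: ennreal_mult)
qed

text \<open>A layer-cake substitute for polar coordinates: |x|^(-p) is an integral over radii \<rho>
  \<ge> |x|, and after Tonelli only volumes of balls enter. An inequality is enough, as the lemma
  only serves to prove finiteness.\<close>

lemma nn_integral_norm_powr_le:
  fixes A :: "'a::euclidean_space set" and p :: real
  assumes [measurable]: "A \<in> sets borel" and p: "p > 0"
  shows "(\<integral>\<^sup>+ x. ennreal (indicator A x * norm x powr (- p)) \<partial>lborel) \<le>
     (\<integral>\<^sup>+ \<rho>. ennreal (p * \<rho> powr (- p - 1)) * emeasure lborel (A \<inter> cball 0 \<rho>) * indicator {0..} \<rho> \<partial>lborel)"
proof -
  have "(\<integral>\<^sup>+ x. ennreal (indicator A x * norm x powr (- p)) \<partial>lborel) \<le>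
    (\<integral>\<^sup>+ x. \<integral>\<^sup>+ \<rho>. ennreal (p * \<rho> powr (- p - 1)) * indicator (A \<inter> cball 0 \<rho>) x * indicator {0..} \<rho> \<partial>lborel \<partial>lborel)"
  proof (rule nn_integral_mono)
    fix x :: 'a
    show "ennreal (indicator A x * norm x powr (- p)) \<le>
      (\<integral>\<^sup>+ \<rho>. ennreal (p * \<rho> powr (- p - 1)) * indicator (A \<inter> cball 0 \<rho>) x * indicator {0..} \<rho> \<partial>lborel)"
    proof (cases "x \<in> A \<and> x \<noteq> 0")
      case True
      then have "ennreal (norm x powr (- p)) = (\<integral>\<^sup>+ \<rho>. ennreal (indicator {norm x..} \<rho> * (p * \<rho> powr (- p - 1))) \<partial>lborel)"
        using p by (intro powr_eq_layer_cake) auto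
      also have "\<dots> \<le> (\<integral>\<^sup>+ \<rho>. ennreal (p * \<rho> powr (- p - 1)) * indicator (A \<inter> cball 0 \<rho>) x * indicator {0..} \<rho> \<partial>lborel)"
      proof (rule nn_integral_mono)
        fix \<rho> :: real
        show "ennreal (indicator {norm x..} \<rho> * (p * \<rho> powr (- p - 1))) \<le> ennreal (p * \<rho> powr (- p - 1)) * indicator (A \<inter> cball 0 \<rho>) x * indicator {0..} \<rho>"
        proof (cases "norm x \<le> \<rho>")
          case le: True
          then have "0 \<le> \<rho>" using norm_ge_zero[of x] by linarith
          with le True have "\<rho> \<in> {norm x..}" "x \<in> A \<inter> cball 0 \<rho>" "\<rho> \<in> {0..}" by auto
          then show ?thesis by (simp only: indicator_simps mult_1 mult_1_right order_refl)
        qed simp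
      qed
      finally show ?thesis using True by (simp only: indicator_simps mult_1)
    next
      case False
      then have "indicator A x * norm x powr (- p) = 0" by auto
      then show ?thesis by (simp only: ennreal_0 zero_le)
    qed
  qed
  also have "\<dots> = (\<integral>\<^sup>+ \<rho>. \<integral>\<^sup>+ x. ennreal (p * \<rho> powr (- p - 1)) * indicator (A \<inter> cball 0 \<rho>) x * indicator {0..} \<rho> \<partial>lborel \<partial>lborel)"
  proof (rule lborel_pair.Fubini'[symmetric])
    have "(\<lambda>(x, \<rho>). ennreal (p * \<rho> powr (- p - 1)) * indicator (A \<inter> cball 0 \<rho>) x * indicator {0..} \<rho>) =
       (\<lambda>(x, \<rho>). ennreal (p * \<rho> powr (- p - 1)) * (if x \<in> A \<and> norm x \<le> \<rho> then 1 else 0) * indicator {0..} \<rho>)"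
      by (auto simp: indicator_def fun_eq_iff)
    also have "\<dots> \<in> borel_measurable (lborel \<Otimes>\<^sub>M lborel)" by measurable
    finally show "(\<lambda>(x, \<rho>). ennreal (p * \<rho> powr (- p - 1)) * indicator (A \<inter> cball 0 \<rho>) x * indicator {0..} \<rho>) \<in> borel_measurable (lborel \<Otimes>\<^sub>M lborel)" .
  qed
  also have "\<dots> = (\<integral>\<^sup>+ \<rho>. ennreal (p * \<rho> powr (- p - 1)) * emeasure lborel (A \<inter> cball 0 \<rho>) * indicator {0..} \<rho> \<partial>lborel)"
  proof (rule nn_integral_cong)
    fix \<rho> :: real
    have m[measurable]: "A \<inter> cball 0 \<rho> \<in> sets lborel" using assms(1) by (metis borel_closed closed_cball sets.Int sets_lborel)
    show "(\<integral>\<^sup>+ x. ennreal (p * \<rho> powr (- p - 1)) * indicator (A \<inter> cball 0 \<rho>) x * indicator {0..} \<rho> \<partial>lborel) =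
      ennreal (p * \<rho> powr (- p - 1)) * emeasure lborel (A \<inter> cball 0 \<rho>) * indicator {0..} \<rho>"
      by (subst nn_integral_multc, measurable, subst nn_integral_cmult_indicator[OF m]) (rule refl)
  qed
  finally show ?thesis .
qed

lemma emeasure_cball_powr:
  assumes "p \<ge> 0" "\<rho> > 0"
  shows "ennreal (p * \<rho> powr e) * emeasure lborel (cball (0::'a::euclidean_space) \<rho>)
     = ennreal (p * unit_ball_vol (DIM('a))) * ennreal (\<rho> powr (e + DIM('a)))"
proof -
  have "emeasure lborel (cball (0::'a) \<rho>) = ennreal (unit_ball_vol (DIM('a)) * \<rho> powr DIM('a))"
    using assms by (simp add: emeasure_cball powr_realpow)
  moreover have "p * \<rho> powr e * (unit_ball_vol (DIM('a)) * \<rho> powr DIM('a)) = p * unit_ball_vol (DIM('a)) * \<rho> powr (e + DIM('a))"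
    unfolding powr_add by (simp only: mult_ac)
  ultimately show ?thesis
    using assms by (simp only: ennreal_mult[symmetric] mult_nonneg_nonneg powr_ge_zero unit_ball_vol_nonneg of_nat_0_le_iff)
qed

lemma nn_integral_norm_powr_cball_finite:
  fixes p :: real
  assumes p: "0 < p" "p < DIM('a::euclidean_space)"
  shows "(\<integral>\<^sup>+ x. ennreal (indicator (cball (0::'a) 1) x * norm x powr (- p)) \<partial>lborel) < \<infinity>"
proof -
  define V where "V = unit_ball_vol (DIM('a))"
  have V: "V \<ge> 0" by (simp add: V_def)
  have "(\<integral>\<^sup>+ x. ennreal (indicator (cball (0::'a) 1) x * norm x powr (- p)) \<partial>lborel) \<le>
     (\<integral>\<^sup>+ \<rho>. ennreal (p * \<rho> powr (- p - 1)) * emeasure lborel (cball 0 1 \<inter> cball (0::'a) \<rho>) * indicator {0..} \<rho> \<partial>lborel)"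
    using p by (intro nn_integral_norm_powr_le) auto
  also have "\<dots> \<le> (\<integral>\<^sup>+ \<rho>. ennreal (p * V) * ennreal (indicator {0..1} \<rho> * \<rho> powr (DIM('a) - p - 1)) +
        ennreal (p * V) * ennreal (indicator {1..} \<rho> * \<rho> powr (- p - 1)) \<partial>lborel)"
  proof (rule nn_integral_mono)
    fix \<rho> :: real
    \<comment> \<open>Below radius 1 the volume is V \<rho>^d, and p < d makes the result integrable
      at 0; above 1 the volume is capped by V, and p > 0 gives the decay.\<close>
    consider "\<rho> \<le> 0" | "0 < \<rho>" "\<rho> \<le> 1" | "1 < \<rho>" by linarith
    then show "ennreal (p * \<rho> powr (- p - 1)) * emeasure lborel (cball 0 1 \<inter> cball (0::'a) \<rho>) * indicator {0..} \<rho> \<le>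
       ennreal (p * V) * ennreal (indicator {0..1} \<rho> * \<rho> powr (DIM('a) - p - 1)) +
        ennreal (p * V) * ennreal (indicator {1..} \<rho> * \<rho> powr (- p - 1))"
    proof cases
      case 2
      have "cball 0 1 \<inter> cball (0::'a) \<rho> = cball 0 \<rho>" using 2 by auto
      then have "ennreal (p * \<rho> powr (- p - 1)) * emeasure lborel (cball 0 1 \<inter> cball (0::'a) \<rho>) =
        ennreal (p * V) * ennreal (\<rho> powr (DIM('a) - p - 1))"
        using emeasure_cball_powr[of p \<rho> "- p - 1", where 'a = 'a] 2 p by (simp only: V_def) (simp add: algebra_simps)
      moreover have "\<rho> \<in> {0..1}" "\<rho> \<in> {0..}" using 2 by auto
      ultimately show ?thesis by (simp only: indicator_simps mult_1 mult_1_right) (rule add_increasing2, simp_all)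
    next
      case 3
      have "emeasure lborel (cball 0 1 \<inter> cball (0::'a) \<rho>) \<le> emeasure lborel (cball (0::'a) 1)"
        by (intro emeasure_mono) auto
      also have "\<dots> = ennreal V" by (simp add: emeasure_cball V_def)
      finally have "ennreal (p * \<rho> powr (- p - 1)) * emeasure lborel (cball 0 1 \<inter> cball (0::'a) \<rho>) \<le>
        ennreal (p * \<rho> powr (- p - 1)) * ennreal V"
        by (rule mult_left_mono) simp
      also have "\<dots> = ennreal (p * \<rho> powr (- p - 1) * V)"
        using p V by (intro ennreal_mult[symmetric]) auto
      also have "p * \<rho> powr (- p - 1) * V = p * V * \<rho> powr (- p - 1)" by simp
      also have "ennreal \<dots> = ennreal (p * V) * ennreal (\<rho> powr (- p - 1))"
        using p V by (intro ennreal_mult) auto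
      finally have *: "ennreal (p * \<rho> powr (- p - 1)) * emeasure lborel (cball 0 1 \<inter> cball (0::'a) \<rho>) \<le>
        ennreal (p * V) * ennreal (\<rho> powr (- p - 1))" .
      have "\<rho> \<in> {1..}" "\<rho> \<in> {0..}" using 3 by auto
      then show ?thesis using * by (simp only: indicator_simps mult_1 mult_1_right) (rule add_increasing, simp_all)
    next
      case 1
      then have "\<rho> powr (- p - 1) = 0 \<or> indicator {0..} \<rho> = (0::ennreal)" by (cases "\<rho> = 0") auto
      then show ?thesis by (elim disjE) (simp_all only: mult_zero_right mult_zero_left ennreal_0 zero_le)
    qed
  qed
  also have "\<dots> < \<infinity>"
  proof -
    have "(\<integral>\<^sup>+ \<rho>. ennreal (indicator {0..1} \<rho> * \<rho> powr (DIM('a) - p - 1)) \<partial>lborel) < \<infinity>"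
      using p by (subst nn_integral_powr_from_0) auto
    moreover have "(\<integral>\<^sup>+ \<rho>. ennreal (indicator {1..} \<rho> * \<rho> powr (- p - 1)) \<partial>lborel) < \<infinity>"
      using p by (subst nn_integral_powr_to_inf) auto
    ultimately show ?thesis
      by (subst nn_integral_add, simp, simp, subst nn_integral_cmult, simp, subst nn_integral_cmult, simp)
        (simp only: ennreal_mult_less_top ennreal_add_less_top infinity_ennreal_def ennreal_less_top simp_thms)
  qed
  finally show ?thesis .
qed

lemma nn_integral_norm_powr_outside_finite:
  fixes p :: real
  assumes p: "p > DIM('a::euclidean_space)"
  shows "(\<integral>\<^sup>+ x. ennreal (indicator (- cball (0::'a) 1) x * norm x powr (- p)) \<partial>lborel) < \<infinity>"
proof -
  define V where "V = unit_ball_vol (DIM('a))"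
  have V: "V \<ge> 0" by (simp add: V_def)
  have p0: "p > 0" using p by (rule le_less_trans[rotated]) simp
  have "(\<integral>\<^sup>+ x. ennreal (indicator (- cball (0::'a) 1) x * norm x powr (- p)) \<partial>lborel) \<le>
     (\<integral>\<^sup>+ \<rho>. ennreal (p * \<rho> powr (- p - 1)) * emeasure lborel (- cball 0 1 \<inter> cball (0::'a) \<rho>) * indicator {0..} \<rho> \<partial>lborel)"
    using p0 by (intro nn_integral_norm_powr_le) auto
  also have "\<dots> \<le> (\<integral>\<^sup>+ \<rho>. ennreal (p * V) * ennreal (indicator {1..} \<rho> * \<rho> powr (DIM('a) - p - 1)) \<partial>lborel)"
  proof (rule nn_integral_mono)
    fix \<rho> :: real
    consider "\<rho> < 1" | "1 \<le> \<rho>" by linarith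
    then show "ennreal (p * \<rho> powr (- p - 1)) * emeasure lborel (- cball 0 1 \<inter> cball (0::'a) \<rho>) * indicator {0..} \<rho> \<le>
        ennreal (p * V) * ennreal (indicator {1..} \<rho> * \<rho> powr (DIM('a) - p - 1))"
    proof cases
      case 1
      have "- cball 0 1 \<inter> cball (0::'a) \<rho> = {}" using 1 by auto
      then show ?thesis by simp
    next
      case 2
      have "ennreal (p * \<rho> powr (- p - 1)) * emeasure lborel (- cball 0 1 \<inter> cball (0::'a) \<rho>) \<le> ennreal (p * \<rho> powr (- p - 1)) * emeasure lborel (cball (0::'a) \<rho>)"
        by (intro mult_left_mono emeasure_mono) auto
      also have "\<dots> = ennreal (p * V) * ennreal (\<rho> powr (DIM('a) - p - 1))"
        using emeasure_cball_powr[of p \<rho> "- p - 1", where 'a = 'a] 2 p0 by (simp only: V_def) (simp add: algebra_simps)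
      finally have *: "ennreal (p * \<rho> powr (- p - 1)) * emeasure lborel (- cball 0 1 \<inter> cball (0::'a) \<rho>) \<le> ennreal (p * V) * ennreal (\<rho> powr (DIM('a) - p - 1))" .
      have "\<rho> \<in> {1..}" "\<rho> \<in> {0..}" using 2 by auto
      then show ?thesis using * by (simp only: indicator_simps mult_1 mult_1_right)
    qed
  qed
  also have "\<dots> < \<infinity>"
  proof -
    have "(\<integral>\<^sup>+ \<rho>. ennreal (indicator {1..} \<rho> * \<rho> powr (DIM('a) - p - 1)) \<partial>lborel) < \<infinity>"
      using p by (subst nn_integral_powr_to_inf) auto
    then show ?thesis
      by (subst nn_integral_cmult, simp) (simp only: ennreal_mult_less_top infinity_ennreal_def ennreal_less_top simp_thms)
  qed
  finally show ?thesis .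
qed

lemma borel_measurable_indicator_norm_powr:
  fixes A :: "'a::euclidean_space set"
  assumes [measurable]: "A \<in> sets borel"
  shows "(\<lambda>x. ennreal (indicator A x * norm x powr e)) \<in> borel_measurable lborel"
  by measurable

section \<open>The stable kernel against Gaussians\<close>

lemma stable_exp_integrable:
  assumes \<alpha>: "\<alpha> > 0" and s: "s > 0"
  shows "integrable lborel (\<lambda>\<xi>::'a::euclidean_space. exp (- s * norm \<xi> powr \<alpha>))"
proof -
  \<comment> \<open>Any n with \<alpha> n \<ge> d + 1 works: y^n / n! \<le> exp y with y = s
    |\<xi>|^\<alpha> gives decay of order d + 1, which is integrable at infinity.\<close>
  define n where "n = nat \<lceil>(real DIM('a) + 1) / \<alpha>\<rceil>"
  have "(real DIM('a) + 1) / \<alpha> \<le> real n" unfolding n_def by linarith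
  then have n: "real DIM('a) + 1 \<le> \<alpha> * real n" using \<alpha> by (simp add: field_simps)
  define C where "C = fact n / s ^ n"
  have C: "C > 0" using s by (simp add: C_def)
  have bound: "exp (- s * norm \<xi> powr \<alpha>) \<le> C * norm \<xi> powr (- (real DIM('a) + 1))" if "\<xi> \<notin> cball 0 1" for \<xi> :: 'a
  proof -
    have r: "norm \<xi> > 1" using that by simp
    define y where "y = s * norm \<xi> powr \<alpha>"
    have y: "y \<ge> 0" using s by (simp add: y_def)
    have "s ^ n * norm \<xi> powr (real DIM('a) + 1) / fact n \<le> s ^ n * norm \<xi> powr (\<alpha> * n) / fact n"
      using r s n by (intro divide_right_mono mult_left_mono powr_mono) auto
    also have "\<dots> = y ^ n / fact n"
    proof -
      have "(norm \<xi> powr \<alpha>) ^ n = norm \<xi> powr (\<alpha> * n)"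
        using r by (subst powr_realpow[symmetric]) (auto simp: powr_powr)
      then show ?thesis by (simp add: y_def power_mult_distrib)
    qed
    also have "\<dots> \<le> exp y"
    proof -
      have "(\<Sum>k\<in>{n}. y ^ k /\<^sub>R fact k) \<le> (\<Sum>k. y ^ k /\<^sub>R fact k)"
        using y by (intro sum_le_suminf summable_exp_generic) auto
      then show ?thesis by (simp add: exp_def divide_inverse mult.commute)
    qed
    finally have *: "norm \<xi> powr (real DIM('a) + 1) / C \<le> exp y" by (simp add: C_def mult.commute)
    define N where "N = norm \<xi> powr (real DIM('a) + 1)"
    have "N > 0" using r unfolding N_def by auto
    then have "exp (- y) \<le> C / N"
      using C * unfolding N_def[symmetric] by (simp add: exp_minus field_simps)
    then have "exp (- y) \<le> C / norm \<xi> powr (real DIM('a) + 1)" by (simp add: N_def)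
    then show ?thesis by (simp only: powr_minus_divide y_def mult_minus_left times_divide_eq_right mult_1_right)
  qed
  have "(\<integral>\<^sup>+ \<xi>. ennreal (exp (- s * norm (\<xi>::'a) powr \<alpha>)) \<partial>lborel) \<le>
     (\<integral>\<^sup>+ \<xi>. indicator (cball (0::'a) 1) \<xi> + ennreal C * ennreal (indicator (- cball 0 1) \<xi> * norm \<xi> powr (- (real DIM('a) + 1))) \<partial>lborel)"
  proof (rule nn_integral_mono)
    fix \<xi> :: 'a
    show "ennreal (exp (- s * norm (\<xi>::'a) powr \<alpha>)) \<le> indicator (cball (0::'a) 1) \<xi> + ennreal C * ennreal (indicator (- cball 0 1) \<xi> * norm \<xi> powr (- (real DIM('a) + 1)))"
    proof (cases "\<xi> \<in> cball 0 1")
      case True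
      then show ?thesis using s by (simp add: indicator_def)
    next
      case False
      then show ?thesis using bound[OF False] C by (simp add: indicator_def ennreal_mult[symmetric] del: mem_cball)
    qed
  qed
  also have "\<dots> < \<infinity>"
  proof -
    let ?f = "\<lambda>\<xi>. ennreal (indicator (- cball (0::'a) 1) \<xi> * norm \<xi> powr (- (real DIM('a) + 1)))"
    have m: "?f \<in> borel_measurable lborel" by (rule borel_measurable_indicator_norm_powr) auto
    have m1: "(indicator (cball (0::'a) 1) :: 'a \<Rightarrow> ennreal) \<in> borel_measurable lborel"
      "(\<lambda>\<xi>. ennreal C * ?f \<xi>) \<in> borel_measurable lborel"
      by (rule borel_measurable_indicator, simp add: borel_closed) (rule borel_measurable_times_ennreal[OF borel_measurable_const m])
    have "integral\<^sup>N lborel ?f < \<infinity>"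
      by (rule nn_integral_norm_powr_outside_finite) auto
    moreover have "(\<integral>\<^sup>+ \<xi>. indicator (cball (0::'a) 1) \<xi> \<partial>lborel) < \<infinity>" by (simp add: emeasure_cball)
    ultimately show ?thesis
      unfolding nn_integral_add[OF m1] nn_integral_cmult[OF m]
      by (simp only: ennreal_mult_less_top ennreal_add_less_top infinity_ennreal_def ennreal_less_top simp_thms)
  qed
  finally show ?thesis by (intro integrableI_nonneg) auto
qed

lemma borel_measurable_stable_kernel [measurable]:
  assumes [measurable]: "f \<in> borel_measurable M" "g \<in> borel_measurable M"
  shows "(\<lambda>w. stable_kernel \<alpha> (f w) (g w :: 'a::euclidean_space)) \<in> borel_measurable M"
  unfolding stable_kernel_def by measurable

text \<open>The Gaussian density whose Fourier transform is \<open>x \<mapsto> exp (- u |x|\<^sup>2)\<close>.\<close>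

definition gauss_weight :: "real \<Rightarrow> 'a::euclidean_space \<Rightarrow> real" where
  "gauss_weight u \<xi> = (4 * pi * u) powr (- (real DIM('a) / 2)) * exp (- (norm \<xi>)\<^sup>2 / (4 * u))"

lemma gauss_weight_nonneg [simp]: "0 \<le> gauss_weight u \<xi>"
  by (simp add: gauss_weight_def)

lemma borel_measurable_gauss_weight [measurable]:
  assumes [measurable]: "f \<in> borel_measurable M" "g \<in> borel_measurable M"
  shows "(\<lambda>w. gauss_weight (f w) (g w :: 'a::euclidean_space)) \<in> borel_measurable M"
  unfolding gauss_weight_def by measurable

text \<open>The summand 0 and the coefficient 1 / (4u) put the density in the shape of the shifted
  Gaussian integrals, with shift 0.\<close>

lemma gauss_weight_alt:
  "gauss_weight u (\<xi>::'a::euclidean_space) = (4 * pi * u) powr (- (real DIM('a) / 2)) * exp (- (1 / (4 * u)) * (norm (0 + \<xi>))\<^sup>2)"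
  by (simp add: gauss_weight_def)

lemma gauss_weight_integrable:
  assumes "u > 0"
  shows "integrable lborel (gauss_weight u :: 'a::euclidean_space \<Rightarrow> real)"
proof -
  have "integrable lborel (\<lambda>\<xi>::'a. (4 * pi * u) powr (- (real DIM('a) / 2)) * exp (- (1 / (4 * u)) * (norm (0 + \<xi>))\<^sup>2))"
    using assms by (intro integrable_mult_right gaussian_shift_integrable) auto
  then show ?thesis unfolding gauss_weight_alt[symmetric] .
qed

lemma gauss_weight_bounded_integrable:
  fixes f :: "'a::euclidean_space \<Rightarrow> real"
  assumes "u > 0" and [measurable]: "f \<in> borel_measurable borel" and "\<And>\<xi>. \<bar>f \<xi>\<bar> \<le> 1"
  shows "integrable lborel (\<lambda>\<xi>. f \<xi> * gauss_weight u \<xi>)"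
  using gauss_weight_integrable[OF assms(1)]
  by (rule Bochner_Integration.integrable_bound) (use assms(3) in \<open>auto simp: abs_mult mult_left_le_one_le\<close>)

lemma gauss_weight_fourier:
  assumes u: "u > 0"
  shows "(LINT \<xi>|lborel. cos (\<xi> \<bullet> x) * gauss_weight u \<xi>) = exp (- u * (norm (x::'a::euclidean_space))\<^sup>2)"
proof -
  have "(LINT \<xi>|lborel. cos (\<xi> \<bullet> x) * gauss_weight u \<xi>) =
    (LINT \<xi>|lborel. (4 * pi * u) powr (- (real DIM('a) / 2)) * (exp (- (1 / (4 * u)) * (norm (0 + \<xi>))\<^sup>2) * cos (x \<bullet> \<xi>)))"
    by (simp add: gauss_weight_alt inner_commute mult_ac)
  also have "\<dots> = (4 * pi * u) powr (- (real DIM('a) / 2)) * (cos (x \<bullet> 0) * ((pi / (1 / (4 * u))) powr (DIM('a) / 2) * exp (- (norm x)\<^sup>2 / (4 * (1 / (4 * u))))))"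
    using u by (subst gaussian_cos_integral_shift[symmetric]) (auto simp only: integral_mult_right_zero, simp)
  also have "\<dots> = ((4 * pi * u) powr (- (real DIM('a) / 2)) * (4 * pi * u) powr (real DIM('a) / 2)) * exp (- u * (norm x)\<^sup>2)"
    using u by (simp add: mult_ac)
  also have "(4 * pi * u) powr (- (real DIM('a) / 2)) * (4 * pi * u) powr (real DIM('a) / 2) = 1"
    using u by (simp add: powr_add[symmetric])
  finally show ?thesis by simp
qed

text \<open>The closed form tends to 1 as u tends to 0, so it measures how fast
  \<open>gauss_weight u\<close> concentrates at the origin.\<close>

lemma gauss_weight_gauss:
  assumes u: "u > 0"
  shows "(LINT \<xi>|lborel. exp (- (norm (\<xi>::'a::euclidean_space))\<^sup>2) * gauss_weight u \<xi>) = (1 / (4 * u + 1)) powr (DIM('a) / 2)"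
proof -
  define v where "v = 1 + 1 / (4 * u)"
  have v: "v > 0" using u by (simp add: v_def add_pos_pos)
  have e: "exp (- (norm \<xi>)\<^sup>2) * gauss_weight u \<xi> = (4 * pi * u) powr (- (real DIM('a) / 2)) * (exp (- v * (norm (0 + \<xi>))\<^sup>2) * cos (0 \<bullet> \<xi>))" for \<xi> :: 'a
    by (simp add: gauss_weight_def v_def exp_add[symmetric] algebra_simps)
  have "(LINT \<xi>|lborel. exp (- (norm (\<xi>::'a::euclidean_space))\<^sup>2) * gauss_weight u \<xi>) =
     (4 * pi * u) powr (- (real DIM('a) / 2)) * (pi / v) powr (DIM('a) / 2)"
    unfolding e using gaussian_cos_integral_shift[OF v, of 0 "0::'a"] by (simp only: integral_mult_right_zero) simp
  also have "\<dots> = (1 / (4 * pi * u)) powr (real DIM('a) / 2) * (pi / v) powr (DIM('a) / 2)"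
    using u by (simp add: powr_minus powr_divide inverse_eq_divide)
  also have "\<dots> = ((1 / (4 * pi * u)) * (pi / v)) powr (real DIM('a) / 2)"
    using u v by (subst powr_mult) auto
  also have "(1 / (4 * pi * u)) * (pi / v) = 1 / (4 * u + 1)"
    using u by (simp add: v_def field_simps)
  finally show ?thesis .
qed

text \<open>Fourier form of the stable semigroup at time s acting on the Gaussian exp(-u |y|^2),
  evaluated at x. Unlike the inversion integral of the kernel it is meaningful at s = 0, where it is
  the Gaussian itself.\<close>

definition stable_gauss :: "real \<Rightarrow> 'a::euclidean_space \<Rightarrow> real \<Rightarrow> real \<Rightarrow> real" where
  "stable_gauss \<alpha> x s u = (LINT \<xi>|lborel. cos (\<xi> \<bullet> x) * exp (- s * norm \<xi> powr \<alpha>) * gauss_weight u \<xi>)"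

lemma borel_measurable_stable_gauss [measurable]:
  assumes [measurable]: "f \<in> borel_measurable M" "g \<in> borel_measurable M" "h \<in> borel_measurable M"
  shows "(\<lambda>w. stable_gauss \<alpha> (h w :: 'a::euclidean_space) (f w) (g w)) \<in> borel_measurable M"
  unfolding stable_gauss_def by measurable

text \<open>After the Fourier integral of the kernel is inserted, the double integrand is dominated
  by exp(-s |\<xi>|^\<alpha>) times a Gaussian in z, each integrable. Hence the pairing converges
  absolutely before anything is known about the sign or integrability of the kernel.\<close>

lemma stable_kernel_gauss:
  fixes x :: "'a::euclidean_space"
  assumes \<alpha>: "\<alpha> > 0" and s: "s > 0" and u: "u > 0"
  shows "integrable lborel (\<lambda>z. stable_kernel \<alpha> s z * exp (- u * (norm (x + z))\<^sup>2))"
    and "(LINT z|lborel. stable_kernel \<alpha> s z * exp (- u * (norm (x + z))\<^sup>2)) = stable_gauss \<alpha> x s u"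
proof -
  define c where "c = 1 / (2 * pi) ^ DIM('a)"
  have c: "c > 0" by (simp add: c_def)
  define f where "f = (\<lambda>(z::'a) (\<xi>::'a). c * (exp (- s * norm \<xi> powr \<alpha>) * cos (\<xi> \<bullet> z)) * exp (- u * (norm (x + z))\<^sup>2))"
  have fm: "(\<lambda>(z, \<xi>). f z \<xi>) \<in> borel_measurable (borel \<Otimes>\<^sub>M borel)"
    unfolding f_def by measurable
  have fin: "(\<integral>\<^sup>+ \<xi>. \<integral>\<^sup>+ z. ennreal \<bar>f z \<xi>\<bar> \<partial>lborel \<partial>lborel) < \<infinity>"
  proof -
    have "(\<integral>\<^sup>+ \<xi>. \<integral>\<^sup>+ z. ennreal \<bar>f z \<xi>\<bar> \<partial>lborel \<partial>lborel) \<le>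
      (\<integral>\<^sup>+ \<xi>. \<integral>\<^sup>+ z. ennreal (c * exp (- s * norm (\<xi>::'a) powr \<alpha>)) * ennreal (exp (- u * (norm (x + z))\<^sup>2)) \<partial>lborel \<partial>lborel)"
    proof (intro nn_integral_mono)
      fix \<xi> z :: 'a
      have "\<bar>f z \<xi>\<bar> = c * exp (- s * norm \<xi> powr \<alpha>) * exp (- u * (norm (x + z))\<^sup>2) * \<bar>cos (\<xi> \<bullet> z)\<bar>"
        using c by (simp add: f_def abs_mult)
      also have "\<dots> \<le> c * exp (- s * norm \<xi> powr \<alpha>) * exp (- u * (norm (x + z))\<^sup>2)"
        using c by (intro mult_left_le) auto
      finally show "ennreal \<bar>f z \<xi>\<bar> \<le> ennreal (c * exp (- s * norm \<xi> powr \<alpha>)) * ennreal (exp (- u * (norm (x + z))\<^sup>2))"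
        using c by (subst ennreal_mult[symmetric]) (auto intro: ennreal_leI)
    qed
    also have "\<dots> = (\<integral>\<^sup>+ \<xi>. ennreal (c * exp (- s * norm (\<xi>::'a) powr \<alpha>)) \<partial>lborel) * (\<integral>\<^sup>+ z. ennreal (exp (- u * (norm (x + z))\<^sup>2)) \<partial>lborel)"
      by (simp add: nn_integral_cmult nn_integral_multc)
    also have "\<dots> < \<infinity>"
    proof -
      have "integrable lborel (\<lambda>\<xi>::'a. c * exp (- s * norm \<xi> powr \<alpha>))"
        by (intro integrable_mult_right stable_exp_integrable \<alpha> s)
      then have "(\<integral>\<^sup>+ \<xi>. ennreal (c * exp (- s * norm (\<xi>::'a) powr \<alpha>)) \<partial>lborel) < \<infinity>"
        using c by (subst nn_integral_eq_integral) auto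
      moreover have "(\<integral>\<^sup>+ z. ennreal (exp (- u * (norm (x + z))\<^sup>2)) \<partial>lborel) < \<infinity>"
        using gaussian_shift_integrable[OF u, of x] by (subst nn_integral_eq_integral) auto
      ultimately show ?thesis by (simp add: ennreal_mult_less_top)
    qed
    finally show ?thesis .
  qed
  have 1: "(LINT \<xi>|lborel. f z \<xi>) = stable_kernel \<alpha> s z * exp (- u * (norm (x + z))\<^sup>2)" for z
    by (simp add: f_def stable_kernel_def c_def)
  have 2: "(LINT z|lborel. f z \<xi>) = cos (\<xi> \<bullet> x) * exp (- s * norm \<xi> powr \<alpha>) * gauss_weight u \<xi>" for \<xi>
  proof -
    have "(LINT z|lborel. f z \<xi>) = (LINT z|lborel. (c * exp (- s * norm \<xi> powr \<alpha>)) * (exp (- u * (norm (x + z))\<^sup>2) * cos (\<xi> \<bullet> z)))"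
      by (simp add: f_def mult_ac)
    also have "\<dots> = (c * exp (- s * norm \<xi> powr \<alpha>)) * (cos (\<xi> \<bullet> x) * ((pi / u) powr (DIM('a) / 2) * exp (- (norm \<xi>)\<^sup>2 / (4 * u))))"
      by (simp only: integral_mult_right_zero gaussian_cos_integral_shift[OF u])
    also have "\<dots> = cos (\<xi> \<bullet> x) * exp (- s * norm \<xi> powr \<alpha>) * ((c * (pi / u) powr (DIM('a) / 2)) * exp (- (norm \<xi>)\<^sup>2 / (4 * u)))"
      by (simp add: mult_ac)
    also have "c * (pi / u) powr (DIM('a) / 2) = (4 * pi * u) powr (- (real DIM('a) / 2))"
    proof -
      have "c = (1 / (2 * pi)\<^sup>2) powr (DIM('a) / 2)"
      proof -
        have "(1 / (2 * pi)\<^sup>2) powr (DIM('a) / 2) = ((1 / (2 * pi)) powr 2) powr (DIM('a) / 2)"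
          by (subst powr_numeral) (auto simp: power_divide)
        also have "\<dots> = (1 / (2 * pi)) powr (DIM('a))" by (simp only: powr_powr) simp
        also have "\<dots> = c" by (subst powr_realpow) (auto simp: c_def power_divide)
        finally show ?thesis by simp
      qed
      then have "c * (pi / u) powr (DIM('a) / 2) = ((1 / (2 * pi)\<^sup>2) * (pi / u)) powr (DIM('a) / 2)"
        using u by (subst powr_mult) auto
      also have "(1 / (2 * pi)\<^sup>2) * (pi / u) = 1 / (4 * pi * u)"
        by (simp add: power2_eq_square field_simps)
      finally show ?thesis using u by (simp add: powr_minus powr_divide inverse_eq_divide)
    qed
    finally show ?thesis by (simp add: gauss_weight_def)
  qed
  show "integrable lborel (\<lambda>z. stable_kernel \<alpha> s z * exp (- u * (norm (x + z))\<^sup>2))"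
    using Fubini_lborel(2)[OF fm fin] by (simp add: 1)
  show "(LINT z|lborel. stable_kernel \<alpha> s z * exp (- u * (norm (x + z))\<^sup>2)) = stable_gauss \<alpha> x s u"
    using Fubini_lborel(1)[OF fm fin] by (simp add: 1 2 stable_gauss_def)
qed

section \<open>Positivity of the stable kernel\<close>

lemma stable_gauss_zero_time: "u > 0 \<Longrightarrow> stable_gauss \<alpha> x 0 u = exp (- u * (norm x)\<^sup>2)"
  by (simp add: stable_gauss_def gauss_weight_fourier)

text \<open>As u tends to 0 the probability densities \<open>gauss_weight u\<close> concentrate at
  the frequency 0, where exp(-s |\<xi>|^\<alpha>) equals 1. Concentration is tested against
  exp(-|\<xi>|^2), whose average is known in closed form. The bound u \<le> 1 lets the resulting
  Gaussian be compared with the one for u = 1.\<close>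

lemma stable_gauss_origin_ge:
  assumes \<alpha>: "\<alpha> > 0" and s: "s > 0" and \<epsilon>: "\<epsilon> > 0"
  shows "\<exists>u. 0 < u \<and> u \<le> 1 \<and> 1 - \<epsilon> \<le> stable_gauss \<alpha> (0::'a::euclidean_space) s u"
proof -
  have "((\<lambda>r::real. s * r powr \<alpha>) \<longlongrightarrow> s * 0) (at_right 0)"
    using \<alpha> by (intro tendsto_mult tendsto_const tendsto_zero_powrI[where b = \<alpha>] tendsto_ident_at)
      (auto simp: eventually_at_filter)
  then have "eventually (\<lambda>r. s * r powr \<alpha> < \<epsilon> / 2) (at_right (0::real))"
    using \<epsilon> by (intro order_tendstoD(2)) auto
  then obtain r0 where r0: "r0 > 0" "\<And>r. 0 < r \<Longrightarrow> r < r0 \<Longrightarrow> s * r powr \<alpha> < \<epsilon> / 2"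
    unfolding eventually_at_right_field by auto
  \<comment> \<open>This C makes C (1 - exp(-|\<xi>|^2)) at least 1 outside the ball of radius
    \<open>r0\<close>, so that it dominates the deviation there.\<close>
  define C where "C = 1 / (1 - exp (- r0\<^sup>2))"
  have C: "C > 0" using r0 by (simp add: C_def)
  have pw: "1 - exp (- s * norm \<xi> powr \<alpha>) \<le> \<epsilon> / 2 + C * (1 - exp (- (norm \<xi>)\<^sup>2))" for \<xi> :: 'a
  proof (cases "norm \<xi> < r0")
    case True
    have "1 - exp (- s * norm \<xi> powr \<alpha>) \<le> s * norm \<xi> powr \<alpha>"
      using exp_ge_add_one_self[of "- s * norm \<xi> powr \<alpha>"] by simp
    also have "\<dots> \<le> \<epsilon> / 2" using r0(2)[of "norm \<xi>"] True \<epsilon> by (cases "\<xi> = 0") auto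
    also have "\<dots> \<le> \<epsilon> / 2 + C * (1 - exp (- (norm \<xi>)\<^sup>2))" using C by simp
    finally show ?thesis .
  next
    case False
    then have "r0\<^sup>2 \<le> (norm \<xi>)\<^sup>2" using r0 by (intro power_mono) auto
    then have "1 - exp (- r0\<^sup>2) \<le> 1 - exp (- (norm \<xi>)\<^sup>2)" by simp
    then have "C * (1 - exp (- r0\<^sup>2)) \<le> C * (1 - exp (- (norm \<xi>)\<^sup>2))"
      using C by (intro mult_left_mono) auto
    moreover have "C * (1 - exp (- r0\<^sup>2)) = 1" using r0 by (simp add: C_def)
    moreover have "1 - exp (- s * norm \<xi> powr \<alpha>) \<le> 1" by simp
    ultimately show ?thesis using \<epsilon> by linarith
  qed
  have "((\<lambda>u::real. (1 / (4 * u + 1)) powr (DIM('a) / 2)) \<longlongrightarrow> (1 / (4 * 0 + 1)) powr (DIM('a) / 2)) (at_right 0)"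
    by (intro tendsto_intros) auto
  then have "eventually (\<lambda>u::real. (1 / (4 * u + 1)) powr (DIM('a) / 2) > 1 - \<epsilon> / (2 * C)) (at_right 0)"
    using \<epsilon> C by (intro order_tendstoD(1)) auto
  then obtain u0 where u0: "u0 > 0" "\<And>u. 0 < u \<Longrightarrow> u < u0 \<Longrightarrow> (1 / (4 * u + 1)) powr (DIM('a) / 2) > 1 - \<epsilon> / (2 * C)"
    unfolding eventually_at_right_field by auto
  define u where "u = min 1 (u0 / 2)"
  have u: "0 < u" "u \<le> 1" "(1 / (4 * u + 1)) powr (DIM('a) / 2) > 1 - \<epsilon> / (2 * C)"
    using u0(1) u0(2)[of u] by (auto simp: u_def)
  have i1: "integrable lborel (\<lambda>\<xi>::'a. exp (- s * norm \<xi> powr \<alpha>) * gauss_weight u \<xi>)"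
    using u s by (intro gauss_weight_bounded_integrable) auto
  have i2: "integrable lborel (\<lambda>\<xi>::'a. exp (- (norm \<xi>)\<^sup>2) * gauss_weight u \<xi>)"
    using u by (intro gauss_weight_bounded_integrable) auto
  have i3: "integrable lborel (gauss_weight u :: 'a \<Rightarrow> real)"
    using u by (intro gauss_weight_integrable) auto
  have m: "(LINT \<xi>|lborel. gauss_weight u (\<xi>::'a)) = 1"
    using gauss_weight_fourier[OF u(1), of "0::'a"] by simp
  have "1 - stable_gauss \<alpha> (0::'a) s u = (LINT \<xi>|lborel. gauss_weight u (\<xi>::'a) - exp (- s * norm \<xi> powr \<alpha>) * gauss_weight u \<xi>)"
    by (subst Bochner_Integration.integral_diff[OF i3 i1]) (simp add: m stable_gauss_def)
  also have "\<dots> \<le> (LINT \<xi>|lborel. (\<epsilon> / 2) * gauss_weight u (\<xi>::'a) + C * (gauss_weight u \<xi> - exp (- (norm \<xi>)\<^sup>2) * gauss_weight u \<xi>))"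
  proof (rule integral_mono)
    fix \<xi> :: 'a
    have "(1 - exp (- s * norm \<xi> powr \<alpha>)) * gauss_weight u \<xi> \<le> (\<epsilon> / 2 + C * (1 - exp (- (norm \<xi>)\<^sup>2))) * gauss_weight u \<xi>"
      by (intro mult_right_mono pw) auto
    then show "gauss_weight u \<xi> - exp (- s * norm \<xi> powr \<alpha>) * gauss_weight u \<xi> \<le> (\<epsilon> / 2) * gauss_weight u (\<xi>::'a) + C * (gauss_weight u \<xi> - exp (- (norm \<xi>)\<^sup>2) * gauss_weight u \<xi>)"
      by (simp only: algebra_simps)
  qed (use i1 i2 i3 in auto)
  also have "\<dots> = \<epsilon> / 2 + C * (1 - (1 / (4 * u + 1)) powr (DIM('a) / 2))"
    using i1 i2 i3 m gauss_weight_gauss[OF u(1), where 'a = 'a] by simp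
  also have "\<dots> \<le> \<epsilon> / 2 + C * (\<epsilon> / (2 * C))"
    using u C by (intro add_left_mono mult_left_mono) auto
  also have "\<dots> = \<epsilon>" using C by simp
  finally show ?thesis using u by (intro exI[of _ u]) auto
qed

text \<open>Since \<open>ennreal\<close> cuts off negative values, the mass hypothesis says only
  that the positive part has integral 1. The signed integral against exp(-u |z|^2) can be made at
  least 1 - \<epsilon> by a small u, while its positive part contributes at most 1; so the negative
  part contributes at most \<epsilon>.\<close>

lemma stable_kernel_nonneg_AE:
  assumes \<alpha>: "\<alpha> > 0" and s: "s > 0"
    and mass: "(\<integral>\<^sup>+ z. ennreal (stable_kernel \<alpha> s (z::'a::euclidean_space)) \<partial>lborel) = 1"
  shows "AE z in lborel. 0 \<le> stable_kernel \<alpha> s (z::'a)"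
proof -
  define p where "p = (stable_kernel \<alpha> s :: 'a \<Rightarrow> real)"
  have [measurable]: "p \<in> borel_measurable borel" unfolding p_def by measurable
  define n where "n = (\<lambda>z. max 0 (- p z))"
  have [measurable]: "n \<in> borel_measurable borel" unfolding n_def by measurable
  have ib: "integrable lborel (\<lambda>z. p z * exp (- u * (norm z)\<^sup>2))" if "u > 0" for u
    using stable_kernel_gauss(1)[OF \<alpha> s that, of "0::'a"] by (simp add: p_def)
  have inb: "integrable lborel (\<lambda>z. n z * exp (- u * (norm z)\<^sup>2))" if "u > 0" for u
    using ib[OF that] by (rule Bochner_Integration.integrable_bound) (auto simp: n_def abs_mult)
  have ipb: "integrable lborel (\<lambda>z. max 0 (p z) * exp (- u * (norm z)\<^sup>2))" if "u > 0" for u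
    using ib[OF that] by (rule Bochner_Integration.integrable_bound) (auto simp: abs_mult)
  have "(LINT z|lborel. n z * exp (- 1 * (norm z)\<^sup>2)) \<le> 0 + \<epsilon>" if "\<epsilon> > 0" for \<epsilon>
  proof -
    obtain u where u: "0 < u" "u \<le> 1" "1 - \<epsilon> \<le> stable_gauss \<alpha> (0::'a) s u"
      using stable_gauss_origin_ge[OF \<alpha> s \<open>\<epsilon> > 0\<close>] by blast
    have "ennreal (LINT z|lborel. max 0 (p z) * exp (- u * (norm z)\<^sup>2)) = (\<integral>\<^sup>+ z. ennreal (max 0 (p z) * exp (- u * (norm z)\<^sup>2)) \<partial>lborel)"
      using ipb[OF u(1)] by (intro nn_integral_eq_integral[symmetric]) auto
    also have "\<dots> \<le> (\<integral>\<^sup>+ z. ennreal (p z) \<partial>lborel)"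
    proof (rule nn_integral_mono)
      fix z
      have "max 0 (p z) * exp (- u * (norm z)\<^sup>2) \<le> max 0 (p z)"
        using u by (intro mult_left_le) auto
      then show "ennreal (max 0 (p z) * exp (- u * (norm z)\<^sup>2)) \<le> ennreal (p z)"
        by (metis ennreal_leI max_0L ennreal_neg max.commute max_def nle_le)
    qed
    also have "\<dots> = 1" using mass by (simp add: p_def)
    finally have pos: "(LINT z|lborel. max 0 (p z) * exp (- u * (norm z)\<^sup>2)) \<le> 1"
      by (metis ennreal_1 ennreal_le_iff zero_le_one)
    \<comment> \<open>Because u \<le> 1, the fixed Gaussian exp(-|z|^2) lies below exp(-u |z|^2);
      the quantity being estimated thus does not depend on the choice of u.\<close>
    have "(LINT z|lborel. n z * exp (- 1 * (norm z)\<^sup>2)) \<le> (LINT z|lborel. n z * exp (- u * (norm z)\<^sup>2))"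
      using u by (intro integral_mono inb mult_left_mono) (auto simp: n_def mult_left_le_one_le)
    also have "\<dots> = (LINT z|lborel. max 0 (p z) * exp (- u * (norm z)\<^sup>2) - p z * exp (- u * (norm z)\<^sup>2))"
      by (intro Bochner_Integration.integral_cong refl) (auto simp: n_def max_def algebra_simps)
    also have "\<dots> = (LINT z|lborel. max 0 (p z) * exp (- u * (norm z)\<^sup>2)) - stable_gauss \<alpha> (0::'a) s u"
      using stable_kernel_gauss(2)[OF \<alpha> s u(1), of "0::'a"]
      by (subst Bochner_Integration.integral_diff[OF ipb ib]) (use u in \<open>auto simp: p_def\<close>)
    also have "\<dots> \<le> \<epsilon>" using pos u by simp
    finally show ?thesis by simp
  qed
  then have "(LINT z|lborel. n z * exp (- 1 * (norm z)\<^sup>2)) \<le> 0"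
    by (rule field_le_epsilon)
  moreover have "0 \<le> (LINT z|lborel. n z * exp (- 1 * (norm z)\<^sup>2))"
    by (intro integral_nonneg_AE) (auto simp: n_def)
  ultimately have "(LINT z|lborel. n z * exp (- 1 * (norm z)\<^sup>2)) = 0" by simp
  then have "AE z in lborel. n z * exp (- 1 * (norm z)\<^sup>2) = 0"
    by (subst (asm) integral_nonneg_eq_0_iff_AE[OF inb]) (auto simp: n_def)
  then show ?thesis
    by eventually_elim (auto simp: n_def p_def max_def split: if_splits)
qed

text \<open>The exponent d/2 - a - 1 cancels the factor r^(-d/2) of the density and leaves an
  inverse Gamma integral with parameter a. It is used for a = (d + \<beta>) / 2 and a = (d + \<beta>
  - \<alpha>) / 2, the values that belong to |y|^\<beta> and |y|^(\<beta>-\<alpha>) on the Fourier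
  side.\<close>

lemma nn_integral_gauss_weight_mixture:
  fixes \<xi> :: "'a::euclidean_space" and a :: real
  assumes a: "a > 0" and \<xi>: "\<xi> \<noteq> 0"
  shows "(\<integral>\<^sup>+ r. ennreal (indicator {0<..} r * r powr (DIM('a) / 2 - a - 1) * gauss_weight r \<xi>) \<partial>lborel)
     = ennreal ((4 * pi) powr (- (real DIM('a) / 2)) * 4 powr a * Gamma a * norm \<xi> powr (- 2 * a))"
proof -
  define c where "c = (4 * pi) powr (- (real DIM('a) / 2))"
  have eq: "indicator {0<..} r * r powr (DIM('a) / 2 - a - 1) * gauss_weight r \<xi> =
     c * (indicator {0<..} r * (r powr (- a - 1) * exp (- ((norm \<xi>)\<^sup>2 / 4) / r)))" for r :: real
  proof (cases "r > 0")
    case True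
    have "r powr (DIM('a) / 2 - a - 1) * (4 * pi * r) powr (- (real DIM('a) / 2)) = c * (r powr (DIM('a) / 2 - a - 1) * r powr (- (real DIM('a) / 2)))"
      using True by (simp add: c_def powr_mult)
    also have "r powr (DIM('a) / 2 - a - 1) * r powr (- (real DIM('a) / 2)) = r powr (- a - 1)"
      by (subst powr_add[symmetric]) (rule arg_cong[where f = "\<lambda>e. r powr e"], simp)
    finally show ?thesis using True by (simp add: gauss_weight_def mult.assoc[symmetric])
  qed simp
  have pos: "(norm \<xi>)\<^sup>2 / 4 > 0" using \<xi> by simp
  have c: "c \<ge> 0" by (simp add: c_def)
  have "(\<integral>\<^sup>+ r. ennreal (indicator {0<..} r * r powr (DIM('a) / 2 - a - 1) * gauss_weight r \<xi>) \<partial>lborel) =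
    ennreal c * ennreal (Gamma a / ((norm \<xi>)\<^sup>2 / 4) powr a)"
    unfolding eq using c
    by (subst ennreal_mult, simp, simp, subst nn_integral_cmult, simp) (simp only: nn_integral_inverse_Gamma[OF a pos])
  also have "\<dots> = ennreal (c * (Gamma a / ((norm \<xi>)\<^sup>2 / 4) powr a))"
    using c a by (intro ennreal_mult[symmetric]) (auto intro!: divide_nonneg_nonneg Gamma_real_nonneg)
  also have "Gamma a / ((norm \<xi>)\<^sup>2 / 4) powr a = 4 powr a * Gamma a * norm \<xi> powr (- 2 * a)"
  proof -
    have "((norm \<xi>)\<^sup>2) powr a = norm \<xi> powr (2 * a)"
      using powr_powr[of "norm \<xi>" 2 a] \<xi> by simp
    then have 1: "((norm \<xi>)\<^sup>2 / 4) powr a = norm \<xi> powr (2 * a) / 4 powr a" by (simp add: powr_divide)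
    have 2: "norm \<xi> powr (- 2 * a) = 1 / norm \<xi> powr (2 * a)"
      using powr_minus_divide[of "norm \<xi>" "2 * a"] by simp
    show ?thesis unfolding 1 2 by simp
  qed
  finally show ?thesis by (simp add: c_def mult_ac)
qed

text \<open>Near 0 the first factor is at most t |\<xi>|^\<alpha>, which lowers the singularity to
  the order d + \<beta> - \<alpha>, strictly between 0 and d; at infinity it is at most 1, and the
  order d + \<beta> exceeds d.\<close>

lemma stable_difference_integrable:
  fixes \<alpha> \<beta> t :: real
  assumes "0 < \<beta>" "\<beta> < \<alpha>" "\<alpha> < DIM('a::euclidean_space)" "t > 0"
  shows "integrable lborel (\<lambda>\<xi>::'a. (1 - exp (- t * norm \<xi> powr \<alpha>)) * norm \<xi> powr (- (real DIM('a) + \<beta>)))"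
proof -
  define F where "F = (\<lambda>\<xi>::'a. (1 - exp (- t * norm \<xi> powr \<alpha>)) * norm \<xi> powr (- (real DIM('a) + \<beta>)))"
  have F0: "0 \<le> F \<xi>" for \<xi> using assms by (simp add: F_def)
  have [measurable]: "F \<in> borel_measurable borel" unfolding F_def by measurable
  have in1: "F \<xi> \<le> t * norm \<xi> powr (- (real DIM('a) + \<beta> - \<alpha>))" for \<xi>
  proof -
    have "1 - exp (- t * norm \<xi> powr \<alpha>) \<le> t * norm \<xi> powr \<alpha>"
      using exp_ge_add_one_self[of "- t * norm \<xi> powr \<alpha>"] by simp
    then have "F \<xi> \<le> t * norm \<xi> powr \<alpha> * norm \<xi> powr (- (real DIM('a) + \<beta>))"
      unfolding F_def by (intro mult_right_mono) auto
    also have "\<dots> = t * norm \<xi> powr (- (real DIM('a) + \<beta> - \<alpha>))"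
      by (simp add: powr_add[symmetric] algebra_simps)
    finally show ?thesis .
  qed
  have out: "F \<xi> \<le> norm \<xi> powr (- (real DIM('a) + \<beta>))" for \<xi>
    unfolding F_def by (intro mult_left_le_one_le) (use assms in auto)
  have "(\<integral>\<^sup>+ \<xi>. ennreal (F \<xi>) \<partial>lborel) \<le>
     (\<integral>\<^sup>+ \<xi>. ennreal t * ennreal (indicator (cball (0::'a) 1) \<xi> * norm \<xi> powr (- (real DIM('a) + \<beta> - \<alpha>)))
        + ennreal (indicator (- cball 0 1) \<xi> * norm \<xi> powr (- (real DIM('a) + \<beta>))) \<partial>lborel)"
  proof (rule nn_integral_mono)
    fix \<xi> :: 'a
    show "ennreal (F \<xi>) \<le> ennreal t * ennreal (indicator (cball (0::'a) 1) \<xi> * norm \<xi> powr (- (real DIM('a) + \<beta> - \<alpha>)))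
        + ennreal (indicator (- cball 0 1) \<xi> * norm \<xi> powr (- (real DIM('a) + \<beta>)))"
    proof (cases "\<xi> \<in> cball 0 1")
      case True
      then have "indicator (cball 0 1) \<xi> = (1::real)" "indicator (- cball 0 1) \<xi> = (0::real)" by (auto simp: indicator_def)
      then show ?thesis using in1[of \<xi>] assms by (simp only: ennreal_0 mult_1 mult_zero_left add_0_right)
         (subst ennreal_mult[symmetric], auto intro: ennreal_leI)
    next
      case False
      then have "indicator (cball 0 1) \<xi> = (0::real)" "indicator (- cball 0 1) \<xi> = (1::real)" by (auto simp: indicator_def)
      then show ?thesis using out[of \<xi>] by (simp only: ennreal_0 mult_1 mult_zero_left mult_zero_right add_0_left)
         (auto intro: ennreal_leI)
    qed
  qed
  also have "\<dots> < \<infinity>"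
  proof -
    have m: "(\<lambda>\<xi>. ennreal (indicator (- cball (0::'a) 1) \<xi> * norm \<xi> powr (- (real DIM('a) + \<beta>)))) \<in> borel_measurable lborel"
       "(\<lambda>\<xi>. ennreal (indicator (cball (0::'a) 1) \<xi> * norm \<xi> powr (- (real DIM('a) + \<beta> - \<alpha>)))) \<in> borel_measurable lborel"
      by (rule borel_measurable_indicator_norm_powr[OF borel_comp[OF borel_closed[OF closed_cball]]])
         (rule borel_measurable_indicator_norm_powr[OF borel_closed[OF closed_cball]])
    note m3 = borel_measurable_times_ennreal[OF borel_measurable_const m(2), of "ennreal t"]
    have "(\<integral>\<^sup>+ \<xi>. ennreal (indicator (- cball (0::'a) 1) \<xi> * norm \<xi> powr (- (real DIM('a) + \<beta>))) \<partial>lborel) < \<infinity>"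
      using assms by (intro nn_integral_norm_powr_outside_finite) auto
    moreover have "(\<integral>\<^sup>+ \<xi>. ennreal (indicator (cball (0::'a) 1) \<xi> * norm \<xi> powr (- (real DIM('a) + \<beta> - \<alpha>))) \<partial>lborel) < \<infinity>"
      using assms by (intro nn_integral_norm_powr_cball_finite) auto
    ultimately show ?thesis
      unfolding nn_integral_add[OF m3 m(1)] nn_integral_cmult[OF m(2)]
      by (simp only: ennreal_mult_less_top ennreal_add_less_top infinity_ennreal_def ennreal_less_top simp_thms)
  qed
  finally have "integrable lborel F" using F0 by (intro integrableI_nonneg) auto
  then show ?thesis by (simp add: F_def)
qed

section \<open>Power moments of the stable semigroup\<close>

lemma nn_integral_exp_interval:
  fixes c t :: real
  assumes "c > 0" "t \<ge> 0"
  shows "(\<integral>\<^sup>+ s. ennreal (indicator {0..t} s * exp (- s * c)) \<partial>lborel) = ennreal ((1 - exp (- t * c)) / c)"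
proof -
  have "(\<integral>\<^sup>+ s. ennreal (exp (- s * c)) * indicator {0..t} s \<partial>lborel) = ennreal (- exp (- t * c) / c - (- exp (- 0 * c) / c))"
    using assms by (intro nn_integral_FTC_Icc) (auto intro!: derivative_eq_intros)
  moreover have "ennreal (exp (- s * c)) * indicator {0..t} s = ennreal (indicator {0..t} s * exp (- s * c))" for s
    by (auto simp: indicator_def)
  ultimately show ?thesis by (simp add: diff_divide_distrib)
qed

text \<open>The constant produced by \<open>nn_integral_gauss_weight_mixture\<close>; with it the
  comparison of the two powers becomes a ratio of two values of one function.\<close>

definition mixture_const :: "nat \<Rightarrow> real \<Rightarrow> real" where
  "mixture_const d a = (4 * pi) powr (- (real d / 2)) * 4 powr a * Gamma a"

lemma mixture_const_pos: "a > 0 \<Longrightarrow> mixture_const d a > 0"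
  by (simp add: mixture_const_def Gamma_real_pos)

text \<open>In the ratio the powers of pi cancel, and the two powers of 4 leave the factor
  2^\<alpha> of \<kappa>. The other two factors, \<open>Gamma ((\<alpha> - \<beta>) / 2)\<close> and
  \<open>- Gamma_neg_half \<beta>\<close>, normalise the mixtures that represent
  |y|^(\<beta>-\<alpha>) and |y|^\<beta>.\<close>

lemma kappa_eq_mixture:
  assumes "0 < \<beta>" "\<beta> < \<alpha>" "\<alpha> < 2" "\<alpha> < real d"
  shows "- kappa d \<alpha> \<beta> = mixture_const d ((d + \<beta>) / 2) * Gamma ((\<alpha> - \<beta>) / 2) /
     (- Gamma_neg_half \<beta> * mixture_const d ((d + \<beta> - \<alpha>) / 2))"
proof -
  have "4 powr ((d + \<beta>) / 2) = 4 powr (\<alpha> / 2) * 4 powr ((d + \<beta> - \<alpha>) / 2)"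
    by (subst powr_add[symmetric]) (rule arg_cong[where f = "\<lambda>e. 4 powr e"], simp add: field_simps)
  moreover have "(4::real) powr (\<alpha> / 2) = 2 powr \<alpha>"
  proof -
    have "(4::real) powr (\<alpha> / 2) = (2 powr 2) powr (\<alpha> / 2)" by simp
    also have "\<dots> = 2 powr \<alpha>" unfolding powr_powr by simp
    finally show ?thesis .
  qed
  ultimately have 4: "4 powr ((d + \<beta>) / 2) = 2 powr \<alpha> * 4 powr ((d + \<beta> - \<alpha>) / 2)" by simp
  have g: "Gamma ((d + \<beta> - \<alpha>) / 2) \<noteq> 0"
    using assms Gamma_real_pos[of "(d + \<beta> - \<alpha>) / 2"] by (simp add: less_imp_neq[symmetric])
  have alg: "- (p * g * h / (n * k)) = (q * (p * r) * h) * g / (- n * (q * r * k))"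
    if "q \<noteq> 0" "r \<noteq> 0" "n \<noteq> 0" "k \<noteq> 0" for p g h n k q r :: real
    using that by (simp add: field_simps)
  show ?thesis
    unfolding kappa_def mixture_const_def 4
    by (rule alg) (use Gamma_neg_half_neg[of \<beta>] assms g in auto)
qed

lemma kappa_neg:
  assumes "0 < \<beta>" "\<beta> < \<alpha>" "\<alpha> < 2" "\<alpha> < real d"
  shows "kappa d \<alpha> \<beta> < 0"
proof -
  have "0 < - kappa d \<alpha> \<beta>"
    unfolding kappa_eq_mixture[OF assms]
    using assms Gamma_neg_half_neg[of \<beta>]
    by (intro divide_pos_pos mult_pos_pos mixture_const_pos Gamma_real_pos) auto
  then show ?thesis by simp
qed

definition spectral_integral :: "real \<Rightarrow> real \<Rightarrow> real \<Rightarrow> 'a::euclidean_space \<Rightarrow> real" where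
  "spectral_integral \<alpha> \<beta> t x =
     (LINT \<xi>|lborel. cos (\<xi> \<bullet> x) * ((1 - exp (- t * norm \<xi> powr \<alpha>)) * norm \<xi> powr (- (real DIM('a) + \<beta>))))"

text \<open>Near r = 0 neither Gaussian term is integrable by itself against r^(-1-\<beta>/2). Their
  difference is, because on the Fourier side it carries the factor 1 - exp(-t |\<xi>|^\<alpha>);
  integrating over r first then turns the Gaussian densities into |\<xi>|^(-d-\<beta>).\<close>

lemma
  fixes x :: "'a::euclidean_space" and \<alpha> \<beta> t :: real
  assumes "0 < \<beta>" "\<beta> < \<alpha>" "\<alpha> < real DIM('a)" "t > 0"
  shows gauss_difference_integrable: "integrable lborel (\<lambda>r. indicator {0<..} r * r powr (- 1 - \<beta> / 2) * (exp (- r * (norm x)\<^sup>2) - stable_gauss \<alpha> x t r))"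
    and gauss_difference_integral: "(LINT r|lborel. indicator {0<..} r * r powr (- 1 - \<beta> / 2) * (exp (- r * (norm x)\<^sup>2) - stable_gauss \<alpha> x t r))
       = mixture_const DIM('a) ((DIM('a) + \<beta>) / 2) * spectral_integral \<alpha> \<beta> t x"
proof -
  define a where "a = (real DIM('a) + \<beta>) / 2"
  have a: "a > 0" using assms by (simp add: a_def add_nonneg_pos)
  define e where "e = (\<lambda>\<xi>::'a. 1 - exp (- t * norm \<xi> powr \<alpha>))"
  have e01: "0 \<le> e \<xi>" "e \<xi> \<le> 1" for \<xi> using assms by (auto simp: e_def)
  \<comment> \<open>At \<xi> = 0 the integral of the weights over r diverges; the factor
    \<open>e\<close> vanishes there and removes that point from the estimate.\<close>
  have e0: "e 0 = 0" using assms by (simp add: e_def)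
  have [measurable]: "e \<in> borel_measurable borel" unfolding e_def by measurable
  define w where "w = (\<lambda>r \<xi>::'a. indicator {0<..} r * r powr (- 1 - \<beta> / 2) * gauss_weight r \<xi>)"
  have w0: "0 \<le> w r \<xi>" for r \<xi> by (simp add: w_def)
  have [measurable]: "(\<lambda>(r, \<xi>). w r \<xi>) \<in> borel_measurable (borel \<Otimes>\<^sub>M borel)"
    unfolding w_def by measurable
  have wI: "(\<integral>\<^sup>+ r. ennreal (w r \<xi>) \<partial>lborel) = ennreal (mixture_const DIM('a) a * norm \<xi> powr (- 2 * a))" if "\<xi> \<noteq> 0" for \<xi>
  proof -
    have ee: "DIM('a) / 2 - a - 1 = - 1 - \<beta> / 2" by (simp add: a_def field_simps)
    show ?thesis
      using nn_integral_gauss_weight_mixture[OF a that] unfolding ee by (simp add: w_def mixture_const_def)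
  qed
  have wL: "(LINT r|lborel. w r \<xi>) = mixture_const DIM('a) a * norm \<xi> powr (- 2 * a)" if "\<xi> \<noteq> 0" for \<xi>
    using wI[OF that] mixture_const_pos[OF a, of "DIM('a)"] by (subst integral_eq_nn_integral) (auto simp: w0)
  define f where "f = (\<lambda>r \<xi>. w r \<xi> * (cos (\<xi> \<bullet> x) * e \<xi>))"
  have fm: "(\<lambda>(r, \<xi>). f r \<xi>) \<in> borel_measurable (borel \<Otimes>\<^sub>M borel)"
    unfolding f_def by measurable
  have a2: "- 2 * a = - (real DIM('a) + \<beta>)" by (simp add: a_def)
  have "(\<integral>\<^sup>+ \<xi>. \<integral>\<^sup>+ r. ennreal \<bar>f r \<xi>\<bar> \<partial>lborel \<partial>lborel) \<le>
    (\<integral>\<^sup>+ \<xi>. ennreal (mixture_const DIM('a) a * (e \<xi> * norm \<xi> powr (- (real DIM('a) + \<beta>)))) \<partial>lborel)"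
  proof (rule nn_integral_mono)
    fix \<xi> :: 'a
    have "(\<integral>\<^sup>+ r. ennreal \<bar>f r \<xi>\<bar> \<partial>lborel) \<le> (\<integral>\<^sup>+ r. ennreal (e \<xi>) * ennreal (w r \<xi>) \<partial>lborel)"
    proof (rule nn_integral_mono)
      fix r
      have "\<bar>f r \<xi>\<bar> = (e \<xi> * w r \<xi>) * \<bar>cos (\<xi> \<bullet> x)\<bar>" using w0 e01 by (simp add: f_def abs_mult)
      also have "\<dots> \<le> e \<xi> * w r \<xi>" using w0 e01 by (intro mult_left_le) auto
      finally show "ennreal \<bar>f r \<xi>\<bar> \<le> ennreal (e \<xi>) * ennreal (w r \<xi>)"
        using w0 e01 by (subst ennreal_mult[symmetric]) (auto intro: ennreal_leI)
    qed
    also have "\<dots> = ennreal (e \<xi>) * (\<integral>\<^sup>+ r. ennreal (w r \<xi>) \<partial>lborel)"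
      by (rule nn_integral_cmult) measurable
    also have "\<dots> \<le> ennreal (mixture_const DIM('a) a * (e \<xi> * norm \<xi> powr (- (real DIM('a) + \<beta>))))"
    proof (cases "\<xi> = 0")
      case False
      show ?thesis unfolding wI[OF False] a2 using e01 mixture_const_pos[OF a, of "DIM('a)"]
        by (subst ennreal_mult[symmetric]) (auto simp: mult_ac)
    qed (simp add: e0)
    finally show "(\<integral>\<^sup>+ r. ennreal \<bar>f r \<xi>\<bar> \<partial>lborel) \<le> ennreal (mixture_const DIM('a) a * (e \<xi> * norm \<xi> powr (- (real DIM('a) + \<beta>))))" .
  qed
  also have "\<dots> < \<infinity>"
    using integrable_mult_right[OF stable_difference_integrable[OF assms], of "mixture_const DIM('a) a"] e01 mixture_const_pos[OF a, of "DIM('a)"]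
    by (subst nn_integral_eq_integral) (auto simp: e_def)
  finally have fin: "(\<integral>\<^sup>+ \<xi>. \<integral>\<^sup>+ r. ennreal \<bar>f r \<xi>\<bar> \<partial>lborel \<partial>lborel) < \<infinity>" .
  have 1: "(LINT \<xi>|lborel. f r \<xi>) = indicator {0<..} r * r powr (- 1 - \<beta> / 2) * (exp (- r * (norm x)\<^sup>2) - stable_gauss \<alpha> x t r)" for r
  proof (cases "r > 0")
    case True
    have i: "integrable lborel (\<lambda>\<xi>. cos (\<xi> \<bullet> x) * gauss_weight r \<xi>)"
      "integrable lborel (\<lambda>\<xi>. cos (\<xi> \<bullet> x) * exp (- t * norm \<xi> powr \<alpha>) * gauss_weight r \<xi>)"
      using True assms by (intro gauss_weight_bounded_integrable; auto simp: abs_mult intro!: mult_le_one)+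
    have "f r = (\<lambda>\<xi>. r powr (- 1 - \<beta> / 2) * (cos (\<xi> \<bullet> x) * gauss_weight r \<xi> - cos (\<xi> \<bullet> x) * exp (- t * norm \<xi> powr \<alpha>) * gauss_weight r \<xi>))"
      using True by (simp add: f_def w_def e_def algebra_simps fun_eq_iff)
    then have "(LINT \<xi>|lborel. f r \<xi>) = r powr (- 1 - \<beta> / 2) * ((LINT \<xi>|lborel. cos (\<xi> \<bullet> x) * gauss_weight r \<xi>) - stable_gauss \<alpha> x t r)"
      using Bochner_Integration.integral_diff[OF i] by (simp only: integral_mult_right_zero stable_gauss_def)
    then show ?thesis using True by (simp add: gauss_weight_fourier)
  qed (simp add: f_def w_def)
  have 2: "(LINT \<xi>|lborel. LINT r|lborel. f r \<xi>) = mixture_const DIM('a) a * spectral_integral \<alpha> \<beta> t x"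
  proof -
    have "(LINT r|lborel. f r \<xi>) = mixture_const DIM('a) a * (cos (\<xi> \<bullet> x) * ((1 - exp (- t * norm \<xi> powr \<alpha>)) * norm \<xi> powr (- (real DIM('a) + \<beta>))))" for \<xi>
    proof (cases "\<xi> = 0")
      case True
      then show ?thesis using assms by (simp add: f_def e0)
    next
      case False
      have "(LINT r|lborel. f r \<xi>) = (LINT r|lborel. w r \<xi>) * (cos (\<xi> \<bullet> x) * e \<xi>)"
        unfolding f_def by (rule integral_mult_left_zero)
      then show ?thesis unfolding wL[OF False] a2 by (simp add: e_def mult_ac)
    qed
    then show ?thesis by (simp only: spectral_integral_def integral_mult_right_zero)
  qed
  show "integrable lborel (\<lambda>r. indicator {0<..} r * r powr (- 1 - \<beta> / 2) * (exp (- r * (norm x)\<^sup>2) - stable_gauss \<alpha> x t r))"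
    using Fubini_lborel(2)[OF fm fin] unfolding 1 .
  show "(LINT r|lborel. indicator {0<..} r * r powr (- 1 - \<beta> / 2) * (exp (- r * (norm x)\<^sup>2) - stable_gauss \<alpha> x t r))
       = mixture_const DIM('a) ((DIM('a) + \<beta>) / 2) * spectral_integral \<alpha> \<beta> t x"
    using Fubini_lborel(1)[OF fm fin] unfolding 1 2 a_def .
qed

text \<open>Time and mixing variable are joined into one variable, so that a single exchange with
  \<xi> suffices. The time integral of exp(-s |\<xi>|^\<alpha>) is (1 - exp(-t |\<xi>|^\<alpha>))
  |\<xi>|^(-\<alpha>), and this extra -\<alpha> brings the exponent to the same -d-\<beta> as for
  |y|^\<beta>.\<close>

lemma
  fixes x :: "'a::euclidean_space" and \<alpha> \<beta> t :: real
  assumes "0 < \<beta>" "\<beta> < \<alpha>" "\<alpha> < real DIM('a)" "t > 0"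
  shows gauss_potential_integrable: "integrable lborel (\<lambda>(s, u). indicator {0..t} s * (indicator {0<..} u * u powr ((\<alpha> - \<beta>) / 2 - 1)) * stable_gauss \<alpha> x s u)"
    and gauss_potential_integral: "(LINT (s, u)|lborel. indicator {0..t} s * (indicator {0<..} u * u powr ((\<alpha> - \<beta>) / 2 - 1)) * stable_gauss \<alpha> x s u)
       = mixture_const DIM('a) ((DIM('a) + \<beta> - \<alpha>) / 2) * spectral_integral \<alpha> \<beta> t x"
proof -
  define a where "a = (real DIM('a) + \<beta> - \<alpha>) / 2"
  have a: "a > 0" using assms by (simp add: a_def)
  define w where "w = (\<lambda>(\<tau>::real \<times> real) \<xi>::'a. indicator {0..t} (fst \<tau>) * exp (- fst \<tau> * norm \<xi> powr \<alpha>) * (indicator {0<..} (snd \<tau>) * snd \<tau> powr ((\<alpha> - \<beta>) / 2 - 1) * gauss_weight (snd \<tau>) \<xi>))"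
  have w0: "0 \<le> w \<tau> \<xi>" for \<tau> \<xi> by (cases \<tau>) (simp add: w_def)
  have wm[measurable]: "(\<lambda>(\<tau>, \<xi>). w \<tau> \<xi>) \<in> borel_measurable (borel \<Otimes>\<^sub>M borel)"
    unfolding w_def borel_prod[symmetric] by measurable
  define F where "F = (\<lambda>\<xi>::'a. (1 - exp (- t * norm \<xi> powr \<alpha>)) * norm \<xi> powr (- (real DIM('a) + \<beta>)))"
  have [measurable]: "F \<in> borel_measurable borel" unfolding F_def by measurable
  have F0: "0 \<le> F \<xi>" for \<xi> using assms by (simp add: F_def)
  have wI: "(\<integral>\<^sup>+ \<tau>. ennreal (w \<tau> \<xi>) \<partial>lborel) = ennreal (mixture_const DIM('a) a * F \<xi>)" if "\<xi> \<noteq> 0" for \<xi>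
  proof -
    have ee: "DIM('a) / 2 - a - 1 = (\<alpha> - \<beta>) / 2 - 1" by (simp add: a_def field_simps)
    have c: "norm \<xi> powr \<alpha> > 0" using that by simp
    have "(\<integral>\<^sup>+ \<tau>. ennreal (w \<tau> \<xi>) \<partial>lborel) = (\<integral>\<^sup>+ s. \<integral>\<^sup>+ u. ennreal (w (s, u) \<xi>) \<partial>lborel \<partial>lborel)"
      unfolding lborel_prod[symmetric] by (rule lborel.nn_integral_fst[symmetric]) (simp add: lborel_prod)
    also have "\<dots> = (\<integral>\<^sup>+ s. ennreal (indicator {0..t} s * exp (- s * norm \<xi> powr \<alpha>)) * ennreal (mixture_const DIM('a) a * norm \<xi> powr (- 2 * a)) \<partial>lborel)"
    proof (rule nn_integral_cong)
      fix s
      have "(\<integral>\<^sup>+ u. ennreal (w (s, u) \<xi>) \<partial>lborel) = (\<integral>\<^sup>+ u. ennreal (indicator {0..t} s * exp (- s * norm \<xi> powr \<alpha>)) * ennreal (indicator {0<..} u * u powr ((\<alpha> - \<beta>) / 2 - 1) * gauss_weight u \<xi>) \<partial>lborel)"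
        by (intro nn_integral_cong) (simp add: w_def ennreal_mult[symmetric])
      also have "\<dots> = ennreal (indicator {0..t} s * exp (- s * norm \<xi> powr \<alpha>)) * (\<integral>\<^sup>+ u. ennreal (indicator {0<..} u * u powr ((\<alpha> - \<beta>) / 2 - 1) * gauss_weight u \<xi>) \<partial>lborel)"
        by (rule nn_integral_cmult) measurable
      also have "(\<integral>\<^sup>+ u. ennreal (indicator {0<..} u * u powr ((\<alpha> - \<beta>) / 2 - 1) * gauss_weight u \<xi>) \<partial>lborel) = ennreal (mixture_const DIM('a) a * norm \<xi> powr (- 2 * a))"
        using nn_integral_gauss_weight_mixture[OF a that] unfolding ee by (simp add: mixture_const_def)
      finally show "(\<integral>\<^sup>+ u. ennreal (w (s, u) \<xi>) \<partial>lborel) = ennreal (indicator {0..t} s * exp (- s * norm \<xi> powr \<alpha>)) * ennreal (mixture_const DIM('a) a * norm \<xi> powr (- 2 * a))" .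
    qed
    also have "\<dots> = (\<integral>\<^sup>+ s. ennreal (indicator {0..t} s * exp (- s * norm \<xi> powr \<alpha>)) \<partial>lborel) * ennreal (mixture_const DIM('a) a * norm \<xi> powr (- 2 * a))"
      by (rule nn_integral_multc) measurable
    also have "\<dots> = ennreal ((1 - exp (- t * norm \<xi> powr \<alpha>)) / norm \<xi> powr \<alpha>) * ennreal (mixture_const DIM('a) a * norm \<xi> powr (- 2 * a))"
      using assms c by (subst nn_integral_exp_interval) auto
    also have "\<dots> = ennreal ((1 - exp (- t * norm \<xi> powr \<alpha>)) / norm \<xi> powr \<alpha> * (mixture_const DIM('a) a * norm \<xi> powr (- 2 * a)))"
      using assms mixture_const_pos[OF a, of "DIM('a)"] by (intro ennreal_mult[symmetric]) auto
    also have "(1 - exp (- t * norm \<xi> powr \<alpha>)) / norm \<xi> powr \<alpha> * (mixture_const DIM('a) a * norm \<xi> powr (- 2 * a)) =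
       mixture_const DIM('a) a * ((1 - exp (- t * norm \<xi> powr \<alpha>)) * (norm \<xi> powr (- \<alpha>) * norm \<xi> powr (- 2 * a)))"
      by (simp add: powr_minus_divide)
    also have "norm \<xi> powr (- \<alpha>) * norm \<xi> powr (- 2 * a) = norm \<xi> powr (- (real DIM('a) + \<beta>))"
      by (subst powr_add[symmetric]) (rule arg_cong[where f = "\<lambda>e. norm \<xi> powr e"], simp add: a_def field_simps)
    finally show ?thesis by (simp add: F_def)
  qed
  have wL: "(LINT \<tau>|lborel. w \<tau> \<xi>) = mixture_const DIM('a) a * F \<xi>" if "\<xi> \<noteq> 0" for \<xi>
    using wI[OF that] mixture_const_pos[OF a, of "DIM('a)"] F0[of \<xi>] by (subst integral_eq_nn_integral) (auto simp: w0)
  \<comment> \<open>No factor vanishes at \<xi> = 0 here, so that point is discarded as a null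
    set.\<close>
  have AE0: "AE \<xi> in lborel. \<xi> \<noteq> (0::'a)" by (rule AE_lborel_singleton)
  define f where "f = (\<lambda>\<tau> \<xi>. w \<tau> \<xi> * cos (\<xi> \<bullet> x))"
  have fm: "(\<lambda>(\<tau>, \<xi>). f \<tau> \<xi>) \<in> borel_measurable (borel \<Otimes>\<^sub>M borel)"
    unfolding f_def by measurable
  have "(\<integral>\<^sup>+ \<xi>. \<integral>\<^sup>+ \<tau>. ennreal \<bar>f \<tau> \<xi>\<bar> \<partial>lborel \<partial>lborel) \<le> (\<integral>\<^sup>+ \<xi>. \<integral>\<^sup>+ \<tau>. ennreal (w \<tau> \<xi>) \<partial>lborel \<partial>lborel)"
    using w0 by (intro nn_integral_mono ennreal_leI) (auto simp: f_def abs_mult intro!: mult_left_le)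
  also have "\<dots> = (\<integral>\<^sup>+ \<xi>. ennreal (mixture_const DIM('a) a * F \<xi>) \<partial>lborel)"
    by (rule nn_integral_cong_AE) (use AE0 in eventually_elim, rule wI)
  also have "\<dots> < \<infinity>"
    using integrable_mult_right[OF stable_difference_integrable[OF assms], of "mixture_const DIM('a) a"] F0 mixture_const_pos[OF a, of "DIM('a)"]
    by (subst nn_integral_eq_integral) (auto simp: F_def)
  finally have fin: "(\<integral>\<^sup>+ \<xi>. \<integral>\<^sup>+ \<tau>. ennreal \<bar>f \<tau> \<xi>\<bar> \<partial>lborel \<partial>lborel) < \<infinity>" .
  have 1: "(LINT \<xi>|lborel. f \<tau> \<xi>) = (case \<tau> of (s, u) \<Rightarrow> indicator {0..t} s * (indicator {0<..} u * u powr ((\<alpha> - \<beta>) / 2 - 1)) * stable_gauss \<alpha> x s u)" for \<tau>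
  proof -
    obtain s u where \<tau>: "\<tau> = (s, u)" by (cases \<tau>)
    have "f (s, u) = (\<lambda>\<xi>. indicator {0..t} s * (indicator {0<..} u * u powr ((\<alpha> - \<beta>) / 2 - 1)) * (cos (\<xi> \<bullet> x) * exp (- s * norm \<xi> powr \<alpha>) * gauss_weight u \<xi>))"
      by (simp add: f_def w_def fun_eq_iff)
    then show ?thesis unfolding \<tau> by (simp only: integral_mult_right_zero stable_gauss_def prod.case)
  qed
  have 2: "(LINT \<xi>|lborel. LINT \<tau>|lborel. f \<tau> \<xi>) = mixture_const DIM('a) a * spectral_integral \<alpha> \<beta> t x"
  proof -
    have "(LINT \<xi>|lborel. LINT \<tau>|lborel. f \<tau> \<xi>) = (LINT \<xi>|lborel. mixture_const DIM('a) a * (cos (\<xi> \<bullet> x) * F \<xi>))"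
    proof (rule integral_cong_AE)
      show "(\<lambda>\<xi>. LINT \<tau>|lborel. f \<tau> \<xi>) \<in> borel_measurable lborel"
        using Fubini_lborel(3)[OF fm fin] by auto
      show "AE \<xi> in lborel. (LINT \<tau>|lborel. f \<tau> \<xi>) = mixture_const DIM('a) a * (cos (\<xi> \<bullet> x) * F \<xi>)"
        using AE0
      proof eventually_elim
        case (elim \<xi>)
        have "(LINT \<tau>|lborel. f \<tau> \<xi>) = (LINT \<tau>|lborel. w \<tau> \<xi>) * cos (\<xi> \<bullet> x)"
          unfolding f_def by (rule integral_mult_left_zero)
        then show ?case unfolding wL[OF elim] by (simp add: mult_ac)
      qed
    qed measurable
    then show ?thesis by (simp only: spectral_integral_def F_def integral_mult_right_zero)
  qed
  show "integrable lborel (\<lambda>(s, u). indicator {0..t} s * (indicator {0<..} u * u powr ((\<alpha> - \<beta>) / 2 - 1)) * stable_gauss \<alpha> x s u)"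
    using Fubini_lborel(2)[OF fm fin] unfolding 1 .
  show "(LINT (s, u)|lborel. indicator {0..t} s * (indicator {0<..} u * u powr ((\<alpha> - \<beta>) / 2 - 1)) * stable_gauss \<alpha> x s u)
       = mixture_const DIM('a) ((DIM('a) + \<beta> - \<alpha>) / 2) * spectral_integral \<alpha> \<beta> t x"
    using Fubini_lborel(1)[OF fm fin] unfolding 1 2 a_def .
qed

section \<open>The stable semigroup on nonnegative functions\<close>

lemma ennreal_cmult_cancel:
  assumes "c > 0" "y \<ge> 0" "ennreal c * X = ennreal y"
  shows "X = ennreal (y / c)"
proof -
  have "X = ennreal (1 / c) * (ennreal c * X)"
    using assms(1) by (simp add: mult.assoc[symmetric] ennreal_mult[symmetric])
  also have "\<dots> = ennreal (y / c)" using assms by (simp add: ennreal_mult[symmetric])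
  finally show ?thesis .
qed

text \<open>Total mass one is an assumption here and is later supplied by the law of an increment of
  the process. As written it concerns the positive part of the kernel; the sign of the kernel is
  derived from it.\<close>

locale stable_semigroup =
  fixes \<alpha> :: real and p :: "real \<Rightarrow> 'a::euclidean_space \<Rightarrow> real"
  assumes \<alpha>: "0 < \<alpha>" "\<alpha> < 2" "\<alpha> < real DIM('a)"
    and p_eq: "p = stable_kernel \<alpha>"
    and mass: "\<And>s. s > 0 \<Longrightarrow> (\<integral>\<^sup>+ z. ennreal (p s z) \<partial>lborel) = 1"
begin

abbreviation npow :: "real \<Rightarrow> 'a \<Rightarrow> ennreal" where
  "npow e \<equiv> (\<lambda>y. ennreal (norm y powr e))"

definition P :: "real \<Rightarrow> ('a \<Rightarrow> ennreal) \<Rightarrow> 'a \<Rightarrow> ennreal" where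
  "P s f x = (\<integral>\<^sup>+ z. f (x + z) * ennreal (p s z) \<partial>lborel)"

lemma p_measurable [measurable]:
  assumes [measurable]: "f \<in> borel_measurable M" "g \<in> borel_measurable M"
  shows "(\<lambda>w. p (f w) (g w)) \<in> borel_measurable M"
  unfolding p_eq by measurable

lemma P_measurable [measurable]:
  assumes [measurable]: "h \<in> borel_measurable borel" "f \<in> borel_measurable M" "g \<in> borel_measurable M"
  shows "(\<lambda>w. P (f w) h (g w)) \<in> borel_measurable M"
  unfolding P_def by measurable

lemma P_cmult:
  assumes [measurable]: "f \<in> borel_measurable borel"
  shows "P s (\<lambda>y. c * f y) x = c * P s f x"
  unfolding P_def by (simp add: mult.assoc nn_integral_cmult)

lemma P_add:
  assumes [measurable]: "f \<in> borel_measurable borel" "g \<in> borel_measurable borel"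
  shows "P s (\<lambda>y. f y + g y) x = P s f x + P s g x"
  unfolding P_def by (simp add: distrib_right nn_integral_add)

lemma P_const: "s > 0 \<Longrightarrow> P s (\<lambda>y. c) x = c"
  unfolding P_def using mass[of s] by (simp add: nn_integral_cmult)

lemma P_mono: "(\<And>y. f y \<le> g y) \<Longrightarrow> P s f x \<le> P s g x"
  unfolding P_def by (intro nn_integral_mono mult_right_mono) auto

text \<open>An absolutely continuous law does not see the single point 0. This absorbs the
  convention that \<open>powr\<close> is 0 at base 0, where the mixture of Gaussians for a negative
  power is infinite.\<close>

lemma P_cong_nonzero:
  assumes "\<And>y. y \<noteq> 0 \<Longrightarrow> f y = g y"
  shows "P s f x = P s g x"
  unfolding P_def
proof (rule nn_integral_cong_AE)
  have "AE z in lborel. z \<noteq> - x" by (rule AE_lborel_singleton)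
  then show "AE z in lborel. f (x + z) * ennreal (p s z) = g (x + z) * ennreal (p s z)"
  proof eventually_elim
    case (elim z)
    then have "x + z \<noteq> 0" by (metis add.commute eq_neg_iff_add_eq_0)
    then show ?case using assms by simp
  qed
qed

lemma P_nn_integral:
  assumes [measurable]: "(\<lambda>(u, y). h u y) \<in> borel_measurable (borel \<Otimes>\<^sub>M borel)"
  shows "P s (\<lambda>y. \<integral>\<^sup>+ u. h (u::real) y \<partial>lborel) x = (\<integral>\<^sup>+ u. P s (h u) x \<partial>lborel)"
proof -
  have "P s (\<lambda>y. \<integral>\<^sup>+ u. h u y \<partial>lborel) x = (\<integral>\<^sup>+ z. \<integral>\<^sup>+ u. h u (x + z) * ennreal (p s z) \<partial>lborel \<partial>lborel)"
    unfolding P_def by (intro nn_integral_cong nn_integral_multc[symmetric]) measurable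
  also have "\<dots> = (\<integral>\<^sup>+ u. \<integral>\<^sup>+ z. h u (x + z) * ennreal (p s z) \<partial>lborel \<partial>lborel)"
    by (rule lborel_pair.Fubini') measurable
  finally show ?thesis by (simp add: P_def)
qed

lemma P_gauss:
  assumes s: "s > 0" and u: "u > 0"
  shows "P s (\<lambda>y. ennreal (exp (- u * (norm y)\<^sup>2))) x = ennreal (stable_gauss \<alpha> x s u)"
    and stable_gauss_nonneg: "0 \<le> stable_gauss \<alpha> x s u"
proof -
  have nn: "AE z in lborel. 0 \<le> p s z"
    using stable_kernel_nonneg_AE[OF \<alpha>(1) s] mass[OF s] by (simp add: p_eq)
  have "P s (\<lambda>y. ennreal (exp (- u * (norm y)\<^sup>2))) x = (\<integral>\<^sup>+ z. ennreal (p s z * exp (- u * (norm (x + z))\<^sup>2)) \<partial>lborel)"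
    unfolding P_def by (rule nn_integral_cong_AE) (use nn in eventually_elim, simp add: ennreal_mult mult.commute)
  also have "\<dots> = ennreal (LINT z|lborel. p s z * exp (- u * (norm (x + z))\<^sup>2))"
    by (rule nn_integral_eq_integral) (use stable_kernel_gauss(1)[OF \<alpha>(1) s u] nn in \<open>auto simp: p_eq\<close>)
  finally show "P s (\<lambda>y. ennreal (exp (- u * (norm y)\<^sup>2))) x = ennreal (stable_gauss \<alpha> x s u)"
    using stable_kernel_gauss(2)[OF \<alpha>(1) s u, of x] by (simp add: p_eq)
  have "0 \<le> (LINT z|lborel. p s z * exp (- u * (norm (x + z))\<^sup>2))"
    by (intro integral_nonneg_AE) (use nn in auto)
  then show "0 \<le> stable_gauss \<alpha> x s u"
    using stable_kernel_gauss(2)[OF \<alpha>(1) s u, of x] by (simp add: p_eq)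
qed

text \<open>\<open>P s\<close> preserves constants, so the Gaussian and its complement add up to 1,
  and the finite Gaussian term can be cancelled.\<close>

lemma
  assumes s: "s > 0" and u: "u > 0"
  shows P_gauss_compl: "P s (\<lambda>y. ennreal (1 - exp (- u * (norm y)\<^sup>2))) x = ennreal (1 - stable_gauss \<alpha> x s u)"
    and stable_gauss_le_1: "stable_gauss \<alpha> x s u \<le> 1"
proof -
  have "P s (\<lambda>y. ennreal (1 - exp (- u * (norm y)\<^sup>2))) x + P s (\<lambda>y. ennreal (exp (- u * (norm y)\<^sup>2))) x = P s (\<lambda>y. 1) x"
    using u by (subst P_add[symmetric]) (auto intro!: arg_cong[where f = "\<lambda>f. P s f x"] simp flip: ennreal_plus)
  then have *: "P s (\<lambda>y. ennreal (1 - exp (- u * (norm y)\<^sup>2))) x + ennreal (stable_gauss \<alpha> x s u) = 1"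
    by (simp only: P_const[OF s] P_gauss(1)[OF s u])
  have "ennreal (stable_gauss \<alpha> x s u) \<le> P s (\<lambda>y. ennreal (1 - exp (- u * (norm y)\<^sup>2))) x + ennreal (stable_gauss \<alpha> x s u)"
    by (rule add_increasing) simp_all
  then have "ennreal (stable_gauss \<alpha> x s u) \<le> 1" unfolding * .
  then show le: "stable_gauss \<alpha> x s u \<le> 1" by simp
  have "ennreal (1 - stable_gauss \<alpha> x s u) + ennreal (stable_gauss \<alpha> x s u) = 1"
    using le stable_gauss_nonneg[OF s u, of x] by (simp flip: ennreal_plus)
  with * have "ennreal (stable_gauss \<alpha> x s u) + P s (\<lambda>y. ennreal (1 - exp (- u * (norm y)\<^sup>2))) x = ennreal (stable_gauss \<alpha> x s u) + ennreal (1 - stable_gauss \<alpha> x s u)"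
    by (simp only: add.commute)
  then show "P s (\<lambda>y. ennreal (1 - exp (- u * (norm y)\<^sup>2))) x = ennreal (1 - stable_gauss \<alpha> x s u)"
    by (simp only: ennreal_add_left_cancel infinity_ennreal_def ennreal_neq_top simp_thms)
qed

lemma P_riesz:
  assumes s: "s > 0" and \<gamma>: "\<gamma> > 0"
  shows "ennreal (Gamma (\<gamma> / 2)) * P s (npow (- \<gamma>)) x =
    (\<integral>\<^sup>+ u. ennreal (indicator {0<..} u * u powr (\<gamma> / 2 - 1) * stable_gauss \<alpha> x s u) \<partial>lborel)"
proof -
  have "ennreal (Gamma (\<gamma> / 2)) * P s (npow (- \<gamma>)) x = P s (\<lambda>y. ennreal (Gamma (\<gamma> / 2)) * ennreal (norm y powr (- \<gamma>))) x"
    by (rule P_cmult[symmetric]) measurable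
  also have "\<dots> = P s (\<lambda>y. \<integral>\<^sup>+ u. ennreal (indicator {0<..} u * u powr (\<gamma> / 2 - 1)) * ennreal (exp (- u * (norm y)\<^sup>2)) \<partial>lborel) x"
  proof (rule P_cong_nonzero)
    fix y :: 'a assume "y \<noteq> 0"
    then have y: "(norm y)\<^sup>2 > 0" by simp
    have pw: "((norm y)\<^sup>2) powr (\<gamma> / 2) = norm y powr \<gamma>"
      using powr_powr[of "norm y" 2 "\<gamma> / 2"] y by simp
    have "(\<integral>\<^sup>+ u. ennreal (indicator {0<..} u * u powr (\<gamma> / 2 - 1)) * ennreal (exp (- u * (norm y)\<^sup>2)) \<partial>lborel) =
       (\<integral>\<^sup>+ u. ennreal (indicator {0<..} u * (u powr (\<gamma> / 2 - 1) * exp (- (norm y)\<^sup>2 * u))) \<partial>lborel)"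
    proof (rule nn_integral_cong)
      fix u :: real
      have e: "- u * (norm y)\<^sup>2 = - (norm y)\<^sup>2 * u" by simp
      show "ennreal (indicator {0<..} u * u powr (\<gamma> / 2 - 1)) * ennreal (exp (- u * (norm y)\<^sup>2)) =
         ennreal (indicator {0<..} u * (u powr (\<gamma> / 2 - 1) * exp (- (norm y)\<^sup>2 * u)))"
        unfolding e by (subst ennreal_mult[symmetric]) (simp_all only: mult.assoc, simp_all)
    qed
    also have "\<dots> = ennreal (Gamma (\<gamma> / 2) / ((norm y)\<^sup>2) powr (\<gamma> / 2))"
      using \<gamma> y by (intro nn_integral_Gamma) auto
    also have "\<dots> = ennreal (Gamma (\<gamma> / 2)) * ennreal (norm y powr (- \<gamma>))"
      unfolding pw powr_minus_divide using \<gamma> by (subst ennreal_mult[symmetric]) (simp_all add: Gamma_real_nonneg)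
    finally show "ennreal (Gamma (\<gamma> / 2)) * ennreal (norm y powr (- \<gamma>)) = (\<integral>\<^sup>+ u. ennreal (indicator {0<..} u * u powr (\<gamma> / 2 - 1)) * ennreal (exp (- u * (norm y)\<^sup>2)) \<partial>lborel)" ..
  qed
  also have "\<dots> = (\<integral>\<^sup>+ u. P s (\<lambda>y. ennreal (indicator {0<..} u * u powr (\<gamma> / 2 - 1)) * ennreal (exp (- u * (norm y)\<^sup>2))) x \<partial>lborel)"
    by (rule P_nn_integral) measurable
  also have "\<dots> = (\<integral>\<^sup>+ u. ennreal (indicator {0<..} u * u powr (\<gamma> / 2 - 1) * stable_gauss \<alpha> x s u) \<partial>lborel)"
  proof (rule nn_integral_cong)
    fix u :: real
    have "P s (\<lambda>y. ennreal (indicator {0<..} u * u powr (\<gamma> / 2 - 1)) * ennreal (exp (- u * (norm y)\<^sup>2))) x =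
      ennreal (indicator {0<..} u * u powr (\<gamma> / 2 - 1)) * P s (\<lambda>y. ennreal (exp (- u * (norm y)\<^sup>2))) x"
      by (rule P_cmult) measurable
    then show "P s (\<lambda>y. ennreal (indicator {0<..} u * u powr (\<gamma> / 2 - 1)) * ennreal (exp (- u * (norm y)\<^sup>2))) x =
       ennreal (indicator {0<..} u * u powr (\<gamma> / 2 - 1) * stable_gauss \<alpha> x s u)"
      using P_gauss[OF s, of u x] stable_gauss_nonneg[OF s, of u x]
      by (cases "u > 0") (simp_all add: ennreal_mult)
  qed
  finally show ?thesis .
qed

lemma P_power:
  assumes s: "s > 0" and \<beta>: "0 < \<beta>" "\<beta> < 2"
  shows "ennreal (- Gamma_neg_half \<beta>) * P s (npow \<beta>) x =
    (\<integral>\<^sup>+ r. ennreal (indicator {0<..} r * r powr (- 1 - \<beta> / 2) * (1 - stable_gauss \<alpha> x s r)) \<partial>lborel)"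
proof -
  have "ennreal (- Gamma_neg_half \<beta>) * P s (npow \<beta>) x = P s (\<lambda>y. ennreal (- Gamma_neg_half \<beta>) * ennreal (norm y powr \<beta>)) x"
    by (rule P_cmult[symmetric]) measurable
  also have "\<dots> = P s (\<lambda>y. \<integral>\<^sup>+ r. ennreal (indicator {0<..} r * r powr (- 1 - \<beta> / 2)) * ennreal (1 - exp (- r * (norm y)\<^sup>2)) \<partial>lborel) x"
  proof (rule P_cong_nonzero)
    fix y :: 'a
    have "(\<integral>\<^sup>+ r. ennreal (indicator {0<..} r * r powr (- 1 - \<beta> / 2)) * ennreal (1 - exp (- r * (norm y)\<^sup>2)) \<partial>lborel) =
      (\<integral>\<^sup>+ r. ennreal (indicator {0<..} r * (r powr (- 1 - \<beta> / 2) * (1 - exp (- r * (norm y)\<^sup>2)))) \<partial>lborel)"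
      by (intro nn_integral_cong) (auto simp: indicator_def ennreal_mult)
    also have "\<dots> = ennreal (- Gamma_neg_half \<beta> * norm y powr \<beta>)"
      using \<beta> by (intro nn_integral_compensated_scaled) auto
    also have "\<dots> = ennreal (- Gamma_neg_half \<beta>) * ennreal (norm y powr \<beta>)"
      using Gamma_neg_half_neg[OF \<beta>] by (intro ennreal_mult) auto
    finally show "ennreal (- Gamma_neg_half \<beta>) * ennreal (norm y powr \<beta>) = (\<integral>\<^sup>+ r. ennreal (indicator {0<..} r * r powr (- 1 - \<beta> / 2)) * ennreal (1 - exp (- r * (norm y)\<^sup>2)) \<partial>lborel)" ..
  qed
  also have "\<dots> = (\<integral>\<^sup>+ r. P s (\<lambda>y. ennreal (indicator {0<..} r * r powr (- 1 - \<beta> / 2)) * ennreal (1 - exp (- r * (norm y)\<^sup>2))) x \<partial>lborel)"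
    by (rule P_nn_integral) measurable
  also have "\<dots> = (\<integral>\<^sup>+ r. ennreal (indicator {0<..} r * r powr (- 1 - \<beta> / 2) * (1 - stable_gauss \<alpha> x s r)) \<partial>lborel)"
  proof (rule nn_integral_cong)
    fix r :: real
    have "P s (\<lambda>y. ennreal (indicator {0<..} r * r powr (- 1 - \<beta> / 2)) * ennreal (1 - exp (- r * (norm y)\<^sup>2))) x =
      ennreal (indicator {0<..} r * r powr (- 1 - \<beta> / 2)) * P s (\<lambda>y. ennreal (1 - exp (- r * (norm y)\<^sup>2))) x"
      by (rule P_cmult) measurable
    then show "P s (\<lambda>y. ennreal (indicator {0<..} r * r powr (- 1 - \<beta> / 2)) * ennreal (1 - exp (- r * (norm y)\<^sup>2))) x =
       ennreal (indicator {0<..} r * r powr (- 1 - \<beta> / 2) * (1 - stable_gauss \<alpha> x s r))"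
      using P_gauss_compl[OF s, of r x] stable_gauss_le_1[OF s, of r x]
      by (cases "r > 0") (simp_all add: ennreal_mult)
  qed
  finally show ?thesis .
qed

text \<open>The compensated integrand is split at time 0: the part 1 - exp(-r |x|^2) integrates to
  the initial value |x|^\<beta>, and the change from exp(-r |x|^2) to the Gaussian average at time t
  gives the spectral term.\<close>

lemma P_power_spectral:
  fixes \<beta> t :: real
  assumes \<beta>: "0 < \<beta>" "\<beta> < \<alpha>" and t: "t > 0"
  shows "ennreal (- Gamma_neg_half \<beta>) * P t (npow \<beta>) x =
    ennreal (- Gamma_neg_half \<beta> * norm x powr \<beta> + mixture_const DIM('a) ((DIM('a) + \<beta>) / 2) * spectral_integral \<alpha> \<beta> t x)"
proof -
  have \<beta>2: "\<beta> < 2" using \<beta> \<alpha> by simp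
  define h1 where "h1 = (\<lambda>r::real. indicator {0<..} r * (r powr (- 1 - \<beta> / 2) * (1 - exp (- r * (norm x)\<^sup>2))))"
  define h2 where "h2 = (\<lambda>r::real. indicator {0<..} r * r powr (- 1 - \<beta> / 2) * (exp (- r * (norm x)\<^sup>2) - stable_gauss \<alpha> x t r))"
  have [measurable]: "h1 \<in> borel_measurable borel" unfolding h1_def by measurable
  have h1n: "0 \<le> h1 r" for r by (auto simp: h1_def indicator_def)
  have h1I: "(\<integral>\<^sup>+ r. ennreal (h1 r) \<partial>lborel) = ennreal (- Gamma_neg_half \<beta> * norm x powr \<beta>)"
    unfolding h1_def using \<beta> \<beta>2 by (intro nn_integral_compensated_scaled) auto
  have h1i: "integrable lborel h1"
    using h1I h1n by (intro integrableI_nonneg) auto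
  have h1L: "(LINT r|lborel. h1 r) = - Gamma_neg_half \<beta> * norm x powr \<beta>"
    using h1I h1n Gamma_neg_half_neg[OF \<beta>(1) \<beta>2] by (subst integral_eq_nn_integral) (auto simp: mult_nonpos_nonneg)
  have h2i: "integrable lborel h2" and h2L: "(LINT r|lborel. h2 r) = mixture_const DIM('a) ((DIM('a) + \<beta>) / 2) * spectral_integral \<alpha> \<beta> t x"
    unfolding h2_def using \<beta> \<alpha> t by (intro gauss_difference_integrable gauss_difference_integral; simp)+
  have eq: "indicator {0<..} r * r powr (- 1 - \<beta> / 2) * (1 - stable_gauss \<alpha> x t r) = h1 r + h2 r" for r
    by (simp add: h1_def h2_def algebra_simps)
  have nn: "0 \<le> h1 r + h2 r" for r
    unfolding eq[symmetric] using stable_gauss_le_1[OF t, of r x] by (auto simp: indicator_def)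
  show ?thesis
    unfolding P_power[OF t \<beta>(1) \<beta>2] eq
    by (subst nn_integral_eq_integral) (use h1i h2i nn h1L h2L in auto)
qed

text \<open>The sign of the spectral integral is invisible in its oscillating form; it comes from
  the other order of integration, where the integrand is nonnegative.\<close>

lemma P_riesz_spectral:
  fixes \<beta> t :: real
  assumes \<beta>: "0 < \<beta>" "\<beta> < \<alpha>" and t: "t > 0"
  shows "ennreal (Gamma ((\<alpha> - \<beta>) / 2)) * (\<integral>\<^sup>+ s. indicator {0..t} s * P s (npow (\<beta> - \<alpha>)) x \<partial>lborel) =
    ennreal (mixture_const DIM('a) ((DIM('a) + \<beta> - \<alpha>) / 2) * spectral_integral \<alpha> \<beta> t x)"
    and "0 \<le> spectral_integral \<alpha> \<beta> t x"
proof -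
  define w where "w = (\<lambda>\<tau>::real \<times> real. case \<tau> of (s, u) \<Rightarrow> indicator {0..t} s * (indicator {0<..} u * u powr ((\<alpha> - \<beta>) / 2 - 1)) * stable_gauss \<alpha> x s u)"
  have wi: "integrable lborel w" and wL: "(LINT \<tau>|lborel. w \<tau>) = mixture_const DIM('a) ((DIM('a) + \<beta> - \<alpha>) / 2) * spectral_integral \<alpha> \<beta> t x"
    unfolding w_def using \<beta> \<alpha> t by (intro gauss_potential_integrable gauss_potential_integral; simp)+
  have gn: "0 \<le> stable_gauss \<alpha> x s u" if "0 \<le> s" "0 < u" for s u
    using that stable_gauss_nonneg[of s u x] by (cases "s = 0") (auto simp: stable_gauss_zero_time)
  have w0: "0 \<le> w \<tau>" for \<tau>
    by (cases \<tau>) (auto simp: w_def indicator_def gn)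
  have "0 \<le> (LINT \<tau>|lborel. w \<tau>)" by (intro integral_nonneg_AE) (simp add: w0)
  then show "0 \<le> spectral_integral \<alpha> \<beta> t x"
    using mixture_const_pos[of "(DIM('a) + \<beta> - \<alpha>) / 2" "DIM('a)"] \<alpha> \<beta> unfolding wL
    by (simp add: zero_le_mult_iff)
  have wm: "w \<in> borel_measurable (lborel \<Otimes>\<^sub>M lborel)" using wi by (auto simp: lborel_prod)
  have "ennreal (Gamma ((\<alpha> - \<beta>) / 2)) * (\<integral>\<^sup>+ s. indicator {0..t} s * P s (npow (\<beta> - \<alpha>)) x \<partial>lborel) =
     (\<integral>\<^sup>+ s. ennreal (Gamma ((\<alpha> - \<beta>) / 2)) * (indicator {0..t} s * P s (npow (\<beta> - \<alpha>)) x) \<partial>lborel)"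
    by (rule nn_integral_cmult[symmetric]) measurable
  also have "\<dots> = (\<integral>\<^sup>+ s. \<integral>\<^sup>+ u. ennreal (w (s, u)) \<partial>lborel \<partial>lborel)"
  proof (rule nn_integral_cong_AE)
    have "AE s in lborel. s \<noteq> (0::real)" by (rule AE_lborel_singleton)
    then show "AE s in lborel. ennreal (Gamma ((\<alpha> - \<beta>) / 2)) * (indicator {0..t} s * P s (npow (\<beta> - \<alpha>)) x) = (\<integral>\<^sup>+ u. ennreal (w (s, u)) \<partial>lborel)"
    proof eventually_elim
      case (elim s)
      show ?case
      proof (cases "s \<in> {0..t}")
        case True
        then have s: "s > 0" using elim by auto
        have "ennreal (Gamma ((\<alpha> - \<beta>) / 2)) * P s (\<lambda>y. ennreal (norm y powr (- (\<alpha> - \<beta>)))) x = (\<integral>\<^sup>+ u. ennreal (w (s, u)) \<partial>lborel)"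
          using True \<beta> by (subst P_riesz[OF s]) (auto simp: w_def)
        then show ?thesis using True by simp
      qed (simp add: w_def)
    qed
  qed
  also have "\<dots> = (\<integral>\<^sup>+ \<tau>. ennreal (w \<tau>) \<partial>lborel)"
    unfolding lborel_prod[symmetric] by (rule lborel.nn_integral_fst) (use wm in measurable)
  also have "\<dots> = ennreal (LINT \<tau>|lborel. w \<tau>)"
    by (rule nn_integral_eq_integral[OF wi]) (simp add: w0)
  finally show "ennreal (Gamma ((\<alpha> - \<beta>) / 2)) * (\<integral>\<^sup>+ s. indicator {0..t} s * P s (npow (\<beta> - \<alpha>)) x \<partial>lborel) =
    ennreal (mixture_const DIM('a) ((DIM('a) + \<beta> - \<alpha>) / 2) * spectral_integral \<alpha> \<beta> t x)"
    unfolding wL .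
qed

lemma stable_moment:
  fixes \<beta> t :: real
  assumes \<beta>: "0 < \<beta>" "\<beta> < \<alpha>" and t: "t > 0"
  shows "P t (npow \<beta>) x = ennreal (norm x powr \<beta>) +
      ennreal (- kappa DIM('a) \<alpha> \<beta>) * (\<integral>\<^sup>+ s. indicator {0..t} s * P s (npow (\<beta> - \<alpha>)) x \<partial>lborel)"
    and "P t (npow \<beta>) x < \<infinity>"
    and "(\<integral>\<^sup>+ s. indicator {0..t} s * P s (npow (\<beta> - \<alpha>)) x \<partial>lborel) < \<infinity>"
proof -
  define G where "G = - Gamma_neg_half \<beta>"
  define g where "g = Gamma ((\<alpha> - \<beta>) / 2)"
  define c1 where "c1 = mixture_const DIM('a) ((DIM('a) + \<beta>) / 2)"
  define c2 where "c2 = mixture_const DIM('a) ((DIM('a) + \<beta> - \<alpha>) / 2)"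
  define J where "J = spectral_integral \<alpha> \<beta> t x"
  have pos: "G > 0" "g > 0" "c1 > 0" "c2 > 0"
    using Gamma_neg_half_neg[of \<beta>] \<beta> \<alpha> unfolding G_def g_def c1_def c2_def
    by (auto intro!: Gamma_real_pos mixture_const_pos)
  have J: "J \<ge> 0" unfolding J_def by (rule P_riesz_spectral(2)[OF assms])
  have 1: "P t (npow \<beta>) x = ennreal ((G * norm x powr \<beta> + c1 * J) / G)"
    using P_power_spectral[OF assms, of x] pos J unfolding G_def[symmetric] c1_def[symmetric] J_def[symmetric]
    by (intro ennreal_cmult_cancel) auto
  have 2: "(\<integral>\<^sup>+ s. indicator {0..t} s * P s (npow (\<beta> - \<alpha>)) x \<partial>lborel) = ennreal (c2 * J / g)"
    using P_riesz_spectral(1)[OF assms, of x] pos J unfolding g_def[symmetric] c2_def[symmetric] J_def[symmetric]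
    by (intro ennreal_cmult_cancel) auto
  have k: "- kappa DIM('a) \<alpha> \<beta> = c1 * g / (G * c2)"
    unfolding G_def g_def c1_def c2_def by (rule kappa_eq_mixture) (use \<beta> \<alpha> in auto)
  have "(G * norm x powr \<beta> + c1 * J) / G = norm x powr \<beta> + c1 * g / (G * c2) * (c2 * J / g)"
    using pos by (simp add: field_simps)
  then show "P t (npow \<beta>) x = ennreal (norm x powr \<beta>) +
      ennreal (- kappa DIM('a) \<alpha> \<beta>) * (\<integral>\<^sup>+ s. indicator {0..t} s * P s (npow (\<beta> - \<alpha>)) x \<partial>lborel)"
    unfolding 1 2 k using pos J by (simp only: ennreal_mult[symmetric] ennreal_plus[symmetric] divide_nonneg_nonneg mult_nonneg_nonneg less_imp_le powr_ge_zero)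
  show "P t (npow \<beta>) x < \<infinity>" unfolding 1 by simp
  show "(\<integral>\<^sup>+ s. indicator {0..t} s * P s (npow (\<beta> - \<alpha>)) x \<partial>lborel) < \<infinity>" unfolding 2 by simp
qed

end

section \<open>The critical exponent as the limit of \<beta> to 0\<close>

lemma nn_integral_Fatou_tendsto:
  fixes u :: "nat \<Rightarrow> 'a \<Rightarrow> ennreal"
  assumes "\<And>n. u n \<in> borel_measurable M" "\<And>x. x \<in> space M \<Longrightarrow> (\<lambda>n. u n x) \<longlonglongrightarrow> f x"
  shows "(\<integral>\<^sup>+ x. f x \<partial>M) \<le> liminf (\<lambda>n. \<integral>\<^sup>+ x. u n x \<partial>M)"
proof -
  have "(\<integral>\<^sup>+ x. f x \<partial>M) = (\<integral>\<^sup>+ x. liminf (\<lambda>n. u n x) \<partial>M)"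
    by (intro nn_integral_cong lim_imp_Liminf[symmetric] assms(2)) auto
  also have "\<dots> \<le> liminf (\<lambda>n. \<integral>\<^sup>+ x. u n x \<partial>M)"
    by (rule nn_integral_liminf) (rule assms)
  finally show ?thesis .
qed

text \<open>Convexity of exp between 0 and ln y. What counts is that the excess over 1 is linear in
  \<theta>, matching the rate at which \<kappa>_\<beta> vanishes.\<close>

lemma powr_le_one_plus:
  fixes y \<theta> :: real
  assumes "y \<ge> 0" "0 \<le> \<theta>" "\<theta> \<le> 1"
  shows "y powr \<theta> \<le> 1 + \<theta> * y"
proof (cases "y = 0")
  case False
  then have y: "y > 0" using assms by simp
  have "exp ((1 - \<theta>) *\<^sub>R 0 + \<theta> *\<^sub>R ln y) \<le> (1 - \<theta>) * exp 0 + \<theta> * exp (ln y)"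
    using assms by (intro convex_onD[OF exp_convex]) auto
  then have "exp (\<theta> * ln y) \<le> 1 - \<theta> + \<theta> * y" using y by simp
  then show ?thesis using y assms by (simp add: powr_def)
qed simp

text \<open>\<kappa>_\<beta> stripped of the factor 1 / \<Gamma>(-\<beta>/2). It stays positive at
  \<beta> = 0, so the decay of \<kappa>_\<beta> sits entirely in the removed factor.\<close>

definition kappa_numerator :: "nat \<Rightarrow> real \<Rightarrow> real \<Rightarrow> real" where
  "kappa_numerator d \<alpha> \<beta> = 2 powr \<alpha> * Gamma ((\<alpha> - \<beta>) / 2) * Gamma ((real d + \<beta>) / 2) / Gamma ((real d + \<beta> - \<alpha>) / 2)"

text \<open>For \<beta> \<le> 1 the estimate of -\<Gamma>(-\<beta>/2) is at most 4 / \<beta>, since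
  1 / (1 - \<beta>/2) \<le> 2 \<le> 2 / \<beta>.\<close>

lemma kappa_lower:
  assumes "0 < \<beta>" "\<beta> < \<alpha>" "\<beta> \<le> 1" "\<alpha> < 2" "\<alpha> < real d"
  shows "\<beta> * kappa_numerator d \<alpha> \<beta> \<le> 4 * - kappa d \<alpha> \<beta>"
proof -
  define G where "G = - Gamma_neg_half \<beta>"
  have G: "G > 0" using Gamma_neg_half_neg[of \<beta>] assms by (simp add: G_def)
  have "1 / (1 - \<beta> / 2) \<le> 2" using assms by (simp add: field_simps)
  also have "2 \<le> 2 / \<beta>" using assms by (simp add: field_simps)
  finally have "G \<le> 4 / \<beta>" using Gamma_neg_half_ge[of \<beta>] assms unfolding G_def by simp
  then have "\<beta> * G \<le> 4" using assms by (simp add: field_simps)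
  then have "\<beta> \<le> 4 / G" using G by (simp add: field_simps)
  moreover have "kappa_numerator d \<alpha> \<beta> \<ge> 0"
    using assms unfolding kappa_numerator_def by (intro divide_nonneg_nonneg mult_nonneg_nonneg Gamma_real_nonneg) auto
  ultimately have "\<beta> * kappa_numerator d \<alpha> \<beta> \<le> 4 / G * kappa_numerator d \<alpha> \<beta>"
    by (intro mult_right_mono)
  also have "4 / G * kappa_numerator d \<alpha> \<beta> = 4 * - kappa d \<alpha> \<beta>"
    unfolding kappa_def kappa_numerator_def G_def by simp
  finally show ?thesis .
qed

context stable_semigroup
begin

text \<open>The exponent -\<alpha> is the degenerate case \<beta> = 0 of the moment formula, so
  rates are compared: - \<kappa>_\<beta> times the time integral equals P t |y|^\<beta> -
  |x|^\<beta>, which is bounded by a multiple of \<beta>, and - \<kappa>_\<beta> is itself at least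
  of order \<beta>. The time integrals therefore stay bounded, and Fatou passes to the limit. The
  start away from 0 enters through ln |x|.\<close>

lemma riesz_potential_finite:
  assumes x: "x \<noteq> 0" and t: "t > 0"
  shows "(\<integral>\<^sup>+ s. indicator {0..t} s * P s (npow (- \<alpha>)) x \<partial>lborel) < \<infinity>"
proof -
  \<comment> \<open>A fixed exponent with a finite moment. The exponents \<open>b n\<close> are
    fractions \<open>\<theta> n\<close> of it, so |y|^(b n) is the power \<open>\<theta> n\<close>
    of |y|^\<open>\<beta>0\<close>, to which the convexity bound applies.\<close>
  define \<beta>0 where "\<beta>0 = \<alpha> / 2"
  define \<theta> where "\<theta> = (\<lambda>n::nat. 1 / (real n + 1))"
  define b where "b = (\<lambda>n. \<theta> n * \<beta>0)"
  have \<beta>0: "0 < \<beta>0" "\<beta>0 < \<alpha>" "\<beta>0 < 1" using \<alpha> by (auto simp: \<beta>0_def)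
  have \<theta>: "0 < \<theta> n" "\<theta> n \<le> 1" for n by (auto simp: \<theta>_def)
  have b: "0 < b n" "b n < \<alpha>" "b n \<le> 1" for n
  proof -
    have "b n \<le> \<beta>0" unfolding b_def using \<theta>[of n] \<beta>0 by (intro mult_left_le_one_le) auto
    then show "b n < \<alpha>" "b n \<le> 1" using \<beta>0 by auto
    show "0 < b n" using \<theta>[of n] \<beta>0 by (simp add: b_def)
  qed
  have "\<theta> \<longlonglongrightarrow> 0" unfolding \<theta>_def by real_asymp
  then have "(\<lambda>n. \<theta> n * \<beta>0) \<longlonglongrightarrow> 0 * \<beta>0" by (intro tendsto_intros)
  then have blim: "b \<longlonglongrightarrow> 0" unfolding b_def by simp
  define V where "V = enn2real (P t (npow \<beta>0) x)"
  have V: "P t (npow \<beta>0) x = ennreal V" "V \<ge> 0"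
    using stable_moment(2)[OF \<beta>0(1,2) t, of x] by (auto simp: V_def)
  define I where "I = (\<lambda>n. \<integral>\<^sup>+ s. indicator {0..t} s * P s (npow (b n - \<alpha>)) x \<partial>lborel)"
  define i where "i = (\<lambda>n. enn2real (I n))"
  have I: "I n = ennreal (i n)" "i n \<ge> 0" for n
    using stable_moment(3)[OF b(1,2) t, of n x] by (auto simp: I_def i_def)
  \<comment> \<open>The slope in b of the difference between the upper bound 1 + (b /
    \<open>\<beta>0\<close>) V for the moment and the lower bound 1 + b ln |x| for |x|^b.\<close>
  define B where "B = V / \<beta>0 - ln (norm x)"
  define Q where "Q = (\<lambda>n. kappa_numerator DIM('a) \<alpha> (b n))"
  have bound: "Q n * i n \<le> 4 * B" for n
  proof -
    define K where "K = - kappa DIM('a) \<alpha> (b n)"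
    have K: "K > 0" using kappa_neg[of "b n" \<alpha> "DIM('a)"] b \<alpha> by (simp add: K_def)
    have In: "(\<integral>\<^sup>+ s. indicator {0..t} s * P s (npow (b n - \<alpha>)) x \<partial>lborel) = ennreal (i n)"
      using I(1)[of n] by (simp only: I_def)
    have "ennreal (norm x powr b n + K * i n) = P t (npow (b n)) x"
      unfolding stable_moment(1)[OF b(1,2) t] In K_def[symmetric]
      using K I(2)[of n] by (subst ennreal_plus) (auto simp: ennreal_mult)
    also have "\<dots> \<le> P t (\<lambda>y. 1 + ennreal (\<theta> n) * ennreal (norm y powr \<beta>0)) x"
    proof (rule P_mono)
      fix y :: 'a
      have "norm y powr b n = (norm y powr \<beta>0) powr \<theta> n" by (simp add: b_def powr_powr mult.commute)
      also have "\<dots> \<le> 1 + \<theta> n * norm y powr \<beta>0" using \<theta>[of n] by (intro powr_le_one_plus) auto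
      finally have "ennreal (norm y powr b n) \<le> ennreal (1 + \<theta> n * norm y powr \<beta>0)" by (rule ennreal_leI)
      also have "\<dots> = 1 + ennreal (\<theta> n) * ennreal (norm y powr \<beta>0)"
        using \<theta>[of n] by (subst ennreal_plus) (auto simp: ennreal_mult)
      finally show "ennreal (norm y powr b n) \<le> 1 + ennreal (\<theta> n) * ennreal (norm y powr \<beta>0)" .
    qed
    also have "\<dots> = 1 + ennreal (\<theta> n) * ennreal V"
      by (subst P_add, simp, simp, subst P_const[OF t], subst P_cmult, simp) (simp only: V(1))
    also have "\<dots> = ennreal (1 + \<theta> n * V)"
      using \<theta>[of n] V(2) by (subst ennreal_plus) (auto simp: ennreal_mult)
    finally have "norm x powr b n + K * i n \<le> 1 + \<theta> n * V"
      using \<theta>[of n] V(2) by (subst (asm) ennreal_le_iff) auto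
    moreover have "1 + b n * ln (norm x) \<le> norm x powr b n"
      using x exp_ge_add_one_self[of "b n * ln (norm x)"] by (simp add: powr_def)
    moreover have "\<theta> n = b n / \<beta>0" using \<beta>0 by (simp add: b_def)
    ultimately have "K * i n \<le> b n * B" by (simp add: B_def algebra_simps)
    moreover have "b n * Q n \<le> 4 * K"
      unfolding Q_def K_def by (rule kappa_lower) (use b \<alpha> in auto)
    ultimately have "b n * (Q n * i n) \<le> b n * (4 * B)"
      using mult_right_mono[of "b n * Q n" "4 * K" "i n"] I(2)[of n] by (simp add: mult.assoc mult.left_commute)
    then show ?thesis using b(1)[of n] by simp
  qed
  define Q0 where "Q0 = kappa_numerator DIM('a) \<alpha> 0"
  have Q0: "Q0 > 0" unfolding Q0_def kappa_numerator_def
    using \<alpha> by (intro divide_pos_pos mult_pos_pos Gamma_real_pos) auto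
  have np: "z \<notin> \<int>\<^sub>\<le>\<^sub>0" if "z > 0" for z :: real
    using that by (auto elim!: nonpos_Ints_cases)
  have Gp: "Gamma ((real DIM('a) + 0 - \<alpha>) / 2) \<noteq> 0"
    using Gamma_real_pos[of "(real DIM('a) + 0 - \<alpha>) / 2"] \<alpha> by (simp add: less_imp_neq[symmetric])
  have "Q \<longlonglongrightarrow> Q0" unfolding Q_def Q0_def kappa_numerator_def
    by (intro tendsto_intros blim np Gp) (use \<alpha> in auto)
  \<comment> \<open>Continuity of Gamma keeps \<open>Q n\<close> above half of its positive limit,
    so it can be divided out of the bound uniformly in n.\<close>
  then have "eventually (\<lambda>n. Q n > Q0 / 2) sequentially"
    using Q0 by (intro order_tendstoD(1)) auto
  then have "eventually (\<lambda>n. I n \<le> ennreal (8 * B / Q0)) sequentially"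
  proof eventually_elim
    case (elim n)
    have "Q0 / 2 * i n \<le> Q n * i n" using elim I(2)[of n] by (intro mult_right_mono) auto
    then have "i n \<le> 8 * B / Q0" using bound[of n] Q0 by (simp add: field_simps)
    then show ?case unfolding I(1) by (rule ennreal_leI)
  qed
  then have "limsup I \<le> ennreal (8 * B / Q0)" by (rule Limsup_bounded)
  then have lim: "liminf I \<le> ennreal (8 * B / Q0)"
    using Liminf_le_Limsup[of sequentially I] by (metis order_trans sequentially_bot)
  \<comment> \<open>Fatou is applied twice: here in space at a fixed time, and below in
    time.\<close>
  have Ps: "P s (npow (- \<alpha>)) x \<le> liminf (\<lambda>n. P s (npow (b n - \<alpha>)) x)" for s
    unfolding P_def
  proof (rule nn_integral_Fatou_tendsto)
    fix z :: 'a
    have "(\<lambda>n. norm (x + z) powr (b n - \<alpha>)) \<longlonglongrightarrow> norm (x + z) powr (- \<alpha>)"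
    proof (cases "x + z = 0")
      case False
      then have "(\<lambda>n. norm (x + z) powr (b n - \<alpha>)) \<longlonglongrightarrow> norm (x + z) powr (0 - \<alpha>)"
        by (intro tendsto_intros blim) auto
      then show ?thesis by simp
    qed simp
    then have "(\<lambda>n. ennreal (p s z) * ennreal (norm (x + z) powr (b n - \<alpha>))) \<longlonglongrightarrow> ennreal (p s z) * ennreal (norm (x + z) powr (- \<alpha>))"
      by (intro ennreal_tendsto_cmult tendsto_ennrealI) auto
    then show "(\<lambda>n. ennreal (norm (x + z) powr (b n - \<alpha>)) * ennreal (p s z)) \<longlonglongrightarrow> ennreal (norm (x + z) powr (- \<alpha>)) * ennreal (p s z)"
      by (simp only: mult.commute)
  qed measurable
  have "(\<integral>\<^sup>+ s. indicator {0..t} s * P s (npow (- \<alpha>)) x \<partial>lborel) \<le>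
    (\<integral>\<^sup>+ s. liminf (\<lambda>n. indicator {0..t} s * P s (npow (b n - \<alpha>)) x) \<partial>lborel)"
  proof (rule nn_integral_mono)
    fix s
    show "indicator {0..t} s * P s (npow (- \<alpha>)) x \<le> liminf (\<lambda>n. indicator {0..t} s * P s (npow (b n - \<alpha>)) x)"
      using Ps[of s] by (cases "s \<in> {0..t}") simp_all
  qed
  also have "\<dots> \<le> liminf I" unfolding I_def by (rule nn_integral_liminf) measurable
  also have "\<dots> \<le> ennreal (8 * B / Q0)" by (rule lim)
  also have "\<dots> < \<infinity>" by simp
  finally show ?thesis .
qed

end

section \<open>The exponential of an integrated rate\<close>

lemma nn_integral_exp_atLeast:
  fixes a :: real
  shows "(\<integral>\<^sup>+ c. ennreal (exp (- c)) * indicator {a..} c \<partial>lborel) = ennreal (exp (- a))"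
proof -
  have lim: "((\<lambda>c::real. - exp (- c)) \<longlongrightarrow> 0) at_top"
    by real_asymp
  have "(\<integral>\<^sup>+ c. ennreal (exp (- c)) * indicator {a..} c \<partial>lborel) = ennreal (0 - (- exp (- a)))"
    by (rule nn_integral_FTC_atLeast[OF _ _ _ lim]) (auto intro!: derivative_eq_intros)
  then show ?thesis by simp
qed

text \<open>As f is only integrable, its primitive F need not be differentiable everywhere. Instead
  exp(-F s) is written as the integral of exp(-c) over c \<ge> F s; after Tonelli only the integral
  of f over the sublevel set of F at c is needed, and it equals min c (F t). In other words, F
  carries f ds to Lebesgue measure on [0, F t].\<close>

lemma one_minus_exp_neg_integral:
  fixes f :: "real \<Rightarrow> real" and t :: real
  assumes [measurable]: "f \<in> borel_measurable borel" and f0: "\<And>r. 0 \<le> f r" and t: "t \<ge> 0"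
  defines "Z \<equiv> \<lambda>s. \<integral>\<^sup>+ r. ennreal (f r) * indicator {0..s} r \<partial>lborel"
  assumes fin: "Z t < \<infinity>"
  shows "ennreal (1 - exp (- enn2real (Z t))) =
    (\<integral>\<^sup>+ s. indicator {0..t} s * (ennreal (f s) * ennreal (exp (- enn2real (Z s)))) \<partial>lborel)"
proof -
  define F where "F = (\<lambda>s. enn2real (Z s))"
  have Zmono: "Z s \<le> Z s'" if "s \<le> s'" for s s'
    unfolding Z_def using that by (intro nn_integral_mono mult_left_mono) (auto simp: indicator_def)
  have Zfin: "Z s < \<infinity>" if "s \<le> t" for s using Zmono[OF that] fin by (rule le_less_trans)
  have ZF: "Z s = ennreal (F s)" if "s \<le> t" for s using Zfin[OF that] by (simp add: F_def)
  have F0: "0 \<le> F s" for s by (simp add: F_def)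
  have Fmono: "F s \<le> F s'" if "s \<le> s'" "s' \<le> t" for s s'
    using Zmono[OF that(1)] Zfin[OF that(2)] by (simp add: F_def enn2real_mono)
  have [measurable]: "Z \<in> borel_measurable borel"
  proof -
    have "Z = (\<lambda>s. \<integral>\<^sup>+ r. ennreal (f r) * (if 0 \<le> r \<and> r \<le> s then 1 else 0) \<partial>lborel)"
      unfolding Z_def by (intro ext nn_integral_cong) (auto simp: indicator_def)
    also have "\<dots> \<in> borel_measurable borel" by measurable
    finally show ?thesis .
  qed
  have [measurable]: "F \<in> borel_measurable borel" unfolding F_def by measurable
  have si: "set_integrable lborel {0..s} f" if "s \<le> t" for s
  proof -
    have "(\<integral>\<^sup>+ r. ennreal (indicator {0..s} r *\<^sub>R f r) \<partial>lborel) = Z s"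
      unfolding Z_def by (intro nn_integral_cong) (auto simp: indicator_def)
    then show ?thesis unfolding set_integrable_def using Zfin[OF that] f0
      by (intro integrableI_nonneg) (auto simp: indicator_def)
  qed
  have FI: "F s = integral {0..s} f" if "s \<le> t" for s
  proof -
    have "F s = (LINT r:{0..s}|lborel. f r)"
      unfolding set_lebesgue_integral_def F_def Z_def using f0
      by (subst integral_eq_nn_integral) (auto simp: indicator_def intro!: arg_cong[where f = enn2real] nn_integral_cong)
    then show ?thesis using set_borel_integral_eq_integral(2)[OF si[OF that]] by simp
  qed
  have cont: "continuous_on {0..t} F"
    using indefinite_integral_continuous_1[OF set_borel_integral_eq_integral(1)[OF si[OF order_refl]]]
    by (rule continuous_on_eq) (auto simp: FI)
  have Fz: "F 0 = 0" unfolding FI[OF t] by simp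
  have key: "(\<integral>\<^sup>+ s. indicator {0..t} s * ennreal (f s) * indicator {F s..} c \<partial>lborel) =
     (\<integral>\<^sup>+ a. indicator {0..F t} a * indicator {a..} c \<partial>lborel)" if c: "0 \<le> c" for c
  proof -
    \<comment> \<open>A sublevel set of the continuous nondecreasing F is an interval starting at 0.
      Since F may be constant on a stretch, \<sigma> has to be the last point of that set, not just
      any solution of F \<sigma> = c.\<close>
    have "\<exists>\<sigma>\<in>{0..t}. {s\<in>{0..t}. F s \<le> c} = {0..\<sigma>} \<and> F \<sigma> = min c (F t)"
    proof (cases "F t \<le> c")
      case True
      then have "F s \<le> c" if "s \<in> {0..t}" for s using Fmono[of s t] that by auto
      then have "{s\<in>{0..t}. F s \<le> c} = {0..t}" by auto
      then show ?thesis using True t by (intro bexI[of _ t]) auto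
    next
      case False
      obtain s where s: "0 \<le> s" "s \<le> t" "F s = c"
        using IVT'[of F 0 c t] False t c Fz cont by auto
      have "closed ({0..t} \<inter> F -` {..c})" by (rule continuous_closed_preimage[OF cont]) auto
      then have "compact ({0..t} \<inter> F -` {..c})"
        by (intro compact_Int_closed[of "{0..t}" "{0..t} \<inter> F -` {..c}", simplified]) auto
      moreover have "{0..t} \<inter> F -` {..c} \<noteq> {}" using s by auto
      ultimately have "\<exists>\<sigma>\<in>{0..t} \<inter> F -` {..c}. \<forall>r\<in>{0..t} \<inter> F -` {..c}. r \<le> \<sigma>"
        by (rule compact_attains_sup)
      then obtain \<sigma> where \<sigma>: "\<sigma> \<in> {0..t} \<inter> F -` {..c}" "\<And>r. r \<in> {0..t} \<inter> F -` {..c} \<Longrightarrow> r \<le> \<sigma>"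
        by (elim bexE) (simp only: Ball_def)
      have "s \<le> \<sigma>" using s by (intro \<sigma>(2)) auto
      then have "F \<sigma> = c" using Fmono[of s \<sigma>] \<sigma>(1) s by auto
      moreover have "F r \<le> c" if "r \<in> {0..\<sigma>}" for r using \<sigma>(1) Fmono[of r \<sigma>] that by auto
      then have "{s\<in>{0..t}. F s \<le> c} = {0..\<sigma>}" using \<sigma> by auto
      ultimately show ?thesis using \<sigma>(1) False by (intro bexI[of _ \<sigma>]) auto
    qed
    then obtain \<sigma> where \<sigma>: "\<sigma> \<in> {0..t}" "{s\<in>{0..t}. F s \<le> c} = {0..\<sigma>}" "F \<sigma> = min c (F t)" by blast
    have "(\<integral>\<^sup>+ s. indicator {0..t} s * ennreal (f s) * indicator {F s..} c \<partial>lborel) = Z \<sigma>"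
      unfolding Z_def
    proof (rule nn_integral_cong)
      fix s
      have "s \<in> {0..\<sigma>} \<longleftrightarrow> s \<in> {0..t} \<and> F s \<le> c" using \<sigma>(2) by blast
      then show "indicator {0..t} s * ennreal (f s) * indicator {F s..} c = ennreal (f s) * indicator {0..\<sigma>} s"
        by (cases "s \<in> {0..t}"; cases "F s \<le> c"; simp add: indicator_def)
    qed
    also have "\<dots> = ennreal (min c (F t))" using \<sigma> ZF[of \<sigma>] by simp
    also have "\<dots> = emeasure lborel {0..min c (F t)}" using c F0[of t] by simp
    also have "\<dots> = (\<integral>\<^sup>+ a. indicator {0..min c (F t)} a \<partial>lborel)" by simp
    also have "\<dots> = (\<integral>\<^sup>+ a. indicator {0..F t} a * indicator {a..} c \<partial>lborel)"
      by (intro nn_integral_cong) (auto simp: indicator_def)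
    finally show ?thesis .
  qed
  let ?g = "\<lambda>s c. ennreal (exp (- c)) * indicator {0..} c * (indicator {0..t} s * ennreal (f s) * indicator {F s..} c)"
  let ?h = "\<lambda>c a. ennreal (exp (- c)) * indicator {0..} c * (indicator {0..F t} a * indicator {a..} c)"
  have "(\<integral>\<^sup>+ s. indicator {0..t} s * (ennreal (f s) * ennreal (exp (- enn2real (Z s)))) \<partial>lborel) =
     (\<integral>\<^sup>+ s. \<integral>\<^sup>+ c. ?g s c \<partial>lborel \<partial>lborel)"
  proof (rule nn_integral_cong)
    fix s
    have "indicator {0..t} s * (ennreal (f s) * ennreal (exp (- enn2real (Z s)))) = (indicator {0..t} s * ennreal (f s)) * (\<integral>\<^sup>+ c. ennreal (exp (- c)) * indicator {F s..} c \<partial>lborel)"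
      unfolding nn_integral_exp_atLeast F_def by (simp only: mult.assoc)
    also have "\<dots> = (\<integral>\<^sup>+ c. (indicator {0..t} s * ennreal (f s)) * (ennreal (exp (- c)) * indicator {F s..} c) \<partial>lborel)"
      by (rule nn_integral_cmult[symmetric]) measurable
    also have "\<dots> = (\<integral>\<^sup>+ c. ?g s c \<partial>lborel)"
    proof (rule nn_integral_cong)
      fix c
      have "indicator {0..} c * indicator {F s..} c = (indicator {F s..} c :: ennreal)"
        using F0[of s] by (auto simp: indicator_def)
      then show "(indicator {0..t} s * ennreal (f s)) * (ennreal (exp (- c)) * indicator {F s..} c) =
         ?g s c"
        by (metis mult.assoc mult.commute)
    qed
    finally show "indicator {0..t} s * (ennreal (f s) * ennreal (exp (- enn2real (Z s)))) = (\<integral>\<^sup>+ c. ?g s c \<partial>lborel)" .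
  qed
  also have "\<dots> = (\<integral>\<^sup>+ c. \<integral>\<^sup>+ s. ?g s c \<partial>lborel \<partial>lborel)"
  proof (rule lborel_pair.Fubini'[symmetric])
    \<comment> \<open>The set {F s..} moves with s; written as a conditional, its indicator is a
      comparison of two measurable functions, which gives joint measurability.\<close>
    have "(\<lambda>(s, c). ?g s c) =
       (\<lambda>(s, c). ennreal (exp (- c)) * indicator {0..} c * (indicator {0..t} s * ennreal (f s) * (if F s \<le> c then 1 else 0)))"
      by (auto simp: fun_eq_iff indicator_def)
    also have "\<dots> \<in> borel_measurable (lborel \<Otimes>\<^sub>M lborel)" by measurable
    finally show "(\<lambda>(s, c). ?g s c) \<in> borel_measurable (lborel \<Otimes>\<^sub>M lborel)" .
  qed
  also have "\<dots> = (\<integral>\<^sup>+ c. \<integral>\<^sup>+ a. ?h c a \<partial>lborel \<partial>lborel)"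
  proof (rule nn_integral_cong)
    fix c :: real
    have m1: "(\<lambda>s. indicator {0..t} s * ennreal (f s) * indicator {F s..} c) \<in> borel_measurable lborel"
    proof -
      have "(\<lambda>s. indicator {0..t} s * ennreal (f s) * indicator {F s..} c) = (\<lambda>s. indicator {0..t} s * ennreal (f s) * (if F s \<le> c then 1 else 0))"
        by (auto simp: fun_eq_iff indicator_def)
      also have "\<dots> \<in> borel_measurable lborel" by measurable
      finally show ?thesis .
    qed
    have m2: "(\<lambda>a. indicator {0..F t} a * indicator {a..} c :: ennreal) \<in> borel_measurable lborel"
    proof -
      have "(\<lambda>a. indicator {0..F t} a * indicator {a..} c :: ennreal) = (\<lambda>a. indicator {0..F t} a * (if a \<le> c then 1 else 0))"
        by (auto simp: fun_eq_iff indicator_def)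
      also have "\<dots> \<in> borel_measurable lborel" by measurable
      finally show ?thesis .
    qed
    show "(\<integral>\<^sup>+ s. ?g s c \<partial>lborel) =
      (\<integral>\<^sup>+ a. ?h c a \<partial>lborel)"
      unfolding nn_integral_cmult[OF m1] nn_integral_cmult[OF m2]
      by (cases "c \<ge> 0") (simp_all only: key, simp_all add: indicator_def)
  qed
  also have "\<dots> = (\<integral>\<^sup>+ a. \<integral>\<^sup>+ c. ?h c a \<partial>lborel \<partial>lborel)"
  proof (rule lborel_pair.Fubini'[symmetric])
    have "(\<lambda>(c, a). ?h c a) =
       (\<lambda>(c, a). ennreal (exp (- c)) * indicator {0..} c * (indicator {0..F t} a * (if a \<le> c then 1 else 0)))"
      by (auto simp: fun_eq_iff indicator_def)
    also have "\<dots> \<in> borel_measurable (lborel \<Otimes>\<^sub>M lborel)" by measurable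
    finally show "(\<lambda>(c, a). ?h c a) \<in> borel_measurable (lborel \<Otimes>\<^sub>M lborel)" .
  qed
  also have "\<dots> = (\<integral>\<^sup>+ a. ennreal (indicator {0..F t} a * exp (- a * 1)) \<partial>lborel)"
  proof (rule nn_integral_cong)
    fix a
    have "(\<integral>\<^sup>+ c. ?h c a \<partial>lborel) =
      (\<integral>\<^sup>+ c. indicator {0..F t} a * (ennreal (exp (- c)) * indicator {a..} c) \<partial>lborel)"
      by (rule nn_integral_cong) (auto simp: indicator_def)
    also have "\<dots> = indicator {0..F t} a * ennreal (exp (- a))"
      by (subst nn_integral_cmult, measurable, subst nn_integral_exp_atLeast, rule refl)
    also have "\<dots> = ennreal (indicator {0..F t} a * exp (- a * 1))" by (auto simp: indicator_def)
    finally show "(\<integral>\<^sup>+ c. ?h c a \<partial>lborel) = ennreal (indicator {0..F t} a * exp (- a * 1))" .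
  qed
  also have "\<dots> = ennreal ((1 - exp (- F t * 1)) / 1)"
    by (rule nn_integral_exp_interval) (auto simp: F0)
  finally show ?thesis by (simp add: F_def)
qed

section \<open>The Markov property for the past of a stable process\<close>

locale stable_path = stable_semigroup \<alpha> p + prob_space M
  for \<alpha> :: real and p :: "real \<Rightarrow> 'a::euclidean_space \<Rightarrow> real" and M :: "'b measure" +
  fixes X :: "real \<Rightarrow> 'b \<Rightarrow> 'a" and x0 :: 'a
  assumes X_process: "stable_process \<alpha> M X x0"
begin

lemma X_joint: "(\<lambda>(s, \<omega>). X s \<omega>) \<in> borel_measurable (lborel \<Otimes>\<^sub>M M)"
  using X_process by (simp add: stable_process_def)

lemma X_measurable [measurable (raw)]:
  assumes [measurable]: "f \<in> borel_measurable N" "g \<in> measurable N M"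
  shows "(\<lambda>w. X (f w) (g w)) \<in> borel_measurable N"
proof -
  have "(\<lambda>w. (f w, g w)) \<in> measurable N (lborel \<Otimes>\<^sub>M M)" by measurable
  from measurable_comp[OF this X_joint] show ?thesis by (simp add: comp_def)
qed

lemma X_0: "AE \<omega> in M. X 0 \<omega> = x0"
  using X_process by (simp add: stable_process_def)

lemma X_increment: "0 \<le> s \<Longrightarrow> s < t \<Longrightarrow> distributed M lborel (\<lambda>\<omega>. X t \<omega> - X s \<omega>) (\<lambda>z. ennreal (p (t - s) z))"
  using X_process by (simp add: stable_process_def p_eq)

lemma X_indep: "sorted_wrt (<) ts \<Longrightarrow> ts \<noteq> [] \<Longrightarrow> hd ts \<ge> 0 \<Longrightarrow>
  indep_vars (\<lambda>_. borel) (\<lambda>i \<omega>. X (ts ! Suc i) \<omega> - X (ts ! i) \<omega>) {..<length ts - 1}"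
  using X_process by (simp add: stable_process_def)

lemma P_increment:
  assumes "0 \<le> s" "s < t" and [measurable]: "f \<in> borel_measurable borel"
  shows "(\<integral>\<^sup>+ \<omega>. f (y + (X t \<omega> - X s \<omega>)) \<partial>M) = P (t - s) f y"
  using distributed_nn_integral[OF X_increment[OF assms(1,2)], of "\<lambda>z. f (y + z)"]
  by (simp add: P_def mult.commute)

lemma expectation_X:
  assumes t: "t > 0" and f[measurable]: "f \<in> borel_measurable borel"
  shows "(\<integral>\<^sup>+ \<omega>. f (X t \<omega>) \<partial>M) = P t f x0"
proof -
  have "(\<integral>\<^sup>+ \<omega>. f (X t \<omega>) \<partial>M) = (\<integral>\<^sup>+ \<omega>. f (x0 + (X t \<omega> - X 0 \<omega>)) \<partial>M)"
    by (rule nn_integral_cong_AE) (use X_0 in eventually_elim, simp)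
  then show ?thesis using P_increment[of 0 t f x0] t by simp
qed

definition cylinders :: "real \<Rightarrow> 'b set set" where
  "cylinders s = {A. \<exists>J B. finite J \<and> J \<subseteq> {0..s} \<and> (\<forall>r. B r \<in> sets borel) \<and> A = {\<omega>\<in>space M. \<forall>r\<in>J. X r \<omega> \<in> B r}}"

text \<open>The natural \<sigma>-algebra of the process at time s, without null sets added; random
  variables built from whole path segments therefore belong to it only up to almost sure
  equality.\<close>

definition past :: "real \<Rightarrow> 'b measure" where
  "past s = sigma (space M) (cylinders s)"

lemma cylinders_sets: "cylinders s \<subseteq> sets M"
proof
  fix A assume "A \<in> cylinders s"
  then obtain J B where J: "finite J" and B[measurable]: "\<And>r. B r \<in> sets borel" and A: "A = {\<omega>\<in>space M. \<forall>r\<in>J. X r \<omega> \<in> B r}"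
    unfolding cylinders_def by blast
  show "A \<in> sets M" unfolding A using J by measurable
qed

lemma space_past [simp]: "space (past s) = space M"
  using cylinders_sets[of s] sets.sets_into_space by (subst past_def, subst space_measure_of) auto

lemma sets_past: "sets (past s) = sigma_sets (space M) (cylinders s)"
  using cylinders_sets[of s] sets.sets_into_space by (subst past_def, subst sets_measure_of) auto

lemma subalgebra_past: "subalgebra M (past s)"
  unfolding subalgebra_def sets_past using cylinders_sets[of s]
  by (auto simp: sets.sigma_sets_subset)

lemma Int_stable_cylinders: "Int_stable (cylinders s)"
proof (rule Int_stableI)
  fix A A' assume "A \<in> cylinders s" "A' \<in> cylinders s"
  then obtain J B J' B' where J: "finite J" "J \<subseteq> {0..s}" "\<And>r. B r \<in> sets borel" "A = {\<omega>\<in>space M. \<forall>r\<in>J. X r \<omega> \<in> B r}"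
    and J': "finite J'" "J' \<subseteq> {0..s}" "\<And>r. B' r \<in> sets borel" "A' = {\<omega>\<in>space M. \<forall>r\<in>J'. X r \<omega> \<in> B' r}"
    unfolding cylinders_def by blast
  define C where "C = (\<lambda>r. (if r \<in> J then B r else UNIV) \<inter> (if r \<in> J' then B' r else UNIV))"
  have "A \<inter> A' = {\<omega>\<in>space M. \<forall>r\<in>J \<union> J'. X r \<omega> \<in> C r}" by (auto simp: J(4) J'(4) C_def)
  moreover have "C r \<in> sets borel" for r using J(3) J'(3) by (auto simp: C_def)
  ultimately show "A \<inter> A' \<in> cylinders s"
    unfolding cylinders_def using J J' by (intro CollectI exI[of _ "J \<union> J'"] exI[of _ C]) auto
qed

lemma X_past_measurable:
  assumes "0 \<le> r" "r \<le> s"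
  shows "X r \<in> borel_measurable (past s)"
proof (rule measurableI)
  fix B :: "'a set" assume "B \<in> sets borel"
  then have "X r -` B \<inter> space M \<in> cylinders s"
    unfolding cylinders_def using assms by (intro CollectI exI[of _ "{r}"] exI[of _ "\<lambda>_. B"]) auto
  then show "X r -` B \<inter> space (past s) \<in> sets (past s)"
    unfolding sets_past space_past by (rule sigma_sets.Basic)
qed simp

text \<open>Independence is available for increments along a finite list of times. The list consists
  of the times of the cylinder together with 0, s and t, so that X t - X s is the last increment and
  every earlier position is the start plus a sum of the other increments.\<close>

lemma cylinder_indep:
  assumes s: "0 < s" "s < t" and A: "A \<in> cylinders s" and C[measurable]: "C \<in> sets borel"
  shows "prob (A \<inter> ((\<lambda>\<omega>. X t \<omega> - X s \<omega>) -` C \<inter> space M)) = prob A * prob ((\<lambda>\<omega>. X t \<omega> - X s \<omega>) -` C \<inter> space M)"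
proof -
  obtain J B where J: "finite J" "J \<subseteq> {0..s}" and B[measurable]: "\<And>r. B r \<in> sets borel" and A: "A = {\<omega>\<in>space M. \<forall>r\<in>J. X r \<omega> \<in> B r}"
    using A unfolding cylinders_def by blast
  \<comment> \<open>0 is added so that the sums begin at X 0, which is almost surely
    \<open>x0\<close>; s is added so that the increment ending at t begins at s.\<close>
  define K where "K = J \<union> {0, s}"
  have K: "finite K" "K \<noteq> {}" "K \<subseteq> {0..s}" "0 \<in> K" "s \<in> K" using J s by (auto simp: K_def)
  define L where "L = sorted_list_of_set K"
  have L: "set L = K" "sorted L" "distinct L" using K by (auto simp: L_def)
  have Ls: "sorted_wrt (<) L" using L by (simp add: strict_sorted_iff)
  define n where "n = length L"
  have Lne: "L \<noteq> []" using L K by auto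
  then have n0: "n > 0" by (simp add: n_def)
  have L0: "L ! 0 = 0"
  proof -
    obtain j where j: "j < length L" "L ! j = 0" using L(1) K(4) by (auto simp: in_set_conv_nth)
    then have "L ! 0 \<le> 0" using sorted_nth_mono[OF L(2), of 0 j] by simp
    moreover have "L ! 0 \<in> {0..s}" using L(1) K(3) nth_mem[of 0 L] n0 unfolding n_def by blast
    ultimately show ?thesis by simp
  qed
  have Ln: "L ! (n - 1) = s"
  proof -
    obtain j where j: "j < length L" "L ! j = s" using L(1) K(5) by (auto simp: in_set_conv_nth)
    then have "s \<le> L ! (n - 1)" using sorted_nth_mono[OF L(2), of j "n - 1"] n0 by (simp add: n_def)
    moreover have "L ! (n - 1) \<in> set L" using n0 by (simp add: n_def)
    then have "L ! (n - 1) \<in> {0..s}" using L(1) K(3) by blast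
    ultimately show ?thesis by simp
  qed
  define ts where "ts = L @ [t]"
  have ts: "sorted_wrt (<) ts" "ts \<noteq> []" "length ts - 1 = n"
    using Ls L K s by (auto simp: ts_def sorted_wrt_append n_def)
  have ts_nth: "ts ! k = L ! k" if "k < n" for k using that by (simp add: ts_def nth_append n_def)
  have tsn: "ts ! n = t" by (simp add: ts_def n_def)
  have "hd ts = 0" using Lne L0 by (simp add: ts_def hd_append hd_conv_nth)
  \<comment> \<open>The n + 1 times in \<open>ts\<close> give n increments. Number n - 1 is the one
    from s to t; those with smaller index belong to the past.\<close>
  define D where "D = (\<lambda>i \<omega>. X (ts ! Suc i) \<omega> - X (ts ! i) \<omega>)"
  have D: "indep_vars (\<lambda>_. borel) D {..<n}"
    using X_indep[OF ts(1,2)] \<open>hd ts = 0\<close> ts(3) by (simp add: D_def)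
  have Dlast: "D (n - 1) \<omega> = X t \<omega> - X s \<omega>" for \<omega>
    using n0 tsn ts_nth[of "n - 1"] Ln by (simp add: D_def)
  have tele: "X (L ! k) \<omega> = X 0 \<omega> + (\<Sum>i<k. D i \<omega>)" if "k < n" for k \<omega>
    using sum_lessThan_telescope[of "\<lambda>i. X (ts ! i) \<omega>" k] ts_nth[OF that] ts_nth[OF n0] L0
    by (simp add: D_def)
  define A1 where "A1 = {..<n - 1}"
  \<comment> \<open>The event rewritten in increment space with \<open>x0\<close> in place of X 0.
    The two events agree only almost surely, which is enough for probabilities.\<close>
  define S where "S = {d \<in> space (Pi\<^sub>M A1 (\<lambda>_. borel :: 'a measure)). \<forall>k\<in>{k. k < n \<and> L ! k \<in> J}. x0 + (\<Sum>i<k. d i) \<in> B (L ! k)}"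
  have S: "S \<in> sets (Pi\<^sub>M A1 (\<lambda>_. borel))"
  proof -
    have m: "(\<lambda>d. x0 + (\<Sum>i<k. d i)) \<in> borel_measurable (Pi\<^sub>M A1 (\<lambda>_. borel :: 'a measure))" if "k < n" for k
      using that by (intro borel_measurable_add borel_measurable_const borel_measurable_sum measurable_component_singleton) (auto simp: A1_def)
    have "{d \<in> space (Pi\<^sub>M A1 (\<lambda>_. borel :: 'a measure)). x0 + (\<Sum>i<k. d i) \<in> B (L ! k)} \<in> sets (Pi\<^sub>M A1 (\<lambda>_. borel))" if "k < n" for k
      using measurable_sets[OF m[OF that] B[of "L ! k"]] by (simp add: vimage_def Int_def conj_commute)
    then show ?thesis unfolding S_def by (intro sets.sets_Collect_finite_All) auto
  qed
  define T where "T = {d \<in> space (Pi\<^sub>M {n - 1} (\<lambda>_. borel :: 'a measure)). d (n - 1) \<in> C}"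
  have T: "T \<in> sets (Pi\<^sub>M {n - 1} (\<lambda>_. borel))"
  proof -
    have "(\<lambda>d. d (n - 1)) \<in> borel_measurable (Pi\<^sub>M {n - 1} (\<lambda>_. borel :: 'a measure))"
      by (rule measurable_component_singleton) simp
    from measurable_sets[OF this C] show ?thesis by (simp add: T_def vimage_def Int_def conj_commute)
  qed
  have iv: "indep_var (PiM A1 (\<lambda>_. borel)) (\<lambda>\<omega>. restrict (\<lambda>i. D i \<omega>) A1) (PiM {n - 1} (\<lambda>_. borel)) (\<lambda>\<omega>. restrict (\<lambda>i. D i \<omega>) {n - 1})"
    by (rule indep_var_restrict[OF D]) (use n0 in \<open>auto simp: A1_def\<close>)
  let ?U = "\<lambda>\<omega>. restrict (\<lambda>i. D i \<omega>) A1" and ?V = "\<lambda>\<omega>. restrict (\<lambda>i. D i \<omega>) {n - 1}"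
  have V: "?V -` T \<inter> space M = (\<lambda>\<omega>. X t \<omega> - X s \<omega>) -` C \<inter> space M"
    using Dlast by (auto simp: T_def space_PiM)
  have U: "?U -` S \<inter> space M = {\<omega>\<in>space M. \<forall>k\<in>{k. k < n \<and> L ! k \<in> J}. x0 + (\<Sum>i<k. D i \<omega>) \<in> B (L ! k)}"
  proof -
    have "(\<Sum>i<k. restrict (\<lambda>i. D i \<omega>) A1 i) = (\<Sum>i<k. D i \<omega>)" if "k < n" for k \<omega>
      using that by (intro sum.cong) (auto simp: A1_def)
    then show ?thesis by (auto simp: S_def space_PiM)
  qed
  have ind: "prob (?U -` S \<inter> space M \<inter> (?V -` T \<inter> space M)) = prob (?U -` S \<inter> space M) * prob (?V -` T \<inter> space M)"
  proof -
    have "(\<lambda>\<omega>. (?U \<omega>, ?V \<omega>)) -` (S \<times> T) \<inter> space M = ?U -` S \<inter> space M \<inter> (?V -` T \<inter> space M)" by auto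
    then show ?thesis using indep_varD[OF iv S T] by simp
  qed
  have ev: "?U -` S \<inter> space M \<in> events" "?V -` T \<inter> space M \<in> events"
    using measurable_sets[OF indep_var_rv1[OF iv] S] measurable_sets[OF indep_var_rv2[OF iv] T] by auto
  have Aev: "A \<in> events" using assms(3) cylinders_sets[of s] by auto
  have AEA: "AE \<omega> in M. \<omega> \<in> A \<longleftrightarrow> \<omega> \<in> ?U -` S \<inter> space M"
    using X_0
  proof eventually_elim
    case (elim \<omega>)
    have "(\<forall>r\<in>J. X r \<omega> \<in> B r) \<longleftrightarrow> (\<forall>k\<in>{k. k < n \<and> L ! k \<in> J}. X (L ! k) \<omega> \<in> B (L ! k))"
    proof safe
      fix r assume "\<forall>k\<in>{k. k < n \<and> L ! k \<in> J}. X (L ! k) \<omega> \<in> B (L ! k)" "r \<in> J"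
      moreover have "r \<in> set L" using \<open>r \<in> J\<close> L by (simp add: K_def)
      ultimately show "X r \<omega> \<in> B r" by (auto simp: in_set_conv_nth n_def)
    qed auto
    also have "\<dots> \<longleftrightarrow> (\<forall>k\<in>{k. k < n \<and> L ! k \<in> J}. x0 + (\<Sum>i<k. D i \<omega>) \<in> B (L ! k))"
      using elim by (intro ball_cong) (auto simp: tele)
    finally show ?case unfolding U A by auto
  qed
  have 1: "prob A = prob (?U -` S \<inter> space M)"
    by (rule finite_measure_eq_AE[OF AEA Aev ev(1)])
  have 2: "prob (A \<inter> (?V -` T \<inter> space M)) = prob (?U -` S \<inter> space M \<inter> (?V -` T \<inter> space M))"
    by (rule finite_measure_eq_AE) (use AEA Aev ev in \<open>auto elim: eventually_mono\<close>)
  show ?thesis using ind 1 2 unfolding V by simp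
qed

lemma past_indep:
  assumes "0 < s" "s < t"
  shows "indep_set (sets (past s)) (sigma_sets (space M) {(\<lambda>\<omega>. X t \<omega> - X s \<omega>) -` C \<inter> space M | C. C \<in> sets borel})"
  unfolding sets_past
proof (rule indep_set_sigma_sets[OF _ Int_stable_cylinders])
  let ?S = "{(\<lambda>\<omega>. X t \<omega> - X s \<omega>) -` C \<inter> space M | C. C \<in> sets borel}"
  have m: "(\<lambda>\<omega>. X t \<omega> - X s \<omega>) \<in> borel_measurable M" by measurable
  show "indep_set (cylinders s) ?S"
    by (rule indep_setI[OF cylinders_sets]) (use m cylinder_indep[OF assms] in \<open>auto intro: measurable_sets\<close>)
  show "Int_stable ?S"
  proof (rule Int_stableI)
    fix a b assume "a \<in> ?S" "b \<in> ?S"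
    then obtain C1 C2 where "C1 \<in> sets borel" "C2 \<in> sets borel" "a = (\<lambda>\<omega>. X t \<omega> - X s \<omega>) -` C1 \<inter> space M" "b = (\<lambda>\<omega>. X t \<omega> - X s \<omega>) -` C2 \<inter> space M"
      by blast
    then have "C1 \<inter> C2 \<in> sets borel" "a \<inter> b = (\<lambda>\<omega>. X t \<omega> - X s \<omega>) -` (C1 \<inter> C2) \<inter> space M" by auto
    then show "a \<inter> b \<in> ?S" by blast
  qed
qed

text \<open>X t is X s plus an increment independent of the past, so the pair (H, X s) and the
  increment have a product law, and the increment can be integrated out first. The moments involve
  one future time only, so no law of the whole future path is required.\<close>

lemma markov_past:
  assumes s: "0 < s" "s < t" and H: "H \<in> borel_measurable (past s)" and f[measurable]: "f \<in> borel_measurable borel"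
  shows "(\<integral>\<^sup>+ \<omega>. H \<omega> * f (X t \<omega>) \<partial>M) = (\<integral>\<^sup>+ \<omega>. H \<omega> * P (t - s) f (X s \<omega>) \<partial>M)"
proof -
  define U where "U = (\<lambda>\<omega>. (H \<omega> :: ennreal, X s \<omega>))"
  define Y where "Y = (\<lambda>\<omega>. X t \<omega> - X s \<omega>)"
  have Up: "U \<in> measurable (past s) (borel \<Otimes>\<^sub>M borel)"
    unfolding U_def using H X_past_measurable[of s s] s by (intro measurable_Pair) auto
  have Um[measurable]: "U \<in> measurable M (borel \<Otimes>\<^sub>M borel)"
    by (rule measurable_from_subalg[OF subalgebra_past Up])
  have Ym[measurable]: "Y \<in> borel_measurable M" unfolding Y_def by measurable
  \<comment> \<open>The component 0 only gives V the same value type as U, which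
    \<open>indep_var\<close> demands of its two variables.\<close>
  define V where "V = (\<lambda>\<omega>. (0::ennreal, Y \<omega>))"
  have Vm[measurable]: "V \<in> measurable M (borel \<Otimes>\<^sub>M borel)" unfolding V_def by measurable
  have "indep_set (sigma_sets (space M) {U -` A \<inter> space M | A. A \<in> sets (borel \<Otimes>\<^sub>M borel)})
     (sigma_sets (space M) {V -` A \<inter> space M | A. A \<in> sets (borel \<Otimes>\<^sub>M borel)})"
  proof -
    have "{U -` A \<inter> space M | A. A \<in> sets (borel \<Otimes>\<^sub>M borel)} \<subseteq> sets (past s)"
      using measurable_sets[OF Up] by auto
    then have 1: "sigma_sets (space M) {U -` A \<inter> space M | A. A \<in> sets (borel \<Otimes>\<^sub>M borel)} \<subseteq> sets (past s)"
      using sets.sigma_sets_subset[of _ "past s"] by simp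
    have "{V -` A \<inter> space M | A. A \<in> sets (borel \<Otimes>\<^sub>M borel)} \<subseteq> {Y -` C \<inter> space M | C. C \<in> sets borel}"
    proof safe
      fix A :: "(ennreal \<times> 'a) set" assume A: "A \<in> sets (borel \<Otimes>\<^sub>M borel)"
      have "(\<lambda>y. (0::ennreal, y)) \<in> measurable borel (borel \<Otimes>\<^sub>M borel :: (ennreal \<times> 'a) measure)" by measurable
      from measurable_sets[OF this A] have "(\<lambda>y. (0, y)) -` A \<in> sets borel" by simp
      moreover have "V -` A \<inter> space M = Y -` ((\<lambda>y. (0, y)) -` A) \<inter> space M" by (auto simp: V_def)
      ultimately show "\<exists>C. V -` A \<inter> space M = Y -` C \<inter> space M \<and> C \<in> sets borel" by blast
    qed
    then have 2: "sigma_sets (space M) {V -` A \<inter> space M | A. A \<in> sets (borel \<Otimes>\<^sub>M borel)} \<subseteq> sigma_sets (space M) {Y -` C \<inter> space M | C. C \<in> sets borel}"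
      by (rule sigma_sets_mono')
    show ?thesis
      using past_indep[OF s] unfolding Y_def[symmetric] indep_set_def
      by (rule indep_sets_mono_sets) (use 1 2 in \<open>auto split: bool.split\<close>)
  qed
  then have iv: "indep_var (borel \<Otimes>\<^sub>M borel) U (borel \<Otimes>\<^sub>M borel) V"
    unfolding indep_var_eq using Um Vm by simp
  define \<Phi> where "\<Phi> = (\<lambda>v::(ennreal \<times> 'a) \<times> (ennreal \<times> 'a). fst (fst v) * f (snd (fst v) + snd (snd v)))"
  have [measurable]: "\<Phi> \<in> borel_measurable ((borel \<Otimes>\<^sub>M borel) \<Otimes>\<^sub>M (borel \<Otimes>\<^sub>M borel))" unfolding \<Phi>_def by measurable
  interpret Vsp: prob_space "distr M (borel \<Otimes>\<^sub>M borel) V" by (rule prob_space_distr) measurable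
  have "(\<integral>\<^sup>+ \<omega>. H \<omega> * f (X t \<omega>) \<partial>M) = (\<integral>\<^sup>+ \<omega>. \<Phi> (U \<omega>, V \<omega>) \<partial>M)"
    by (simp add: \<Phi>_def U_def Y_def V_def)
  also have "\<dots> = (\<integral>\<^sup>+ v. \<Phi> v \<partial>distr M ((borel \<Otimes>\<^sub>M borel) \<Otimes>\<^sub>M (borel \<Otimes>\<^sub>M borel)) (\<lambda>\<omega>. (U \<omega>, V \<omega>)))"
    by (rule nn_integral_distr[symmetric]) measurable
  also have "distr M ((borel \<Otimes>\<^sub>M borel) \<Otimes>\<^sub>M (borel \<Otimes>\<^sub>M borel)) (\<lambda>\<omega>. (U \<omega>, V \<omega>)) = distr M (borel \<Otimes>\<^sub>M borel) U \<Otimes>\<^sub>M distr M (borel \<Otimes>\<^sub>M borel) V"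
    using iv unfolding indep_var_distribution_eq by simp
  also have "(\<integral>\<^sup>+ v. \<Phi> v \<partial>(distr M (borel \<Otimes>\<^sub>M borel) U \<Otimes>\<^sub>M distr M (borel \<Otimes>\<^sub>M borel) V)) = (\<integral>\<^sup>+ c. \<integral>\<^sup>+ y. \<Phi> (c, y) \<partial>distr M (borel \<Otimes>\<^sub>M borel) V \<partial>distr M (borel \<Otimes>\<^sub>M borel) U)"
    by (rule Vsp.nn_integral_fst[symmetric]) measurable
  also have "\<dots> = (\<integral>\<^sup>+ \<omega>. \<integral>\<^sup>+ y. \<Phi> (U \<omega>, y) \<partial>distr M (borel \<Otimes>\<^sub>M borel) V \<partial>M)"
    by (rule nn_integral_distr) measurable
  also have "\<dots> = (\<integral>\<^sup>+ \<omega>. H \<omega> * P (t - s) f (X s \<omega>) \<partial>M)"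
  proof (rule nn_integral_cong)
    fix \<omega>
    have "(\<integral>\<^sup>+ y. \<Phi> (U \<omega>, y) \<partial>distr M (borel \<Otimes>\<^sub>M borel) V) = (\<integral>\<^sup>+ y. H \<omega> * f (X s \<omega> + snd y) \<partial>distr M (borel \<Otimes>\<^sub>M borel) V)"
      by (simp add: \<Phi>_def U_def)
    also have "\<dots> = (\<integral>\<^sup>+ \<omega>'. H \<omega> * f (X s \<omega> + snd (V \<omega>')) \<partial>M)"
      by (rule nn_integral_distr) measurable
    also have "\<dots> = (\<integral>\<^sup>+ \<omega>'. H \<omega> * f (X s \<omega> + Y \<omega>') \<partial>M)"
      by (simp add: V_def)
    also have "\<dots> = H \<omega> * (\<integral>\<^sup>+ \<omega>'. f (X s \<omega> + Y \<omega>') \<partial>M)"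
      by (rule nn_integral_cmult) measurable
    also have "(\<integral>\<^sup>+ \<omega>'. f (X s \<omega> + Y \<omega>') \<partial>M) = P (t - s) f (X s \<omega>)"
      unfolding Y_def using s by (intro P_increment) auto
    finally show "(\<integral>\<^sup>+ y. \<Phi> (U \<omega>, y) \<partial>distr M (borel \<Otimes>\<^sub>M borel) V) = H \<omega> * P (t - s) f (X s \<omega>)" .
  qed
  finally show ?thesis .
qed

end

section \<open>Feynman-Kac weights\<close>

context stable_path
begin

text \<open>Without path regularity a time integral of the process up to \<open>s\<close> need not be measurable for
  the past of \<open>s\<close>; it only agrees almost surely with its conditional expectation.\<close>

lemma time_integral_past:
  fixes v :: "'a \<Rightarrow> real"
  assumes s: "s > 0" and [measurable]: "v \<in> borel_measurable borel" and v: "\<And>y. 0 \<le> v y" "\<And>y. v y \<le> c"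
  shows "\<exists>Z'\<in>borel_measurable (past s). AE \<omega> in M. (LINT r|lborel. indicator {0..s} r * v (X r \<omega>)) = Z' \<omega>"
proof -
  interpret G: finite_measure_subalgebra M "past s" by standard (rule subalgebra_past)
  interpret pair_sigma_finite lborel M ..
  define w where "w = (\<lambda>r \<omega>. indicator {0..s} r * v (X r \<omega>))"
  have wm[measurable]: "(\<lambda>(r, \<omega>). w r \<omega>) \<in> borel_measurable (lborel \<Otimes>\<^sub>M M)" unfolding w_def by measurable
  have w0: "0 \<le> w r \<omega>" "w r \<omega> \<le> c * indicator {0..s} r" for r \<omega>
    using v by (auto simp: w_def indicator_def)
  have c: "0 \<le> c" using v(1)[of 0] v(2)[of 0] by linarith
  define Z where "Z = (\<lambda>\<omega>. LINT r|lborel. w r \<omega>)"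
  have Zm[measurable]: "Z \<in> borel_measurable M" unfolding Z_def by measurable
  have ci: "integrable lborel (\<lambda>r. c * indicator {0..s} r :: real)" using s by (intro integrable_mult_right integrable_real_indicator) auto
  have Zb: "\<bar>Z \<omega>\<bar> \<le> c * s" if "\<omega> \<in> space M" for \<omega>
  proof -
    have [measurable]: "(\<lambda>r. w r \<omega>) \<in> borel_measurable borel" using that unfolding w_def by measurable
    have "integrable lborel (\<lambda>r. w r \<omega>)"
      using ci by (rule Bochner_Integration.integrable_bound) (use w0 c in \<open>auto simp: indicator_def\<close>)
    then have "Z \<omega> \<le> (LINT r|lborel. c * indicator {0..s} r)"
      unfolding Z_def using ci w0 by (intro integral_mono) auto
    also have "\<dots> = c * s" using s by simp
    finally show ?thesis using w0 by (simp add: Z_def abs_of_nonneg integral_nonneg_AE)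
  qed
  have Zi: "integrable M Z" by (rule integrable_const_bound[of _ "c * s"]) (use Zb in auto)
  \<comment> \<open>Pulling the time integral out leaves a single instant r, and each X r with r
    between 0 and s is measurable for the past.\<close>
  have fub: "(LINT \<omega>|M. Z \<omega> * h \<omega>) = (LINT r|lborel. LINT \<omega>|M. w r \<omega> * h \<omega>)" if h: "integrable M h" for h
  proof -
    have [measurable]: "h \<in> borel_measurable M" using h by auto
    have "(\<integral>\<^sup>+ x. ennreal (norm ((\<lambda>(r, \<omega>). w r \<omega> * h \<omega>) x)) \<partial>(lborel \<Otimes>\<^sub>M M)) = (\<integral>\<^sup>+ \<omega>. \<integral>\<^sup>+ r. ennreal \<bar>w r \<omega> * h \<omega>\<bar> \<partial>lborel \<partial>M)"
      by (subst nn_integral_snd[symmetric]) auto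
    also have "\<dots> \<le> (\<integral>\<^sup>+ \<omega>. \<integral>\<^sup>+ r. ennreal (c * \<bar>h \<omega>\<bar>) * indicator {0..s} r \<partial>lborel \<partial>M)"
    proof (intro nn_integral_mono)
      fix \<omega> r
      have "\<bar>w r \<omega> * h \<omega>\<bar> \<le> c * indicator {0..s} r * \<bar>h \<omega>\<bar>"
        unfolding abs_mult using w0[of r \<omega>] by (intro mult_right_mono) auto
      then have "ennreal \<bar>w r \<omega> * h \<omega>\<bar> \<le> ennreal (c * indicator {0..s} r * \<bar>h \<omega>\<bar>)" by (rule ennreal_leI)
      also have "\<dots> = ennreal (c * \<bar>h \<omega>\<bar>) * indicator {0..s} r" by (cases "r \<in> {0..s}") auto
      finally show "ennreal \<bar>w r \<omega> * h \<omega>\<bar> \<le> ennreal (c * \<bar>h \<omega>\<bar>) * indicator {0..s} r" .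
    qed
    also have "\<dots> = (\<integral>\<^sup>+ \<omega>. ennreal (c * \<bar>h \<omega>\<bar>) * ennreal s \<partial>M)"
      using s by (intro nn_integral_cong, subst nn_integral_cmult_indicator) auto
    also have "\<dots> = (\<integral>\<^sup>+ \<omega>. ennreal (c * \<bar>h \<omega>\<bar>) \<partial>M) * ennreal s" by (rule nn_integral_multc) measurable
    also have "\<dots> < \<infinity>"
    proof -
      have "integrable M (\<lambda>\<omega>. c * \<bar>h \<omega>\<bar>)" using h by (intro integrable_mult_right integrable_abs)
      then have "(\<integral>\<^sup>+ \<omega>. ennreal (c * \<bar>h \<omega>\<bar>) \<partial>M) < \<infinity>" using c by (subst nn_integral_eq_integral) auto
      then show ?thesis by (simp add: ennreal_mult_less_top)
    qed
    finally have "integrable (lborel \<Otimes>\<^sub>M M) (\<lambda>(r, \<omega>). w r \<omega> * h \<omega>)" by (intro integrableI_bounded) auto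
    from Fubini_integral[OF this]
    have "(LINT \<omega>|M. LINT r|lborel. w r \<omega> * h \<omega>) = (LINT r|lborel. LINT \<omega>|M. w r \<omega> * h \<omega>)" .
    then show ?thesis unfolding Z_def by (simp only: integral_mult_left_zero)
  qed
  define Z' where "Z' = real_cond_exp M (past s) Z"
  have Z'p: "Z' \<in> borel_measurable (past s)" unfolding Z'_def by (rule borel_measurable_cond_exp)
  have Z'm[measurable]: "Z' \<in> borel_measurable M" unfolding Z'_def by (rule borel_measurable_cond_exp2)
  have Z'i: "integrable M Z'" unfolding Z'_def by (rule G.real_cond_exp_int(1)[OF Zi])
  have bnd: "integrable M (\<lambda>\<omega>. u \<omega> * h \<omega>)" if "integrable M h" and [measurable]: "u \<in> borel_measurable M" and "\<And>\<omega>. \<omega> \<in> space M \<Longrightarrow> \<bar>u \<omega>\<bar> \<le> b" for h u :: "'b \<Rightarrow> real" and b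
  proof -
    have [measurable]: "h \<in> borel_measurable M" using that by auto
    have "integrable M (\<lambda>\<omega>. b * \<bar>h \<omega>\<bar>)" using that by (intro integrable_mult_right integrable_abs)
    then show ?thesis
    proof (rule Bochner_Integration.integrable_bound)
      show "AE \<omega> in M. norm (u \<omega> * h \<omega>) \<le> norm (b * \<bar>h \<omega>\<bar>)"
      proof (rule AE_I2)
        fix \<omega> assume "\<omega> \<in> space M"
        then have "\<bar>u \<omega>\<bar> \<le> \<bar>b\<bar>" using that(3)[of \<omega>] by linarith
        then show "norm (u \<omega> * h \<omega>) \<le> norm (b * \<bar>h \<omega>\<bar>)" by (simp add: abs_mult mult_right_mono)
      qed
    qed measurable
  qed
  \<comment> \<open>The defining property of the conditional expectation, applied with the bounded
    past-measurable factor \<open>w r\<close>.\<close>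
  have wr: "(LINT \<omega>|M. w r \<omega> * Z \<omega>) = (LINT \<omega>|M. w r \<omega> * Z' \<omega>)" for r
  proof (cases "r \<in> {0..s}")
    case True
    have [measurable]: "X r \<in> borel_measurable (past s)" using True by (intro X_past_measurable) auto
    have "w r \<in> borel_measurable (past s)" unfolding w_def by measurable
    moreover have "integrable M (\<lambda>\<omega>. w r \<omega> * Z \<omega>)"
      by (rule bnd[OF Zi, of _ c]) (use w0[of r] True in \<open>auto simp: w_def\<close>)
    ultimately show ?thesis unfolding Z'_def by (intro G.real_cond_exp_intg(2)[symmetric]) auto
  qed (simp add: w_def)
  have i1: "integrable M (\<lambda>\<omega>. Z \<omega> * Z \<omega>)" by (rule bnd[OF Zi Zm Zb])
  have i2: "integrable M (\<lambda>\<omega>. Z \<omega> * Z' \<omega>)" by (rule bnd[OF Z'i Zm Zb])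
  have i2': "integrable M (\<lambda>\<omega>. Z' \<omega> * Z \<omega>)" using i2 by (simp only: mult.commute)
  have i3: "integrable M (\<lambda>\<omega>. Z' \<omega> * Z' \<omega>)" and e3: "(LINT \<omega>|M. Z' \<omega> * Z' \<omega>) = (LINT \<omega>|M. Z' \<omega> * Z \<omega>)"
    using G.real_cond_exp_intg[OF i2' Z'p Zm] unfolding Z'_def[symmetric] by auto
  \<comment> \<open>Z is itself the time integral of the \<open>w r\<close>, so E[Z Z] = E[Z Z'].
    Together with E[Z' Z'] = E[Z' Z] this makes the mean square of Z - Z' vanish.\<close>
  have e1: "(LINT \<omega>|M. Z \<omega> * Z \<omega>) = (LINT \<omega>|M. Z \<omega> * Z' \<omega>)"
    unfolding fub[OF Zi] fub[OF Z'i] by (simp only: wr)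
  have sq: "(Z \<omega> - Z' \<omega>)\<^sup>2 = Z \<omega> * Z \<omega> - 2 * (Z \<omega> * Z' \<omega>) + Z' \<omega> * Z' \<omega>" for \<omega>
    by (simp add: power2_eq_square algebra_simps)
  have sqi: "integrable M (\<lambda>\<omega>. (Z \<omega> - Z' \<omega>)\<^sup>2)"
    unfolding sq using i1 i2 i3 by auto
  have "(LINT \<omega>|M. (Z \<omega> - Z' \<omega>)\<^sup>2) = (LINT \<omega>|M. Z \<omega> * Z \<omega>) - 2 * (LINT \<omega>|M. Z \<omega> * Z' \<omega>) + (LINT \<omega>|M. Z' \<omega> * Z' \<omega>)"
    unfolding sq using i1 i2 i3 by simp
  also have "\<dots> = 0" unfolding e3 e1 by (simp add: mult.commute)
  finally have "AE \<omega> in M. (Z \<omega> - Z' \<omega>)\<^sup>2 = 0"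
    using integral_nonneg_eq_0_iff_AE[OF sqi] by auto
  then have "AE \<omega> in M. Z \<omega> = Z' \<omega>" by eventually_elim simp
  then show ?thesis using Z'p unfolding Z_def w_def by (intro bexI[of _ Z'])
qed

text \<open>The additive functional with rate V, kept in the extended half line so that it is
  defined even on paths where the singular rate has an infinite integral.\<close>

definition clock :: "('a \<Rightarrow> real) \<Rightarrow> real \<Rightarrow> 'b \<Rightarrow> ennreal" where
  "clock V s \<omega> = (\<integral>\<^sup>+ r. ennreal (V (X r \<omega>)) * indicator {0..s} r \<partial>lborel)"

lemma clock_measurable [measurable (raw)]:
  assumes [measurable]: "V \<in> borel_measurable borel" "f \<in> borel_measurable N" "g \<in> measurable N M"
  shows "(\<lambda>w. clock V (f w) (g w)) \<in> borel_measurable N"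
proof -
  have "(\<lambda>w. clock V (f w) (g w)) = (\<lambda>w. \<integral>\<^sup>+ r. ennreal (V (X r (g w))) * (if 0 \<le> r \<and> r \<le> f w then 1 else 0) \<partial>lborel)"
    unfolding clock_def by (intro ext nn_integral_cong) (auto simp: indicator_def)
  also have "\<dots> \<in> borel_measurable N" by measurable
  finally show ?thesis .
qed

text \<open>Time integrals of bounded rates agree almost surely with past-measurable variables;
  truncating V at n and monotone convergence carry this over to unbounded rates. Countably many
  exceptional null sets are united.\<close>

lemma clock_past:
  assumes s: "s > 0" and Vm[measurable]: "V \<in> borel_measurable borel" and V: "\<And>y. 0 \<le> V y"
  shows "\<exists>C'\<in>borel_measurable (past s). AE \<omega> in M. clock V s \<omega> = C' \<omega>"
proof -
  define Z where "Z = (\<lambda>n \<omega>. LINT r|lborel. indicator {0..s} r * min (V (X r \<omega>)) (real n))"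
  have "\<exists>Z'\<in>borel_measurable (past s). AE \<omega> in M. Z n \<omega> = Z' \<omega>" for n
    unfolding Z_def by (rule time_integral_past[OF s, where c = "real n"]) (use V in auto)
  then have "\<forall>n. \<exists>Z'. Z' \<in> borel_measurable (past s) \<and> (AE \<omega> in M. Z n \<omega> = Z' \<omega>)"
    unfolding Bex_def by (rule allI)
  from choice[OF this] obtain Z' where "\<forall>n. Z' n \<in> borel_measurable (past s) \<and> (AE \<omega> in M. Z n \<omega> = Z' n \<omega>)" ..
  then have Z': "\<And>n. Z' n \<in> borel_measurable (past s)" "\<And>n. AE \<omega> in M. Z n \<omega> = Z' n \<omega>"
    by (simp_all only: simp_thms)
  have cl: "clock V s \<omega> = (SUP n. ennreal (Z n \<omega>))" if \<omega>: "\<omega> \<in> space M" for \<omega>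
  proof -
    have [measurable]: "(\<lambda>r. X r \<omega>) \<in> borel_measurable borel" using \<omega> by measurable
    define u where "u = (\<lambda>n r. ennreal (indicator {0..s} r * min (V (X r \<omega>)) (real n)))"
    have um: "u n \<in> borel_measurable lborel" for n unfolding u_def by measurable
    have inc: "incseq u"
      by (auto simp: incseq_def le_fun_def u_def indicator_def intro!: ennreal_leI)
    have su: "ennreal (V (X r \<omega>)) * indicator {0..s} r = (SUP n. u n r)" for r
    proof (rule antisym)
      obtain n where "V (X r \<omega>) \<le> real n" using real_arch_simple by blast
      then have "ennreal (V (X r \<omega>)) * indicator {0..s} r \<le> u n r" by (auto simp: u_def indicator_def)
      then show "ennreal (V (X r \<omega>)) * indicator {0..s} r \<le> (SUP n. u n r)" by (rule SUP_upper2[OF UNIV_I])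
      show "(SUP n. u n r) \<le> ennreal (V (X r \<omega>)) * indicator {0..s} r"
        by (rule SUP_least) (auto simp: u_def indicator_def intro!: ennreal_leI)
    qed
    have "clock V s \<omega> = (SUP n. integral\<^sup>N lborel (u n))"
      unfolding clock_def su by (rule nn_integral_monotone_convergence_SUP[OF inc um])
    moreover have "integral\<^sup>N lborel (u n) = ennreal (Z n \<omega>)" for n
    proof -
      have "integrable lborel (\<lambda>r. real n * indicator {0..s} r)" using s by (intro integrable_mult_right integrable_real_indicator) auto
      then have "integrable lborel (\<lambda>r. indicator {0..s} r * min (V (X r \<omega>)) (real n))"
        by (rule Bochner_Integration.integrable_bound) (use V in \<open>auto simp: indicator_def\<close>)
      then show ?thesis unfolding u_def Z_def using V by (intro nn_integral_eq_integral) auto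
    qed
    ultimately show ?thesis by simp
  qed
  have "AE \<omega> in M. \<forall>n. Z n \<omega> = Z' n \<omega>" using Z'(2) by (simp add: AE_all_countable)
  then have "AE \<omega> in M. clock V s \<omega> = (SUP n. ennreal (Z' n \<omega>))"
    using AE_space by eventually_elim (simp add: cl)
  moreover have "(\<lambda>\<omega>. SUP n. ennreal (Z' n \<omega>)) \<in> borel_measurable (past s)"
    using Z'(1) by measurable
  ultimately show ?thesis by (rule bexI)
qed

text \<open>On an infinite clock this has the value 1, since \<open>enn2real\<close> sends
  \<infinity> to 0, whereas \<open>fk_weight\<close> has the value 0. The two agree where the clock
  is finite, which is almost everywhere once the clock has finite expectation.\<close>

definition weight :: "('a \<Rightarrow> real) \<Rightarrow> real \<Rightarrow> 'b \<Rightarrow> real" where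
  "weight V s \<omega> = exp (- enn2real (clock V s \<omega>))"

lemma weight_measurable [measurable (raw)]:
  assumes [measurable]: "V \<in> borel_measurable borel" "f \<in> borel_measurable N" "g \<in> measurable N M"
  shows "(\<lambda>w. weight V (f w) (g w)) \<in> borel_measurable N"
  unfolding weight_def by measurable

lemma weight_bounds: "0 < weight V s \<omega>" "weight V s \<omega> \<le> 1"
  by (auto simp: weight_def)

text \<open>The clock is replaced by its past-measurable version, which changes neither expectation
  and makes the Markov property applicable.\<close>

lemma markov_weight:
  assumes s: "0 < s" "s < t" and [measurable]: "V \<in> borel_measurable borel" "f \<in> borel_measurable borel"
    and V: "\<And>y. 0 \<le> V y"
  shows "(\<integral>\<^sup>+ \<omega>. ennreal (V (X s \<omega>) * weight V s \<omega>) * f (X t \<omega>) \<partial>M) =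
     (\<integral>\<^sup>+ \<omega>. ennreal (V (X s \<omega>) * weight V s \<omega>) * P (t - s) f (X s \<omega>) \<partial>M)"
proof -
  obtain C' where C'[measurable]: "C' \<in> borel_measurable (past s)" and AE: "AE \<omega> in M. clock V s \<omega> = C' \<omega>"
    using clock_past[OF s(1) assms(3) V] by blast
  define H where "H = (\<lambda>\<omega>. ennreal (V (X s \<omega>) * exp (- enn2real (C' \<omega>))))"
  have [measurable]: "X s \<in> borel_measurable (past s)" using s by (intro X_past_measurable) auto
  have Hm: "H \<in> borel_measurable (past s)" unfolding H_def by measurable
  have HE: "AE \<omega> in M. ennreal (V (X s \<omega>) * weight V s \<omega>) = H \<omega>"
    using AE by eventually_elim (simp add: H_def weight_def)
  have "(\<integral>\<^sup>+ \<omega>. ennreal (V (X s \<omega>) * weight V s \<omega>) * f (X t \<omega>) \<partial>M) = (\<integral>\<^sup>+ \<omega>. H \<omega> * f (X t \<omega>) \<partial>M)"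
    by (rule nn_integral_cong_AE) (use HE in eventually_elim, simp)
  also have "\<dots> = (\<integral>\<^sup>+ \<omega>. H \<omega> * P (t - s) f (X s \<omega>) \<partial>M)"
    by (rule markov_past[OF s Hm assms(4)])
  also have "\<dots> = (\<integral>\<^sup>+ \<omega>. ennreal (V (X s \<omega>) * weight V s \<omega>) * P (t - s) f (X s \<omega>) \<partial>M)"
    by (rule nn_integral_cong_AE) (use HE in eventually_elim, simp)
  finally show ?thesis .
qed

end

section \<open>Moments of the Feynman-Kac kernel\<close>

lemma ennreal_mult_one_minus:
  fixes a :: ennreal
  assumes "0 \<le> w" "w \<le> 1"
  shows "a * ennreal w + a * ennreal (1 - w) = a"
proof -
  have "ennreal w + ennreal (1 - w) = ennreal (w + (1 - w))"
    using assms by (intro ennreal_plus[symmetric]) auto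
  then show ?thesis by (simp add: distrib_left[symmetric])
qed

lemma (in stable_semigroup) scaled_riesz_potential_finite:
  assumes "x \<noteq> 0" "t > 0" "0 \<le> k"
  shows "(\<integral>\<^sup>+ r. indicator {0..t} r * P r (\<lambda>y. ennreal (k * norm y powr (- \<alpha>))) x \<partial>lborel) < \<infinity>"
proof -
  have eqP: "P r (\<lambda>y. ennreal (k * norm y powr (- \<alpha>))) x = ennreal k * P r (npow (- \<alpha>)) x" for r
    using assms(3) by (subst P_cmult[symmetric]) (auto simp: ennreal_mult)
  have "(\<integral>\<^sup>+ r. indicator {0..t} r * P r (\<lambda>y. ennreal (k * norm y powr (- \<alpha>))) x \<partial>lborel) =
    (\<integral>\<^sup>+ r. ennreal k * (indicator {0..t} r * P r (npow (- \<alpha>)) x) \<partial>lborel)"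
    unfolding eqP by (simp only: mult.left_commute)
  also have "\<dots> = ennreal k * (\<integral>\<^sup>+ r. indicator {0..t} r * P r (npow (- \<alpha>)) x \<partial>lborel)"
    by (rule nn_integral_cmult) measurable
  also have "\<dots> < \<infinity>" using riesz_potential_finite[OF assms(1,2)] by (simp add: ennreal_mult_less_top)
  finally show ?thesis .
qed

context stable_path
begin

text \<open>Tonelli turns the mean of the clock into the time integral of P r V, finite by
  hypothesis. Hence almost every path has a finite clock, and the pathwise statements hold
  there.\<close>

lemma
  assumes t: "t > 0" and Vm[measurable]: "V \<in> borel_measurable borel" and V: "\<And>y. 0 \<le> V y"
    and fin: "(\<integral>\<^sup>+ r. indicator {0..t} r * P r (\<lambda>y. ennreal (V y)) x0 \<partial>lborel) < \<infinity>"
  shows clock_finite: "AE \<omega> in M. clock V t \<omega> < \<infinity>"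
    and one_minus_weight: "AE \<omega> in M. ennreal (1 - weight V t \<omega>) =
      (\<integral>\<^sup>+ s. indicator {0..t} s * ennreal (V (X s \<omega>) * weight V s \<omega>) \<partial>lborel)"
    and fk_weight_eq_weight: "AE \<omega> in M. fk_weight (\<lambda>y. - V y) X t \<omega> = weight V t \<omega>"
proof -
  interpret pair_sigma_finite lborel M ..
  have "(\<integral>\<^sup>+ \<omega>. clock V t \<omega> \<partial>M) = (\<integral>\<^sup>+ r. \<integral>\<^sup>+ \<omega>. ennreal (V (X r \<omega>)) * indicator {0..t} r \<partial>M \<partial>lborel)"
    unfolding clock_def by (rule Fubini') measurable
  also have "\<dots> = (\<integral>\<^sup>+ r. indicator {0..t} r * P r (\<lambda>y. ennreal (V y)) x0 \<partial>lborel)"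
  proof (rule nn_integral_cong_AE)
    have "AE r in lborel. r \<noteq> (0::real)" by (rule AE_lborel_singleton)
    then show "AE r in lborel. (\<integral>\<^sup>+ \<omega>. ennreal (V (X r \<omega>)) * indicator {0..t} r \<partial>M) = indicator {0..t} r * P r (\<lambda>y. ennreal (V y)) x0"
    proof eventually_elim
      case (elim r)
      show ?case
      proof (cases "r \<in> {0..t}")
        case True
        then have "r > 0" using elim by auto
        from expectation_X[OF this, of "\<lambda>y. ennreal (V y)"] True show ?thesis by simp
      qed simp
    qed
  qed
  finally have "(\<integral>\<^sup>+ \<omega>. clock V t \<omega> \<partial>M) \<noteq> \<infinity>" using fin by simp
  then have "AE \<omega> in M. clock V t \<omega> \<noteq> \<infinity>" by (rule nn_integral_PInf_AE[rotated]) measurable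
  then show cf: "AE \<omega> in M. clock V t \<omega> < \<infinity>" by eventually_elim (simp add: less_top)
  show "AE \<omega> in M. ennreal (1 - weight V t \<omega>) =
      (\<integral>\<^sup>+ s. indicator {0..t} s * ennreal (V (X s \<omega>) * weight V s \<omega>) \<partial>lborel)"
    using cf AE_space
  proof eventually_elim
    case (elim \<omega>)
    have [measurable]: "(\<lambda>r. V (X r \<omega>)) \<in> borel_measurable borel" using elim by measurable
    show ?case
      using one_minus_exp_neg_integral[of "\<lambda>r. V (X r \<omega>)" t] elim t V
      by (simp add: weight_def clock_def ennreal_mult)
  qed
  show "AE \<omega> in M. fk_weight (\<lambda>y. - V y) X t \<omega> = weight V t \<omega>"
    using cf AE_space
  proof eventually_elim
    case (elim \<omega>)
    have [measurable]: "(\<lambda>r. V (X r \<omega>)) \<in> borel_measurable borel" using elim by measurable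
    have cl: "(\<integral>\<^sup>+ r. ennreal (indicator {0..t} r *\<^sub>R V (X r \<omega>)) \<partial>lborel) = clock V t \<omega>"
      unfolding clock_def by (intro nn_integral_cong) (auto simp: indicator_def)
    have i: "integrable lborel (\<lambda>r. indicator {0..t} r *\<^sub>R V (X r \<omega>))"
      using cl elim V by (intro integrableI_nonneg) (auto simp: indicator_def)
    have L: "(LINT r|lborel. indicator {0..t} r *\<^sub>R V (X r \<omega>)) = enn2real (clock V t \<omega>)"
      unfolding cl[symmetric] using V by (intro integral_eq_nn_integral) (auto simp: indicator_def)
    have "set_integrable lborel {0..t} (\<lambda>s. - V (X s \<omega>))"
      unfolding set_integrable_def using i by simp
    moreover have "(LINT s:{0..t}|lborel. - V (X s \<omega>)) = - enn2real (clock V t \<omega>)"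
      unfolding set_lebesgue_integral_def L[symmetric] by simp
    ultimately show ?case by (simp add: fk_weight_def weight_def)
  qed
qed

text \<open>The factor g is arbitrary and may look beyond the killing time s. It is used with |X
  t|^\<beta> at horizon t and, read from right to left, with |X u|^(\<beta>-\<alpha>) at horizon
  u.\<close>

lemma expectation_one_minus_weight:
  assumes t: "t > 0" and Vm[measurable]: "V \<in> borel_measurable borel" and V: "\<And>y. 0 \<le> V y"
    and fin: "(\<integral>\<^sup>+ r. indicator {0..t} r * P r (\<lambda>y. ennreal (V y)) x0 \<partial>lborel) < \<infinity>"
    and g[measurable]: "g \<in> borel_measurable M"
  shows "(\<integral>\<^sup>+ \<omega>. g \<omega> * ennreal (1 - weight V t \<omega>) \<partial>M) =
    (\<integral>\<^sup>+ s. indicator {0..t} s * (\<integral>\<^sup>+ \<omega>. ennreal (V (X s \<omega>) * weight V s \<omega>) * g \<omega> \<partial>M) \<partial>lborel)"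
proof -
  interpret pair_sigma_finite lborel M ..
  have "(\<integral>\<^sup>+ \<omega>. g \<omega> * ennreal (1 - weight V t \<omega>) \<partial>M) =
    (\<integral>\<^sup>+ \<omega>. \<integral>\<^sup>+ s. indicator {0..t} s * (ennreal (V (X s \<omega>) * weight V s \<omega>) * g \<omega>) \<partial>lborel \<partial>M)"
  proof (rule nn_integral_cong_AE)
    show "AE \<omega> in M. g \<omega> * ennreal (1 - weight V t \<omega>) = (\<integral>\<^sup>+ s. indicator {0..t} s * (ennreal (V (X s \<omega>) * weight V s \<omega>) * g \<omega>) \<partial>lborel)"
      using one_minus_weight[OF t Vm V fin] AE_space
    proof eventually_elim
      case (elim \<omega>)
      have m: "(\<lambda>s. indicator {0..t} s * ennreal (V (X s \<omega>) * weight V s \<omega>)) \<in> borel_measurable lborel"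
        using elim(2) by measurable
      have "g \<omega> * ennreal (1 - weight V t \<omega>) = (\<integral>\<^sup>+ s. indicator {0..t} s * ennreal (V (X s \<omega>) * weight V s \<omega>) \<partial>lborel) * g \<omega>"
        unfolding elim(1) by (rule mult.commute)
      also have "\<dots> = (\<integral>\<^sup>+ s. (indicator {0..t} s * ennreal (V (X s \<omega>) * weight V s \<omega>)) * g \<omega> \<partial>lborel)"
        by (rule nn_integral_multc[symmetric, OF m])
      finally show ?case by (simp only: mult.assoc)
    qed
  qed
  also have "\<dots> = (\<integral>\<^sup>+ s. \<integral>\<^sup>+ \<omega>. indicator {0..t} s * (ennreal (V (X s \<omega>) * weight V s \<omega>) * g \<omega>) \<partial>M \<partial>lborel)"
    by (rule Fubini') measurable
  also have "\<dots> = (\<integral>\<^sup>+ s. indicator {0..t} s * (\<integral>\<^sup>+ \<omega>. ennreal (V (X s \<omega>) * weight V s \<omega>) * g \<omega> \<partial>M) \<partial>lborel)"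
    by (intro nn_integral_cong nn_integral_cmult) measurable
  finally show ?thesis .
qed

text \<open>Writing \<open>1 - weight\<close> as an integral over the killing time \<open>s\<close> (Duhamel), the Markov property at \<open>s\<close>
  and the moment formula without potential turn it back into weighted moments.\<close>

lemma weighted_moment:
  fixes \<beta> \<delta> t :: real
  assumes x0: "x0 \<noteq> 0" and \<beta>: "0 < \<beta>" "\<beta> < \<alpha>" and \<delta>: "0 < \<delta>" "\<delta> < \<alpha>" and t: "t > 0"
  defines "V \<equiv> \<lambda>y::'a. - kappa DIM('a) \<alpha> \<delta> * norm y powr (- \<alpha>)"
  defines "a \<equiv> \<integral>\<^sup>+ \<omega>. ennreal (norm (X t \<omega>) powr \<beta>) * ennreal (weight V t \<omega>) \<partial>M"
  defines "C \<equiv> \<integral>\<^sup>+ s. indicator {0..t} s * (\<integral>\<^sup>+ \<omega>. ennreal (norm (X s \<omega>) powr (\<beta> - \<alpha>)) * ennreal (weight V s \<omega>) \<partial>M) \<partial>lborel"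
  shows "a < \<infinity>" "C < \<infinity>"
    "enn2real a = norm x0 powr \<beta> + (kappa DIM('a) \<alpha> \<delta> - kappa DIM('a) \<alpha> \<beta>) * enn2real C"
proof -
  interpret pair_sigma_finite lborel M ..
  define k1 where "k1 = (\<lambda>y::'a. ennreal (norm y powr \<beta>))"
  define k2 where "k2 = (\<lambda>y::'a. ennreal (norm y powr (\<beta> - \<alpha>)))"
  define Kb where "Kb = - kappa DIM('a) \<alpha> \<beta>"
  define Kd where "Kd = - kappa DIM('a) \<alpha> \<delta>"
  have K: "Kb > 0" "Kd > 0" using kappa_neg[of \<beta> \<alpha> "DIM('a)"] kappa_neg[of \<delta> \<alpha> "DIM('a)"] \<beta> \<delta> \<alpha> by (auto simp: Kb_def Kd_def)
  have [measurable]: "k1 \<in> borel_measurable borel" "k2 \<in> borel_measurable borel" "V \<in> borel_measurable borel"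
    unfolding k1_def k2_def V_def by measurable
  have V: "0 \<le> V y" for y unfolding V_def Kd_def[symmetric] using K by simp
  have finV: "(\<integral>\<^sup>+ r. indicator {0..u} r * P r (\<lambda>y. ennreal (V y)) x0 \<partial>lborel) < \<infinity>" if "u > 0" for u
    unfolding V_def Kd_def[symmetric] using K that x0 by (intro scaled_riesz_potential_finite) auto
  \<comment> \<open>Under killing at rate V along a given path, \<open>W s\<close> is the density in
    s of the killing time.\<close>
  define W where "W = (\<lambda>s \<omega>. ennreal (V (X s \<omega>) * weight V s \<omega>))"
  have [measurable]: "(\<lambda>(s, \<omega>). W s \<omega>) \<in> borel_measurable (lborel \<Otimes>\<^sub>M M)" unfolding W_def by measurable
  have [measurable]: "W s \<in> borel_measurable M" for s unfolding W_def by measurable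
  \<comment> \<open>\<open>c\<close> and \<open>e\<close> are the surviving and the killed part of
    the moment of order \<beta> - \<alpha>; for s > 0 they add up to the moment without
    potential.\<close>
  define c where "c = (\<lambda>s. \<integral>\<^sup>+ \<omega>. k2 (X s \<omega>) * ennreal (weight V s \<omega>) \<partial>M)"
  define e where "e = (\<lambda>s. \<integral>\<^sup>+ \<omega>. k2 (X s \<omega>) * ennreal (1 - weight V s \<omega>) \<partial>M)"
  have [measurable]: "c \<in> borel_measurable borel" "e \<in> borel_measurable borel" unfolding c_def e_def by measurable
  \<comment> \<open>The moment at time u of the unkilled process, weighted by the density of killing
    at time s.\<close>
  define m where "m = (\<lambda>s u. \<integral>\<^sup>+ \<omega>. W s \<omega> * k2 (X u \<omega>) \<partial>M)"
  have mm[measurable]: "(\<lambda>(s, u). m s u) \<in> borel_measurable (borel \<Otimes>\<^sub>M borel)" unfolding m_def W_def by measurable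
  have C: "C = (\<integral>\<^sup>+ s. indicator {0..t} s * c s \<partial>lborel)" unfolding C_def c_def k2_def ..
  have split: "(\<integral>\<^sup>+ \<omega>. f (X s \<omega>) * ennreal (weight V s \<omega>) \<partial>M) + (\<integral>\<^sup>+ \<omega>. f (X s \<omega>) * ennreal (1 - weight V s \<omega>) \<partial>M) = P s f x0"
    if "s > 0" and [measurable]: "f \<in> borel_measurable borel" for s f
  proof -
    have "(\<integral>\<^sup>+ \<omega>. f (X s \<omega>) * ennreal (weight V s \<omega>) \<partial>M) + (\<integral>\<^sup>+ \<omega>. f (X s \<omega>) * ennreal (1 - weight V s \<omega>) \<partial>M) =
      (\<integral>\<^sup>+ \<omega>. f (X s \<omega>) * ennreal (weight V s \<omega>) + f (X s \<omega>) * ennreal (1 - weight V s \<omega>) \<partial>M)"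
      by (rule nn_integral_add[symmetric]) measurable
    also have "\<dots> = (\<integral>\<^sup>+ \<omega>. f (X s \<omega>) \<partial>M)"
      by (intro nn_integral_cong ennreal_mult_one_minus) (use weight_bounds[of V s] in \<open>auto simp: less_imp_le\<close>)
    finally show ?thesis using expectation_X[OF that] by simp
  qed
  define E where "E = (\<integral>\<^sup>+ s. indicator {0..t} s * e s \<partial>lborel)"
  have CE: "(\<integral>\<^sup>+ s. indicator {0..t} s * P s k2 x0 \<partial>lborel) = C + E"
  proof -
    have "(\<integral>\<^sup>+ s. indicator {0..t} s * P s k2 x0 \<partial>lborel) = (\<integral>\<^sup>+ s. indicator {0..t} s * c s + indicator {0..t} s * e s \<partial>lborel)"
    proof (rule nn_integral_cong_AE)
      have "AE s in lborel. s \<noteq> (0::real)" by (rule AE_lborel_singleton)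
      then show "AE s in lborel. indicator {0..t} s * P s k2 x0 = indicator {0..t} s * c s + indicator {0..t} s * e s"
      proof eventually_elim
        case (elim s)
        show ?case
        proof (cases "s \<in> {0..t}")
          case True
          then have "s > 0" using elim by auto
          from split[OF this, of k2] True show ?thesis by (simp add: c_def e_def)
        qed simp
      qed
    qed
    also have "\<dots> = C + E" unfolding C E_def by (rule nn_integral_add) measurable
    finally show ?thesis .
  qed
  define b where "b = (\<integral>\<^sup>+ \<omega>. k1 (X t \<omega>) * ennreal (1 - weight V t \<omega>) \<partial>M)"
  \<comment> \<open>The formula without potential, with both the moment at t and the time integral
    split into surviving and killed parts.\<close>
  have ab: "a + b = ennreal (norm x0 powr \<beta>) + ennreal Kb * (C + E)"
    using split[OF t, of k1] stable_moment(1)[OF \<beta> t, of x0] unfolding CE[symmetric]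
    by (simp add: a_def b_def k1_def k2_def Kb_def)
  have bb: "b = ennreal Kd * C + ennreal Kb * E"
  proof -
    \<comment> \<open>After time s no weight acts any more, and the formula without potential covers
      the remaining time t - s. Its initial term, by V |y|^\<beta> = Kd |y|^(\<beta>-\<alpha>),
      gives \<open>c s\<close>; its time integral becomes an integral of \<open>m s u\<close> over u
      from s to t.\<close>
    have duh: "(\<integral>\<^sup>+ \<omega>. W s \<omega> * k1 (X t \<omega>) \<partial>M) = ennreal Kd * c s + ennreal Kb * (\<integral>\<^sup>+ u. indicator {s..t} u * m s u \<partial>lborel)"
      if s: "0 < s" "s < t" for s
    proof -
      have ts: "t - s > 0" using s by simp
      have "(\<integral>\<^sup>+ \<omega>. W s \<omega> * k1 (X t \<omega>) \<partial>M) = (\<integral>\<^sup>+ \<omega>. W s \<omega> * P (t - s) k1 (X s \<omega>) \<partial>M)"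
        unfolding W_def by (rule markov_weight[OF s]) (auto simp: V)
      also have "\<dots> = (\<integral>\<^sup>+ \<omega>. W s \<omega> * k1 (X s \<omega>) + ennreal Kb * (\<integral>\<^sup>+ r. indicator {0..t - s} r * (W s \<omega> * P r k2 (X s \<omega>)) \<partial>lborel) \<partial>M)"
      proof (rule nn_integral_cong)
        fix \<omega>
        have "P (t - s) k1 (X s \<omega>) = k1 (X s \<omega>) + ennreal Kb * (\<integral>\<^sup>+ r. indicator {0..t - s} r * P r k2 (X s \<omega>) \<partial>lborel)"
          unfolding k1_def k2_def Kb_def by (rule stable_moment(1)[OF \<beta> ts])
        moreover have "W s \<omega> * (\<integral>\<^sup>+ r. indicator {0..t - s} r * P r k2 (X s \<omega>) \<partial>lborel) = (\<integral>\<^sup>+ r. W s \<omega> * (indicator {0..t - s} r * P r k2 (X s \<omega>)) \<partial>lborel)"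
          by (rule nn_integral_cmult[symmetric]) measurable
        ultimately show "W s \<omega> * P (t - s) k1 (X s \<omega>) = W s \<omega> * k1 (X s \<omega>) + ennreal Kb * (\<integral>\<^sup>+ r. indicator {0..t - s} r * (W s \<omega> * P r k2 (X s \<omega>)) \<partial>lborel)"
          by (simp only: distrib_left mult.left_commute)
      qed
      also have "\<dots> = (\<integral>\<^sup>+ \<omega>. W s \<omega> * k1 (X s \<omega>) \<partial>M) + (\<integral>\<^sup>+ \<omega>. ennreal Kb * (\<integral>\<^sup>+ r. indicator {0..t - s} r * (W s \<omega> * P r k2 (X s \<omega>)) \<partial>lborel) \<partial>M)"
        by (rule nn_integral_add) measurable
      also have "(\<integral>\<^sup>+ \<omega>. W s \<omega> * k1 (X s \<omega>) \<partial>M) = ennreal Kd * c s"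
      proof -
        have "W s \<omega> * k1 (X s \<omega>) = ennreal Kd * (k2 (X s \<omega>) * ennreal (weight V s \<omega>))" for \<omega>
        proof -
          have "V (X s \<omega>) * weight V s \<omega> * norm (X s \<omega>) powr \<beta> = Kd * ((norm (X s \<omega>) powr \<beta> * norm (X s \<omega>) powr (- \<alpha>)) * weight V s \<omega>)"
            by (simp add: V_def Kd_def)
          also have "norm (X s \<omega>) powr \<beta> * norm (X s \<omega>) powr (- \<alpha>) = norm (X s \<omega>) powr (\<beta> - \<alpha>)"
            by (simp add: powr_add[symmetric])
          finally have *: "V (X s \<omega>) * weight V s \<omega> * norm (X s \<omega>) powr \<beta> = Kd * (norm (X s \<omega>) powr (\<beta> - \<alpha>) * weight V s \<omega>)" .
          have "W s \<omega> * k1 (X s \<omega>) = ennreal (V (X s \<omega>) * weight V s \<omega> * norm (X s \<omega>) powr \<beta>)"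
            unfolding W_def k1_def using V weight_bounds(1)[of V s \<omega>] by (intro ennreal_mult[symmetric]) auto
          also have "\<dots> = ennreal Kd * (ennreal (norm (X s \<omega>) powr (\<beta> - \<alpha>)) * ennreal (weight V s \<omega>))"
            unfolding * using K weight_bounds(1)[of V s \<omega>] by (subst ennreal_mult) (auto simp: ennreal_mult)
          finally show ?thesis by (simp add: k2_def)
        qed
        then show ?thesis unfolding c_def by (simp add: nn_integral_cmult)
      qed
      also have "(\<integral>\<^sup>+ \<omega>. ennreal Kb * (\<integral>\<^sup>+ r. indicator {0..t - s} r * (W s \<omega> * P r k2 (X s \<omega>)) \<partial>lborel) \<partial>M) =
         ennreal Kb * (\<integral>\<^sup>+ \<omega>. \<integral>\<^sup>+ r. indicator {0..t - s} r * (W s \<omega> * P r k2 (X s \<omega>)) \<partial>lborel \<partial>M)"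
        by (rule nn_integral_cmult) measurable
      also have "(\<integral>\<^sup>+ \<omega>. \<integral>\<^sup>+ r. indicator {0..t - s} r * (W s \<omega> * P r k2 (X s \<omega>)) \<partial>lborel \<partial>M) =
         (\<integral>\<^sup>+ r. \<integral>\<^sup>+ \<omega>. indicator {0..t - s} r * (W s \<omega> * P r k2 (X s \<omega>)) \<partial>M \<partial>lborel)"
        by (rule Fubini') measurable
      \<comment> \<open>Here the Markov property is read backwards, from P r at X s to the position
        at time s + r. It needs a strictly later time, so r = 0 is dropped as a null set. The form s
        + 1 * r fits the affine substitution that follows.\<close>
      also have "\<dots> = (\<integral>\<^sup>+ r. indicator {s..t} (s + 1 * r) * m s (s + 1 * r) \<partial>lborel)"
      proof (rule nn_integral_cong_AE)
        have "AE r in lborel. r \<noteq> (0::real)" by (rule AE_lborel_singleton)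
        then show "AE r in lborel. (\<integral>\<^sup>+ \<omega>. indicator {0..t - s} r * (W s \<omega> * P r k2 (X s \<omega>)) \<partial>M) = indicator {s..t} (s + 1 * r) * m s (s + 1 * r)"
        proof eventually_elim
          case (elim r)
          have iff: "r \<in> {0..t - s} \<longleftrightarrow> s + 1 * r \<in> {s..t}" by auto
          show ?case
          proof (cases "r \<in> {0..t - s}")
            case True
            then have r: "s < s + r" using elim by auto
            have "(\<integral>\<^sup>+ \<omega>. W s \<omega> * k2 (X (s + r) \<omega>) \<partial>M) = (\<integral>\<^sup>+ \<omega>. W s \<omega> * P (s + r - s) k2 (X s \<omega>) \<partial>M)"
              unfolding W_def by (rule markov_weight[OF s(1) r]) (auto simp: V)
            then have "(\<integral>\<^sup>+ \<omega>. W s \<omega> * P r k2 (X s \<omega>) \<partial>M) = m s (s + 1 * r)" by (simp add: m_def)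
            then show ?thesis using True iff by simp
          next
            case False
            then have "s + 1 * r \<notin> {s..t}" using iff by blast
            then have "indicator {0..t - s} r = (0::ennreal)" "indicator {s..t} (s + 1 * r) = (0::ennreal)"
              using False by (auto simp: indicator_def)
            then show ?thesis by (simp only: mult_zero_left nn_integral_const)
          qed
        qed
      qed
      also have "\<dots> = (\<integral>\<^sup>+ u. indicator {s..t} u * m s u \<partial>lborel)"
        by (subst nn_integral_real_affine[where c = 1 and t = s]) auto
      finally show ?thesis .
    qed
    have "b = (\<integral>\<^sup>+ s. indicator {0..t} s * (\<integral>\<^sup>+ \<omega>. W s \<omega> * k1 (X t \<omega>) \<partial>M) \<partial>lborel)"
      unfolding b_def W_def by (rule expectation_one_minus_weight[OF t _ V finV[OF t]]) measurable
    \<comment> \<open>The endpoints 0 and t are null sets, and \<open>duh\<close> needs 0 < s < t.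
      The indicator of {s..t} becomes a conditional for the sake of joint measurability on the
      triangle.\<close>
    also have "\<dots> = (\<integral>\<^sup>+ s. ennreal Kd * (indicator {0..t} s * c s) + ennreal Kb * (\<integral>\<^sup>+ u. indicator {0..t} s * (if s \<le> u \<and> u \<le> t then m s u else 0) \<partial>lborel) \<partial>lborel)"
    proof (rule nn_integral_cong_AE)
      have "AE s in lborel. s \<noteq> (0::real)" "AE s in lborel. s \<noteq> t" by (rule AE_lborel_singleton)+
      then show "AE s in lborel. indicator {0..t} s * (\<integral>\<^sup>+ \<omega>. W s \<omega> * k1 (X t \<omega>) \<partial>M) =
        ennreal Kd * (indicator {0..t} s * c s) + ennreal Kb * (\<integral>\<^sup>+ u. indicator {0..t} s * (if s \<le> u \<and> u \<le> t then m s u else 0) \<partial>lborel)"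
      proof eventually_elim
        case (elim s)
        show ?case
        proof (cases "s \<in> {0..t}")
          case True
          then have s: "0 < s" "s < t" using elim by auto
          have "(\<integral>\<^sup>+ u. indicator {s..t} u * m s u \<partial>lborel) = (\<integral>\<^sup>+ u. indicator {0..t} s * (if s \<le> u \<and> u \<le> t then m s u else 0) \<partial>lborel)"
            using True by (intro nn_integral_cong) (auto simp: indicator_def)
          then show ?thesis using duh[OF s] True by simp
        qed simp
      qed
    qed
    also have "\<dots> = ennreal Kd * C + ennreal Kb * (\<integral>\<^sup>+ s. \<integral>\<^sup>+ u. indicator {0..t} s * (if s \<le> u \<and> u \<le> t then m s u else 0) \<partial>lborel \<partial>lborel)"
    proof -
      have m1: "(\<lambda>s. indicator {0..t} s * c s) \<in> borel_measurable lborel" by measurable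
      have m2: "(\<lambda>s. \<integral>\<^sup>+ u. indicator {0..t} s * (if s \<le> u \<and> u \<le> t then m s u else 0) \<partial>lborel) \<in> borel_measurable lborel"
        by measurable
      show ?thesis unfolding C using m1 m2
        by (subst nn_integral_add) (simp_all add: nn_integral_cmult)
    qed
    also have "(\<integral>\<^sup>+ s. \<integral>\<^sup>+ u. indicator {0..t} s * (if s \<le> u \<and> u \<le> t then m s u else 0) \<partial>lborel \<partial>lborel) =
      (\<integral>\<^sup>+ u. \<integral>\<^sup>+ s. indicator {0..t} s * (if s \<le> u \<and> u \<le> t then m s u else 0) \<partial>lborel \<partial>lborel)"
      by (rule lborel_pair.Fubini'[symmetric]) measurable
    \<comment> \<open>In the other order the inner integral runs over killing times s \<le> u. It is
      again of Duhamel form, now with horizon u, and so recombines to the killed part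
      \<open>e u\<close>.\<close>
    also have "\<dots> = E" unfolding E_def
    proof (rule nn_integral_cong_AE)
      have "AE u in lborel. u \<noteq> (0::real)" by (rule AE_lborel_singleton)
      then show "AE u in lborel. (\<integral>\<^sup>+ s. indicator {0..t} s * (if s \<le> u \<and> u \<le> t then m s u else 0) \<partial>lborel) = indicator {0..t} u * e u"
      proof eventually_elim
        case (elim u)
        show ?case
        proof (cases "u \<in> {0..t}")
          case True
          then have u: "u > 0" using elim by auto
          have "e u = (\<integral>\<^sup>+ s. indicator {0..u} s * m s u \<partial>lborel)"
            unfolding e_def m_def W_def by (rule expectation_one_minus_weight[OF u _ V finV[OF u]]) measurable
          also have "\<dots> = (\<integral>\<^sup>+ s. indicator {0..t} s * (if s \<le> u \<and> u \<le> t then m s u else 0) \<partial>lborel)"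
            using True by (intro nn_integral_cong) (auto simp: indicator_def)
          finally show ?thesis using True by simp
        next
          case False
          then have z: "indicator {0..t} s * (if s \<le> u \<and> u \<le> t then m s u else 0) = 0" for s
            by (auto simp: indicator_def)
          have "indicator {0..t} u = (0::ennreal)" using False by (rule indicator_simps(2))
          then show ?thesis by (simp only: z nn_integral_const mult_zero_left)
        qed
      qed
    qed
    finally show ?thesis .
  qed
  \<comment> \<open>C and E are parts of a finite time integral without potential, so
    \<open>Kb * E\<close> may be cancelled between the two expressions involving b. What remains has
    the coefficient Kb - Kd = \<kappa>_\<delta> - \<kappa>_\<beta>.\<close>
  have "C + E < \<infinity>" unfolding CE[symmetric] k2_def by (rule stable_moment(3)[OF \<beta> t])
  then have fin: "C < \<infinity>" "E < \<infinity>" by (simp_all add: ennreal_add_less_top)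
  show "C < \<infinity>" by (rule fin)
  have "a + b < \<infinity>" unfolding ab using \<open>C + E < \<infinity>\<close> by (simp add: ennreal_mult_less_top)
  then show afin: "a < \<infinity>" by (simp add: ennreal_add_less_top)
  obtain a' C' E' where r: "a = ennreal a'" "0 \<le> a'" "C = ennreal C'" "0 \<le> C'" "E = ennreal E'" "0 \<le> E'"
    using afin fin by (metis enn2real_nonneg ennreal_enn2real infinity_ennreal_def)
  have "ennreal (a' + (Kd * C' + Kb * E')) = a + (ennreal Kd * C + ennreal Kb * E)"
    using r K by (simp add: ennreal_mult)
  also have "\<dots> = ennreal (norm x0 powr \<beta> + Kb * (C' + E'))"
    unfolding bb[symmetric] ab using r K by (simp add: ennreal_mult)
  finally have "a' + (Kd * C' + Kb * E') = norm x0 powr \<beta> + Kb * (C' + E')"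
    using r K by (subst (asm) ennreal_inj) auto
  then show "enn2real a = norm x0 powr \<beta> + (kappa DIM('a) \<alpha> \<delta> - kappa DIM('a) \<alpha> \<beta>) * enn2real C"
    using r by (simp add: Kb_def Kd_def algebra_simps)
qed

end

section \<open>From the process to the kernel\<close>

lemma stable_process_mass:
  fixes X :: "real \<Rightarrow> 'b \<Rightarrow> 'a::euclidean_space"
  assumes "stable_process \<alpha> M X x" "s > 0"
  shows "(\<integral>\<^sup>+ z. ennreal (stable_kernel \<alpha> s (z::'a)) \<partial>lborel) = 1"
proof -
  interpret prob_space M using assms by (simp add: stable_process_def)
  have "\<forall>s t. 0 \<le> s \<and> s < t \<longrightarrow>
        distributed M lborel (\<lambda>\<omega>. X t \<omega> - X s \<omega>) (\<lambda>z. ennreal (stable_kernel \<alpha> (t - s) z))"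
    using assms(1) unfolding stable_process_def by (elim conjE)
  from this[rule_format, of 0 s] assms(2)
  have "distributed M lborel (\<lambda>\<omega>. X s \<omega> - X 0 \<omega>) (\<lambda>z. ennreal (stable_kernel \<alpha> s z))" by simp
  from distributed_nn_integral[OF this, of "\<lambda>_. 1"] show ?thesis by (simp add: emeasure_space_1)
qed

text \<open>For x = 0 all terms vanish by convention: the kernel is 0 at positive times and
  \<open>powr\<close> is 0 at base 0. For other x the path representation and the almost sure
  equality of the two weights translate the weighted moments. Time 0, where nothing is known of the
  kernel, is a null set in both cases.\<close>

lemma fk_moment:
  fixes \<alpha> \<beta> \<delta> t :: real and pt :: "real \<Rightarrow> 'a::euclidean_space \<Rightarrow> 'a \<Rightarrow> real" and x :: 'a
  assumes "0 < \<alpha>" and "\<alpha> < min (real DIM('a)) 2"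
    and "0 < \<delta>" and "\<delta> < \<alpha>"
    and fk: "is_fk_kernel \<alpha> \<delta> pt TYPE('b)"
    and \<beta>: "0 < \<beta>" "\<beta> < \<alpha>" and t: "t > 0"
  defines "a \<equiv> \<integral>\<^sup>+ y. ennreal (pt t x y * norm y powr \<beta>) \<partial>lborel"
  defines "C \<equiv> \<integral>\<^sup>+ s. indicator {0..t} s * (\<integral>\<^sup>+ y. ennreal (pt s x y * norm y powr (\<beta> - \<alpha>)) \<partial>lborel) \<partial>lborel"
  shows "a < \<infinity> \<and> C < \<infinity> \<and> enn2real a = norm x powr \<beta> + (kappa DIM('a) \<alpha> \<delta> - kappa DIM('a) \<alpha> \<beta>) * enn2real C"
proof (cases "x = 0")
  case True
  have pt0: "pt s 0 y = 0" if "s > 0" for s y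
    using fk[unfolded is_fk_kernel_def, THEN conjunct2, THEN conjunct2, THEN conjunct2, THEN conjunct1] that by simp
  have "a = 0" unfolding a_def True using pt0[OF t] by simp
  moreover have "C = (\<integral>\<^sup>+ s. 0 \<partial>(lborel :: real measure))"
    unfolding C_def True
  proof (rule nn_integral_cong_AE)
    have "AE s in lborel. s \<noteq> (0::real)" by (rule AE_lborel_singleton)
    then show "AE s in lborel. indicator {0..t} s * (\<integral>\<^sup>+ y. ennreal (pt s 0 y * norm y powr (\<beta> - \<alpha>)) \<partial>lborel) = 0"
    proof eventually_elim
      case (elim s)
      then show ?case using pt0[of s] by (cases "s > 0") (auto simp: indicator_def)
    qed
  qed
  ultimately show ?thesis using True by simp
next
  case False
  note fk_rep = fk[unfolded is_fk_kernel_def, THEN conjunct2, THEN conjunct2, THEN conjunct2, THEN conjunct2,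
      THEN conjunct2, rule_format, OF False]
  obtain M :: "'b measure" and X where X: "stable_process \<alpha> M X x"
    and rep: "\<And>s f. s > 0 \<Longrightarrow> f \<in> borel_measurable borel \<Longrightarrow>
       (\<integral>\<^sup>+ y. f y * ennreal (pt s x y) \<partial>lborel) = (\<integral>\<^sup>+ \<omega>. f (X s \<omega>) * ennreal (fk_weight (hardy_pot \<alpha> \<delta>) X s \<omega>) \<partial>M)"
    using fk_rep by (elim exE conjE) (simp only: simp_thms atomize_all atomize_imp)
  have pos: "0 \<le> pt s x y" if "s > 0" for s y
    using fk[unfolded is_fk_kernel_def, THEN conjunct1] that by simp
  interpret prob_space M using X by (simp add: stable_process_def)
  interpret stable_path \<alpha> "stable_kernel \<alpha>" M X x
    by standard (use assms(1,2) X stable_process_mass[OF X] in auto)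
  define V where "V = (\<lambda>y::'a. - kappa DIM('a) \<alpha> \<delta> * norm y powr (- \<alpha>))"
  have [measurable]: "V \<in> borel_measurable borel" unfolding V_def by measurable
  have K: "kappa DIM('a) \<alpha> \<delta> < 0" using assms by (intro kappa_neg) auto
  have V: "0 \<le> V y" for y using K by (simp add: V_def mult_nonpos_nonneg)
  \<comment> \<open>The origin is no exception: division by 0 on one side and \<open>powr\<close> at
    base 0 on the other both give 0.\<close>
  have hp: "hardy_pot \<alpha> \<delta> = (\<lambda>y::'a. - V y)"
    by (auto simp: hardy_pot_def V_def powr_minus_divide)
  have finV: "(\<integral>\<^sup>+ r. indicator {0..u} r * P r (\<lambda>y. ennreal (V y)) x \<partial>lborel) < \<infinity>" if "u > 0" for u
    unfolding V_def using K that False by (intro scaled_riesz_potential_finite) auto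
  have rep': "(\<integral>\<^sup>+ y. ennreal (pt s x y * norm y powr g) \<partial>lborel) = (\<integral>\<^sup>+ \<omega>. ennreal (norm (X s \<omega>) powr g) * ennreal (weight V s \<omega>) \<partial>M)"
    if s: "s > 0" for s g
  proof -
    have "(\<integral>\<^sup>+ y. ennreal (pt s x y * norm y powr g) \<partial>lborel) = (\<integral>\<^sup>+ y. ennreal (norm y powr g) * ennreal (pt s x y) \<partial>lborel)"
      using pos[OF s] by (intro nn_integral_cong) (simp add: ennreal_mult mult.commute)
    also have "\<dots> = (\<integral>\<^sup>+ \<omega>. ennreal (norm (X s \<omega>) powr g) * ennreal (fk_weight (hardy_pot \<alpha> \<delta>) X s \<omega>) \<partial>M)"
      by (rule rep[OF s]) measurable
    also have "\<dots> = (\<integral>\<^sup>+ \<omega>. ennreal (norm (X s \<omega>) powr g) * ennreal (weight V s \<omega>) \<partial>M)"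
      unfolding hp by (rule nn_integral_cong_AE) (use fk_weight_eq_weight[OF s _ V finV[OF s]] in \<open>auto elim: eventually_mono\<close>)
    finally show ?thesis .
  qed
  have a: "a = (\<integral>\<^sup>+ \<omega>. ennreal (norm (X t \<omega>) powr \<beta>) * ennreal (weight V t \<omega>) \<partial>M)"
    unfolding a_def by (rule rep'[OF t])
  have C: "C = (\<integral>\<^sup>+ s. indicator {0..t} s * (\<integral>\<^sup>+ \<omega>. ennreal (norm (X s \<omega>) powr (\<beta> - \<alpha>)) * ennreal (weight V s \<omega>) \<partial>M) \<partial>lborel)"
    unfolding C_def
  proof (rule nn_integral_cong_AE)
    have "AE s in lborel. s \<noteq> (0::real)" by (rule AE_lborel_singleton)
    then show "AE s in lborel. indicator {0..t} s * (\<integral>\<^sup>+ y. ennreal (pt s x y * norm y powr (\<beta> - \<alpha>)) \<partial>lborel) =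
      indicator {0..t} s * (\<integral>\<^sup>+ \<omega>. ennreal (norm (X s \<omega>) powr (\<beta> - \<alpha>)) * ennreal (weight V s \<omega>) \<partial>M)"
    proof eventually_elim
      case (elim s)
      then show ?case using rep'[of s "\<beta> - \<alpha>"] by (cases "s > 0") (auto simp: indicator_def)
    qed
  qed
  show ?thesis
    using weighted_moment[OF False \<beta> assms(3,4) t] unfolding a C V_def by auto
qed

theorem theorem2p4:
  fixes \<alpha> \<delta> :: real
    and pt :: "real \<Rightarrow> 'a::euclidean_space \<Rightarrow> 'a \<Rightarrow> real"
  assumes "0 < \<alpha>" and "\<alpha> < min (real DIM('a)) 2"
    and "0 < \<delta>" and "\<delta> < \<alpha>"
    and "is_fk_kernel \<alpha> \<delta> pt TYPE('b)"
  shows "(\<forall>\<beta>. 0 < \<beta> \<and> \<beta> < \<alpha> \<longrightarrow> (\<forall>t>0. \<forall>x::'a.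
            (\<integral>\<^sup>+ y. ennreal (pt t x y * norm y powr \<beta>) \<partial>lborel) < \<infinity> \<and>
            (\<integral>\<^sup>+ s. indicator {0..t} s *
                 (\<integral>\<^sup>+ y. ennreal (pt s x y * norm y powr (\<beta> - \<alpha>)) \<partial>lborel) \<partial>lborel) < \<infinity> \<and>
            enn2real (\<integral>\<^sup>+ y. ennreal (pt t x y * norm y powr \<beta>) \<partial>lborel) =
              norm x powr \<beta> + (kappa DIM('a) \<alpha> \<delta> - kappa DIM('a) \<alpha> \<beta>) *
              enn2real (\<integral>\<^sup>+ s. indicator {0..t} s *
                 (\<integral>\<^sup>+ y. ennreal (pt s x y * norm y powr (\<beta> - \<alpha>)) \<partial>lborel) \<partial>lborel)))
       \<and> (\<forall>t>0. \<forall>x::'a.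
            (\<integral>\<^sup>+ y. ennreal (pt t x y * norm y powr \<delta>) \<partial>lborel) = ennreal (norm x powr \<delta>))"
proof (intro conjI[OF allI allI] impI allI)
  fix \<beta> t :: real and x :: 'a
  assume "0 < \<beta> \<and> \<beta> < \<alpha>" "0 < t"
  then show "(\<integral>\<^sup>+ y. ennreal (pt t x y * norm y powr \<beta>) \<partial>lborel) < \<infinity> \<and>
            (\<integral>\<^sup>+ s. indicator {0..t} s *
                 (\<integral>\<^sup>+ y. ennreal (pt s x y * norm y powr (\<beta> - \<alpha>)) \<partial>lborel) \<partial>lborel) < \<infinity> \<and>
            enn2real (\<integral>\<^sup>+ y. ennreal (pt t x y * norm y powr \<beta>) \<partial>lborel) =
              norm x powr \<beta> + (kappa DIM('a) \<alpha> \<delta> - kappa DIM('a) \<alpha> \<beta>) *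
              enn2real (\<integral>\<^sup>+ s. indicator {0..t} s *
                 (\<integral>\<^sup>+ y. ennreal (pt s x y * norm y powr (\<beta> - \<alpha>)) \<partial>lborel) \<partial>lborel)"
    using fk_moment[OF assms, of \<beta> t x] by blast
next
  fix t :: real and x :: 'a
  assume "0 < t"
  \<comment> \<open>With \<beta> = \<delta> the coefficient of the time integral is 0; finiteness of
    the moment then lifts the real identity back to \<open>ennreal\<close>.\<close>
  then have "(\<integral>\<^sup>+ y. ennreal (pt t x y * norm y powr \<delta>) \<partial>lborel) < \<infinity>"
    and "enn2real (\<integral>\<^sup>+ y. ennreal (pt t x y * norm y powr \<delta>) \<partial>lborel) = norm x powr \<delta>"
    using fk_moment[OF assms assms(3,4), of t x] by auto
  then show "(\<integral>\<^sup>+ y. ennreal (pt t x y * norm y powr \<delta>) \<partial>lborel) = ennreal (norm x powr \<delta>)"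
    by (metis ennreal_enn2real infinity_ennreal_def)
qed

end
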